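(* Let $\lambda_0,\lambda_1>0$ and $\gamma_0>\gamma_1$ be real numbers, let $\Gamma$ be the associated telegraph process, and let $\mathcal T(y)=\min\{t>0: \Gamma(t)=y\}$ (with $\mathcal T(y)=\infty$ if the level is never reached). For $i\in\{0,1\}$ let $F_i(\mathrm dt;y)=\mathrm P_i\{\mathcal T(y)\in \mathrm dt\}$, and for $n\ge 1$ let $f_i(t,y;n)$ denote the density in $t$ of the measure $\mathrm P_i\{\mathcal T(y)\in \mathrm dt,\ N(\mathcal T(y))=n\}$. (1) Suppose $y$ and both velocities $\gamma_0,\gamma_1$ have the same sign (all positive or all negative), and let $\Delta(y)$ be the segment with endpoints $y/\gamma_0$ and $y/\gamma_1$. Then $\mathcal T(y)$ is almost surely bounded, $\mathrm P\{\mathcal T(y)\in\Delta(y)\}=1$, and for $i\in\{0,1\}$, $n\ge0$, $$f_i(t,y;2n+1)=\lambda_i|\gamma_{1-i}|\frac{z(t,y)^n}{n!^2}\,\theta(t,y)\,\mathbf 1_{\{t\in\Delta(y)\}},$$ $$f_i(t,y;2n+2)=\lambda_0\lambda_1|\gamma_i|\,\xi_i(t,y)\frac{z(t,y)^n}{n!(n+1)!}\,\theta(t,y)\,\mathbf 1_{\{t\in\Delta(y)\}}.$$ Further, $$F_0(\mathrm dt;y)=e^{-\lambda_0y/\gamma_0}\delta_{y/\gamma_0}(\mathrm dt)+\lambda_0\Big(|\gamma_1|\,\mathcal I_0(t,y)+\lambda_1|\gamma_0|\,\xi_0(t,y)\,\mathcal I_1(t,y)\Big)\theta(t,y)\mathbf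 1_{\{t\in\Delta(y)\}}\,\mathrm dt,$$ $$F_1(\mathrm dt;y)=e^{-\lambda_1y/\gamma_1}\delta_{y/\gamma_1}(\mathrm dt)+\lambda_1\Big(|\gamma_0|\,\mathcal I_0(t,y)+\lambda_0|\gamma_1|\,\xi_1(t,y)\,\mathcal I_1(t,y)\Big)\theta(t,y)\mathbf 1_{\{t\in\Delta(y)\}}\,\mathrm dt.$$ In the cases $y<0<\gamma_1\le\gamma_0$ and $y>0>\gamma_0\ge\gamma_1$, the level $y$ is never reached: $\mathcal T(y)=\infty$ almost surely. (2) Suppose $\gamma_0>0>\gamma_1$ and $y>0$. Then for all $n\ge0$, $$f_0(t,y;2n+1)\equiv0,\qquad f_1(t,y;2n+2)\equiv0,$$ $$f_1(t,y;2n+1)=\frac{\lambda_1}{\xi_0(t,y)}\cdot\frac{z(t,y)^n}{n!^2}\,\theta(t,y)\Big(y-\frac{\gamma_1}{n+1}\xi_1(t,y)\Big)\mathbf 1_{\{t>y/\gamma_0\}},$$ $$f_0(t,y;2n+2)=\lambda_0\lambda_1\,y\,\frac{z(t,y)^n}{n!(n+1)!}\,\theta(t,y)\,\mathbf 1_{\{t>y/\gamma_0\}}.$$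
   Context: $\varepsilon=\varepsilon(t)\in\{0,1\}$, $t\ge0$, is a two-state continuous-time Markov process which leaves state $i$ at rate $\lambda_i$ (so holding times in state $i$ are exponential with parameter $\lambda_i$) and switches to state $1-i$. $\mathrm P_i\{\cdot\}=\mathrm P\{\cdot\mid\varepsilon(0)=i\}$. $N(t)$ is the number of switchings of $\varepsilon$ up to time $t$, $N(0)=0$. The (integrated, asymmetric) telegraph process is $\Gamma(t)=\int_0^t\gamma_{\varepsilon(s)}\,\mathrm ds$. Notation: $$\xi_0(t,x)=\frac{x-\gamma_1t}{\gamma_0-\gamma_1},\qquad \xi_1(t,x)=t-\xi_0(t,x)=\frac{\gamma_0t-x}{\gamma_0-\gamma_1},$$ $$z(t,x)=\lambda_0\lambda_1\xi_0(t,x)\xi_1(t,x),\qquad \theta(t,x)=\frac{\exp(-\lambda_0\xi_0(t,x)-\lambda_1\xi_1(t,x))}{\gamma_0-\gamma_1},$$ $$\mathcal I_0(t,x)=\sum_{n=0}^\infty\frac{z(t,x)^n}{n!^2},\qquad \mathcal I_1(t,x)=\sum_{n=0}^\infty\frac{z(t,x)^n}{n!(n+1)!}.$$ $\delta_a$ is the Dirac measure at $a$. Densities are understood up to Lebesgue-null sets of $t$. *)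

theory Defs
  imports "HOL-Probability.Probability"
begin

definition cadlag_path :: "(real \<Rightarrow> 'b::topological_space) \<Rightarrow> bool" where
  "cadlag_path x \<longleftrightarrow>
     (\<forall>t\<ge>0. (x \<longlongrightarrow> x t) (at_right t)) \<and>
     (\<forall>t>0. \<exists>l. (x \<longlongrightarrow> l) (at_left t))"

text \<open>Time-homogeneous Markov process on the states \<open>0\<close>, \<open>1\<close>, indexed by \<open>t \<ge> 0\<close>, with
  transition function \<open>p h i j\<close> and transition rate \<open>lam i\<close> from \<open>i\<close> to \<open>1 - i\<close>.
  The initial distribution is arbitrary. In the discrete state space, \<open>cadlag_path\<close> says
  that a path is a right-continuous step function with finitely many switchings in every bounded
  time interval.\<close>

definition two_state_markov :: "'a measure \<Rightarrow> (nat \<Rightarrow> real) \<Rightarrow> (real \<Rightarrow> 'a \<Rightarrow> nat) \<Rightarrow> bool" where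
  "two_state_markov M lam \<epsilon> \<longleftrightarrow>
     prob_space M \<and>
     (\<forall>t\<ge>0. \<epsilon> t \<in> M \<rightarrow>\<^sub>M count_space {0, 1}) \<and>
     (\<forall>\<omega>\<in>space M. cadlag_path (\<lambda>t. \<epsilon> t \<omega>)) \<and>
     (\<exists>p :: real \<Rightarrow> nat \<Rightarrow> nat \<Rightarrow> real.
        (\<forall>(n::nat) (\<tau> :: nat \<Rightarrow> real) (s :: nat \<Rightarrow> nat).
           0 \<le> \<tau> 0 \<and> strict_mono_on {..Suc n} \<tau> \<and> (\<forall>k\<le>Suc n. s k \<in> {0, 1}) \<and>
           \<P>(\<omega> in M. \<forall>k\<le>n. \<epsilon> (\<tau> k) \<omega> = s k) > 0 \<longrightarrow>
           \<P>(\<omega> in M. \<epsilon> (\<tau> (Suc n)) \<omega> = s (Suc n) \<bar> \<forall>k\<le>n. \<epsilon> (\<tau> k) \<omega> = s k)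
             = p (\<tau> (Suc n) - \<tau> n) (s n) (s (Suc n))) \<and>
        (\<forall>i\<in>{0, 1}. ((\<lambda>h. p h i (1 - i) / h) \<longlongrightarrow> lam i) (at_right 0)))"

text \<open>The conditional probability given \<open>\<epsilon> 0 = i\<close>; meaningful only if that event has positive
  probability.\<close>

definition cond_start :: "'a measure \<Rightarrow> (real \<Rightarrow> 'a \<Rightarrow> nat) \<Rightarrow> nat \<Rightarrow> 'a measure" where
  "cond_start M \<epsilon> i = uniform_measure M {\<omega> \<in> space M. \<epsilon> 0 \<omega> = i}"

text \<open>A switching time is a left discontinuity of the right-continuous path.\<close>

definition switch_count :: "(real \<Rightarrow> 'a \<Rightarrow> nat) \<Rightarrow> real \<Rightarrow> 'a \<Rightarrow> nat" where
  "switch_count \<epsilon> t \<omega> =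
     card {s \<in> {0<..t}. \<not> ((\<lambda>u. \<epsilon> u \<omega>) \<longlongrightarrow> \<epsilon> s \<omega>) (at_left s)}"

definition telegraph :: "(nat \<Rightarrow> real) \<Rightarrow> (real \<Rightarrow> 'a \<Rightarrow> nat) \<Rightarrow> real \<Rightarrow> 'a \<Rightarrow> real" where
  "telegraph \<gamma> \<epsilon> t \<omega> = integral {0..t} (\<lambda>s. \<gamma> (\<epsilon> s \<omega>))"

text \<open>For \<open>y \<noteq> 0\<close> the minimum exists whenever the level is reached, since \<open>telegraph\<close> is
  continuous in time and vanishes at time \<open>0\<close>.\<close>

definition passage_time :: "(nat \<Rightarrow> real) \<Rightarrow> (real \<Rightarrow> 'a \<Rightarrow> nat) \<Rightarrow> real \<Rightarrow> 'a \<Rightarrow> ereal" where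
  "passage_time \<gamma> \<epsilon> y \<omega> =
     (if \<exists>t>0. telegraph \<gamma> \<epsilon> t \<omega> = y
      then ereal (LEAST t. 0 < t \<and> telegraph \<gamma> \<epsilon> t \<omega> = y)
      else \<infinity>)"

definition passage_law ::
  "'a measure \<Rightarrow> (nat \<Rightarrow> real) \<Rightarrow> (real \<Rightarrow> 'a \<Rightarrow> nat) \<Rightarrow> real \<Rightarrow> ereal measure" where
  "passage_law P \<gamma> \<epsilon> y = distr P borel (passage_time \<gamma> \<epsilon> y)"

text \<open>\<open>f\<close> is a version of the Lebesgue density in \<open>t\<close> of the measure on the real line that gives a
  Borel set \<open>A\<close> the \<open>P\<close>-probability that the passage time lies in \<open>A\<close> and that exactly \<open>n\<close>
  switchings occur up to the passage time. The events are required to be measurable because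
  \<open>emeasure\<close> is \<open>0\<close> on non-measurable sets.\<close>

definition passage_density ::
  "'a measure \<Rightarrow> (nat \<Rightarrow> real) \<Rightarrow> (real \<Rightarrow> 'a \<Rightarrow> nat) \<Rightarrow> real \<Rightarrow> nat \<Rightarrow> (real \<Rightarrow> real) \<Rightarrow> bool" where
  "passage_density P \<gamma> \<epsilon> y n f \<longleftrightarrow>
     f \<in> borel_measurable borel \<and> (\<forall>t. 0 \<le> f t) \<and>
     (\<forall>A\<in>sets borel.
        {\<omega> \<in> space P. \<exists>t\<in>A. passage_time \<gamma> \<epsilon> y \<omega> = ereal t \<and> switch_count \<epsilon> t \<omega> = n} \<in> sets P \<and>
        emeasure P {\<omega> \<in> space P. \<exists>t\<in>A. passage_time \<gamma> \<epsilon> y \<omega> = ereal t \<and> switch_count \<epsilon> t \<omega> = n}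
          = (\<integral>\<^sup>+t\<in>A. ennreal (f t) \<partial>lborel))"

definition tel_xi :: "(nat \<Rightarrow> real) \<Rightarrow> nat \<Rightarrow> real \<Rightarrow> real \<Rightarrow> real" where
  "tel_xi \<gamma> i t x =
     (if i = 0 then (x - \<gamma> 1 * t) / (\<gamma> 0 - \<gamma> 1) else (\<gamma> 0 * t - x) / (\<gamma> 0 - \<gamma> 1))"

definition tel_z :: "(nat \<Rightarrow> real) \<Rightarrow> (nat \<Rightarrow> real) \<Rightarrow> real \<Rightarrow> real \<Rightarrow> real" where
  "tel_z lam \<gamma> t x = lam 0 * lam 1 * tel_xi \<gamma> 0 t x * tel_xi \<gamma> 1 t x"

definition tel_theta :: "(nat \<Rightarrow> real) \<Rightarrow> (nat \<Rightarrow> real) \<Rightarrow> real \<Rightarrow> real \<Rightarrow> real" where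
  "tel_theta lam \<gamma> t x =
     exp (- lam 0 * tel_xi \<gamma> 0 t x - lam 1 * tel_xi \<gamma> 1 t x) / (\<gamma> 0 - \<gamma> 1)"

definition tel_I0 :: "(nat \<Rightarrow> real) \<Rightarrow> (nat \<Rightarrow> real) \<Rightarrow> real \<Rightarrow> real \<Rightarrow> real" where
  "tel_I0 lam \<gamma> t x = (\<Sum>n. tel_z lam \<gamma> t x ^ n / (fact n)\<^sup>2)"

definition tel_I1 :: "(nat \<Rightarrow> real) \<Rightarrow> (nat \<Rightarrow> real) \<Rightarrow> real \<Rightarrow> real \<Rightarrow> real" where
  "tel_I1 lam \<gamma> t x = (\<Sum>n. tel_z lam \<gamma> t x ^ n / (fact n * fact (n + 1)))"

end

theory Submission
  imports Defs
begin

text \<open>Sampling the process on a grid of mesh \<open>d\<close> gives a Markov chain whose holding times are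
  independent and geometric; since the paths are right-continuous step functions, letting
  \<open>d\<close> tend to \<open>0\<close> shows that the holding times of the process are independent and exponential.
  The passage time and the number of switchings up to it are functions of the holding times, and
  splitting off the first holding time \<open>h\<close> in state \<open>i\<close> replaces the pair (level, time) \<open>(y, t)\<close>
  by \<open>(y - \<gamma> i * h, t - h)\<close>. This shift lowers the time \<open>\<xi> i\<close> spent in state \<open>i\<close> by \<open>h\<close>, leaves
  the time spent in the other state unchanged, and turns \<open>exp (- lam i * h)\<close> times the
  exponential weight into the weight at \<open>(y, t)\<close>. The densities are therefore this weight times
  polynomials in the two occupation times, obtained one switching at a time by integrating
  polynomials in \<open>h\<close>. The case \<open>y < 0\<close> follows by reflecting level and velocities.\<close>

section \<open>Crossing times of piecewise constant paths\<close>

text \<open>The Markov property gives conditional probabilities at finitely many fixed times,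
  whereas switchings and passages happen at random times. As the mesh shrinks, a strict inequality
  between a holding time and a threshold is decided eventually, but a tie is not. So the tails get
  an upper bound at thresholds \<open>c\<close> and a lower bound, through complements, at
  thresholds \<open>c' > c\<close>; continuity of the exponential closes the gap. The recursion on
  switchings cannot begin at 0, where the law is an atom at \<open>y / v i\<close>. It begins at 1,
  where the passage time is affine in the single holding time that was completed. A further
  switching shifts one occupation time only, so the factor in the other one is constant under the
  integral; integrating a power gains \<open>1 / (n + 1)\<close>, and alternating states build up
  \<open>n!^2\<close> and \<open>n! (n + 1)!\<close>. For velocities of opposite sign, an ascending
  leg must end below \<open>y\<close>, which cuts the range of integration; the integral stays
  closed because the integrand is an exact derivative whose primitive vanishes at the cut.\<close>

definition alt :: "nat \<Rightarrow> nat \<Rightarrow> nat" where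
  "alt i j = (if even j then i else 1 - i)"

lemma alt_0 [simp]: "alt i 0 = i"
  by (simp add: alt_def)

lemma alt_Suc: "i \<in> {0, 1} \<Longrightarrow> alt i (Suc j) = alt (1 - i) j"
  by (auto simp: alt_def)

lemma alt_Suc': "i \<in> {0, 1} \<Longrightarrow> alt i (Suc j) = 1 - alt i j"
  by (auto simp: alt_def)

lemma alt_in: "i \<in> {0, 1} \<Longrightarrow> alt i j \<in> {0, 1}"
  by (auto simp: alt_def)

lemma alt_Suc_neq: "i \<in> {0, 1} \<Longrightarrow> alt i (Suc j) \<noteq> alt i j"
  by (auto simp: alt_def)

definition elapsed :: "(nat \<Rightarrow> real) \<Rightarrow> nat \<Rightarrow> real" where
  "elapsed h n = (\<Sum>k<n. h k)"

definition level :: "(nat \<Rightarrow> real) \<Rightarrow> nat \<Rightarrow> (nat \<Rightarrow> real) \<Rightarrow> nat \<Rightarrow> real" where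
  "level v i h n = (\<Sum>k<n. v (alt i k) * h k)"

text \<open>In \<open>crosses\<close> only the level at the last switching may equal \<open>y\<close>: a switching at the passage time
  itself is counted.\<close>

definition crosses :: "(nat \<Rightarrow> real) \<Rightarrow> nat \<Rightarrow> real \<Rightarrow> nat \<Rightarrow> (nat \<Rightarrow> real) \<Rightarrow> bool" where
  "crosses v i y n h \<longleftrightarrow> (\<forall>k<n. level v i h k < y) \<and> level v i h n \<le> y \<and>
     0 \<le> (y - level v i h n) / v (alt i n) \<and> (y - level v i h n) / v (alt i n) < h n"

definition cross_time :: "(nat \<Rightarrow> real) \<Rightarrow> nat \<Rightarrow> real \<Rightarrow> nat \<Rightarrow> (nat \<Rightarrow> real) \<Rightarrow> real" where
  "cross_time v i y n h = elapsed h n + (y - level v i h n) / v (alt i n)"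

lemma elapsed_0 [simp]: "elapsed h 0 = 0"
  by (simp add: elapsed_def)

lemma elapsed_Suc: "elapsed h (Suc n) = elapsed h n + h n"
  by (simp add: elapsed_def)

lemma level_0 [simp]: "level v i h 0 = 0"
  by (simp add: level_def)

lemma level_Suc: "level v i h (Suc n) = level v i h n + v (alt i n) * h n"
  by (simp add: level_def)

lemma elapsed_Suc_shift: "elapsed h (Suc n) = h 0 + elapsed (\<lambda>k. h (Suc k)) n"
  unfolding elapsed_def by (rule sum.lessThan_Suc_shift)

lemma level_Suc_shift:
  "i \<in> {0, 1} \<Longrightarrow> level v i h (Suc n) = v i * h 0 + level v (1 - i) (\<lambda>k. h (Suc k)) n"
  unfolding level_def by (subst sum.lessThan_Suc_shift) (simp only: alt_Suc alt_0)

text \<open>Splitting off a leg leaves the same crossing problem with exchanged states, level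
  \<open>y - v i * h 0\<close> and shifted holding times. The conjunct \<open>0 < y\<close> is the
  strict inequality at \<open>k = 0\<close>, where the level is 0.\<close>

lemma crosses_Suc:
  assumes "i \<in> {0, 1}"
  shows "crosses v i y (Suc n) h \<longleftrightarrow> 0 < y \<and> crosses v (1 - i) (y - v i * h 0) n (\<lambda>k. h (Suc k))"
  unfolding crosses_def level_Suc_shift[OF assms] alt_Suc[OF assms] All_less_Suc2
  by (auto simp: algebra_simps)

lemma cross_time_Suc:
  assumes "i \<in> {0, 1}"
  shows "cross_time v i y (Suc n) h = h 0 + cross_time v (1 - i) (y - v i * h 0) n (\<lambda>k. h (Suc k))"
  unfolding cross_time_def level_Suc_shift[OF assms] elapsed_Suc_shift alt_Suc[OF assms]
  by (simp add: algebra_simps)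

section \<open>Paths described by a sequence of holding times up to a horizon\<close>

definition skeleton :: "real \<Rightarrow> nat \<Rightarrow> (nat \<Rightarrow> real) \<Rightarrow> (real \<Rightarrow> nat) \<Rightarrow> bool" where
  "skeleton K i h x \<longleftrightarrow> (\<forall>j. 0 < h j) \<and> (\<forall>t. \<exists>j. t < elapsed h j) \<and>
     (\<forall>j t. elapsed h j \<le> t \<longrightarrow> t < elapsed h (Suc j) \<longrightarrow> t < K \<longrightarrow> x t = alt i j)"

lemma elapsed_strict_mono: "(\<And>j. 0 < h j) \<Longrightarrow> strict_mono (elapsed h)"
  by (rule strict_monoI_Suc) (simp add: elapsed_Suc)

lemma elapsed_interval:
  assumes h: "\<And>j. 0 < h j" and ex: "\<exists>j. t < elapsed h j" and t: "0 \<le> t"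
  obtains j where "elapsed h j \<le> t" "t < elapsed h (Suc j)"
proof -
  define m where "m = (LEAST j. t < elapsed h j)"
  have m: "t < elapsed h m" unfolding m_def using ex by (rule LeastI_ex)
  with t obtain j where j: "m = Suc j" by (cases m) auto
  have "\<not> t < elapsed h j" using not_less_Least[of j "\<lambda>j. t < elapsed h j"] j m_def by auto
  then show thesis using that m j by force
qed

context
  fixes K :: real and i :: nat and h :: "nat \<Rightarrow> real" and x :: "real \<Rightarrow> nat"
  assumes sk: "skeleton K i h x" and i: "i \<in> {0, 1}"
begin

lemma skeleton_pos: "0 < h j"
  using sk unfolding skeleton_def by blast

lemma skeleton_ex: "0 \<le> t \<Longrightarrow> \<exists>j. elapsed h j \<le> t \<and> t < elapsed h (Suc j)"
proof -
  assume "0 \<le> t"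
  moreover have "\<exists>j. t < elapsed h j" using sk unfolding skeleton_def by blast
  ultimately show ?thesis using elapsed_interval[of h t, OF skeleton_pos] by blast
qed

lemma skeleton_state: "elapsed h j \<le> t \<Longrightarrow> t < elapsed h (Suc j) \<Longrightarrow> t < K \<Longrightarrow> x t = alt i j"
  using sk unfolding skeleton_def by blast

lemma skeleton_elapsed_mono: "j \<le> k \<Longrightarrow> elapsed h j \<le> elapsed h k"
  by (simp add: strict_mono_less_eq[OF elapsed_strict_mono[of h, OF skeleton_pos]])

lemma skeleton_elapsed_less_iff: "elapsed h j < elapsed h k \<longleftrightarrow> j < k"
  by (rule strict_mono_less[OF elapsed_strict_mono[of h, OF skeleton_pos]])

lemma skeleton_elapsed_nonneg: "0 \<le> elapsed h j"
  using skeleton_elapsed_mono[of 0 j] by simp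

lemma skeleton_has_integral:
  assumes "elapsed h k \<le> t" "t \<le> elapsed h (Suc k)" "t \<le> K"
  shows "((\<lambda>s. v (x s)) has_integral level v i h k + v (alt i k) * (t - elapsed h k)) {0..t}"
  using assms
proof (induction k arbitrary: t)
  case 0
  have "((\<lambda>s. v (alt i 0)) has_integral v (alt i 0) * (t - 0)) {0..t}"
    using has_integral_const_real[of "v (alt i 0)" 0 t] 0 by (simp add: mult.commute)
  \<comment> \<open>At the endpoint \<open>t\<close> the path may already be in the next state, or
    \<open>t\<close> may be the horizon \<open>K\<close>, where nothing is known of it; a single
    point does not change the integral.\<close>
  then have "((\<lambda>s. v (x s)) has_integral v (alt i 0) * (t - 0)) {0..t}"
    by (rule has_integral_spike_finite[of "{t}", rotated 2])
       (use 0 skeleton_state[of 0] in \<open>auto simp: elapsed_Suc\<close>)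
  then show ?case by simp
next
  case (Suc k)
  let ?e = "elapsed h (Suc k)"
  have "((\<lambda>s. v (alt i (Suc k))) has_integral v (alt i (Suc k)) * (t - ?e)) {?e..t}"
    using has_integral_const_real[of "v (alt i (Suc k))" ?e t] Suc.prems by (simp add: mult.commute)
  then have 2: "((\<lambda>s. v (x s)) has_integral v (alt i (Suc k)) * (t - ?e)) {?e..t}"
    by (rule has_integral_spike_finite[of "{t}", rotated 2])
       (use Suc.prems skeleton_state[of "Suc k"] in auto)
  have 1: "((\<lambda>s. v (x s)) has_integral level v i h k + v (alt i k) * (?e - elapsed h k)) {0..?e}"
    using Suc.prems skeleton_elapsed_mono[of k "Suc k"] by (intro Suc.IH) auto
  have "((\<lambda>s. v (x s)) has_integral level v i h k + v (alt i k) * (?e - elapsed h k)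
      + v (alt i (Suc k)) * (t - ?e)) {0..t}"
    by (rule has_integral_combine[OF _ _ 1 2]) (use Suc.prems skeleton_elapsed_nonneg in auto)
  then show ?case by (simp add: level_Suc elapsed_Suc)
qed

text \<open>Inside a leg the path is constant just to the left of each point, while at the start of
  leg \<open>j > 0\<close> the state differs from the one just before. The index starts at 1 because
  time 0 is not a switching.\<close>

lemma skeleton_switch_set:
  assumes t: "elapsed h n \<le> t" "t < elapsed h (Suc n)" "t < K"
  shows "{s \<in> {0<..t}. \<not> (x \<longlongrightarrow> x s) (at_left s)} = elapsed h ` {1..n}"
proof (intro equalityI subsetI)
  fix s assume s: "s \<in> {s \<in> {0<..t}. \<not> (x \<longlongrightarrow> x s) (at_left s)}"
  then obtain j where j: "elapsed h j \<le> s" "s < elapsed h (Suc j)"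
    using skeleton_ex[of s] by auto
  have "elapsed h j = s"
  proof (rule ccontr)
    assume "elapsed h j \<noteq> s"
    with j have l: "elapsed h j < s" by simp
    have "\<forall>\<^sub>F u in at_left s. x u = x s"
      using eventually_at_left_real[OF l]
      by eventually_elim (use skeleton_state[of j] j s t in \<open>auto\<close>)
    then show False using s by (auto simp: tendsto_discrete)
  qed
  moreover have "j \<noteq> 0" using s calculation by (auto intro: Nat.gr0I)
  moreover have "elapsed h j < elapsed h (Suc n)" using s t calculation by auto
  then have "j \<le> n" using skeleton_elapsed_less_iff by auto
  ultimately show "s \<in> elapsed h ` {1..n}" by force
next
  fix s assume "s \<in> elapsed h ` {1..n}"
  then obtain j where j: "1 \<le> j" "j \<le> n" "s = elapsed h j" by auto
  then obtain k where k: "j = Suc k" by (cases j) auto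
  have l: "elapsed h k < s" using j k skeleton_elapsed_less_iff by simp
  have s: "0 < s" "s \<le> t" using skeleton_elapsed_less_iff[of 0 j] skeleton_elapsed_mono[of j n] j t by auto
  have xs: "x s = alt i j" using skeleton_state[of j s] j skeleton_elapsed_less_iff[of j "Suc j"] s t by auto
  have "\<not> (x \<longlongrightarrow> x s) (at_left s)"
  proof
    assume "(x \<longlongrightarrow> x s) (at_left s)"
    then have "\<forall>\<^sub>F u in at_left s. x u = x s" by (simp add: tendsto_discrete)
    with eventually_at_left_real[OF l] have "\<forall>\<^sub>F u in at_left s. False"
    proof eventually_elim
      case (elim u)
      then have "x u = alt i k" using skeleton_state[of k u] j k s t by auto
      then show ?case using elim(2) xs k alt_Suc_neq[OF i, of k] by simp
    qed
    then show False by (simp add: trivial_limit_at_left_real)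
  qed
  then show "s \<in> {s \<in> {0<..t}. \<not> (x \<longlongrightarrow> x s) (at_left s)}" using s by auto
qed

end

lemma skeleton_switch_count:
  assumes sk: "skeleton K i h (\<lambda>s. X s w)" and i: "i \<in> {0, 1}"
    and t: "elapsed h n \<le> t" "t < elapsed h (Suc n)" "t < K"
  shows "switch_count X t w = n"
proof -
  have "switch_count X t w = card (elapsed h ` {1..n})"
    unfolding switch_count_def using skeleton_switch_set[OF sk i t] by simp
  also have "\<dots> = n"
    using strict_mono_imp_inj_on[OF elapsed_strict_mono[OF skeleton_pos[OF sk i]]]
    by (subst card_image) (auto intro: inj_on_subset)
  finally show ?thesis .
qed

lemma skeleton_telegraph:
  assumes sk: "skeleton K i h (\<lambda>s. X s w)" and i: "i \<in> {0, 1}"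
    and t: "elapsed h n \<le> t" "t \<le> elapsed h (Suc n)" "t \<le> K"
  shows "telegraph v X t w = level v i h n + v (alt i n) * (t - elapsed h n)"
  unfolding telegraph_def by (rule integral_unique[OF skeleton_has_integral[OF sk i t]])

lemma telegraph_0 [simp]: "telegraph v X 0 w = 0"
  by (simp add: telegraph_def)

lemma telegraph_continuous:
  assumes sk: "skeleton K i h (\<lambda>s. X s w)" and i: "i \<in> {0, 1}" and t: "0 \<le> t" "t < K"
  shows "continuous_on {0..t} (\<lambda>t. telegraph v X t w)"
proof -
  obtain j where "elapsed h j \<le> t" "t < elapsed h (Suc j)"
    using skeleton_ex[OF sk i t(1)] by auto
  then have "((\<lambda>s. v (X s w)) integrable_on {0..t})"
    using skeleton_has_integral[OF sk i, of j t v] t by (auto simp: integrable_on_def)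
  then show ?thesis unfolding telegraph_def by (rule indefinite_integral_continuous_1)
qed

lemma telegraph_hits:
  assumes sk: "skeleton K i h (\<lambda>s. X s w)" and i: "i \<in> {0, 1}" and t: "0 \<le> t" "t < K"
    and y: "0 < y" "y \<le> telegraph v X t w"
  obtains s where "0 < s" "s \<le> t" "telegraph v X s w = y"
proof -
  have "\<exists>s\<ge>0. s \<le> t \<and> telegraph v X s w = y"
    by (rule IVT') (use y t telegraph_continuous[where X=X and w=w, OF sk i t] in auto)
  then obtain s where "0 \<le> s" "s \<le> t" "telegraph v X s w = y" by auto
  moreover from this y have "s \<noteq> 0" by (intro notI) simp
  ultimately show thesis using that[of s] by simp
qed

text \<open>\<open>LEAST\<close> over the reals is meaningful only if the minimum is attained. It
  is: in a bounded interval the times at level \<open>y\<close> form a compact set by continuity,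
  and 0 is not among them because the path starts at 0 and \<open>y\<close> is nonzero.\<close>

lemma passage_time_eq_ereal_iff:
  assumes c: "\<And>t. 0 \<le> t \<Longrightarrow> continuous_on {0..t} (\<lambda>t. telegraph v X t w)" and y: "y \<noteq> 0"
  shows "passage_time v X y w = ereal t \<longleftrightarrow>
    0 < t \<and> telegraph v X t w = y \<and> (\<forall>s. 0 < s \<longrightarrow> s < t \<longrightarrow> telegraph v X s w \<noteq> y)"
    (is "?L = ?R")
proof
  assume ?R
  then have "(LEAST t. 0 < t \<and> telegraph v X t w = y) = t"
    by (intro Least_equality) (auto simp: not_less[symmetric])
  then show ?L using \<open>?R\<close> by (auto simp: passage_time_def)
next
  assume L: ?L
  let ?g = "\<lambda>t. telegraph v X t w"
  obtain u where u: "0 < u" "?g u = y" using L by (auto simp: passage_time_def split: if_splits)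
  then have tL: "t = (LEAST t. 0 < t \<and> ?g t = y)"
    using L by (auto simp: passage_time_def split: if_splits)
  let ?C = "{s \<in> {0..u}. ?g s = y}"
  have "closed ?C" using c[of u] u by (intro continuous_closed_preimage_constant) auto
  then have "compact ?C"
    by (auto simp: compact_eq_bounded_closed intro: bounded_subset[OF bounded_closed_interval])
  moreover have "?C \<noteq> {}" using u by auto
  ultimately obtain m where m: "m \<in> ?C" "\<forall>s\<in>?C. m \<le> s"
    using compact_attains_inf by blast
  have "m \<noteq> 0" using m y by (intro notI) auto
  then have m0: "0 < m" using m by auto
  have lem: "m \<le> s" if "0 < s" "?g s = y" for s
    using m that by (cases "s \<le> u") auto
  have "(LEAST t. 0 < t \<and> ?g t = y) = m"
    using m m0 lem by (intro Least_equality) auto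
  then show ?R using tL m m0 lem by force
qed

text \<open>The path is linear between switchings, so a first passage from below is a condition on
  the levels at the switchings. In one direction the intermediate value theorem excludes reaching
  \<open>y\<close> before \<open>t\<close>; in the other, values within a leg are convex
  combinations of the levels at its ends.\<close>

lemma passage_iff_crosses:
  assumes sk: "skeleton K i h (\<lambda>s. X s w)" and i: "i \<in> {0, 1}" and t: "t < K"
    and c: "\<And>t. 0 \<le> t \<Longrightarrow> continuous_on {0..t} (\<lambda>t. telegraph v X t w)"
    and y: "0 < y" and v: "\<And>j. v (alt i j) \<noteq> 0"
  shows "passage_time v X y w = ereal t \<and> switch_count X t w = n \<longleftrightarrow>
    crosses v i y n h \<and> t = cross_time v i y n h"
proof
  let ?g = "\<lambda>t. telegraph v X t w"
  assume L: "passage_time v X y w = ereal t \<and> switch_count X t w = n"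
  then have t0: "0 < t" and gt: "?g t = y" and first: "\<And>s. 0 < s \<Longrightarrow> s < t \<Longrightarrow> ?g s \<noteq> y"
    using passage_time_eq_ereal_iff[OF c] y by auto
  obtain k where k: "elapsed h k \<le> t" "t < elapsed h (Suc k)"
    using skeleton_ex[OF sk i, of t] t0 by auto
  have kn: "k = n" using skeleton_switch_count[where X=X and w=w, OF sk i k t] L by simp
  note k = k[unfolded kn]
  have gy: "y = level v i h n + v (alt i n) * (t - elapsed h n)"
    using skeleton_telegraph[where v=v and X=X and w=w, OF sk i k(1) less_imp_le[OF k(2)] less_imp_le[OF t]] gt by simp
  then have d: "(y - level v i h n) / v (alt i n) = t - elapsed h n"
    using v[of n] by (simp add: field_simps)
  have lev: "?g (elapsed h j) = level v i h j" if "j \<le> n" for j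
    using skeleton_telegraph[where v=v and X=X and w=w, OF sk i, of j "elapsed h j"] skeleton_elapsed_mono[OF sk i, of j "Suc j"]
      skeleton_elapsed_mono[OF sk i that] k t by simp
  have below: "?g s < y" if s: "0 \<le> s" "s < t" for s
  proof (rule ccontr)
    assume "\<not> ?g s < y"
    then obtain r where "0 < r" "r \<le> s" "?g r = y"
      using telegraph_hits[where X=X and w=w, OF sk i, of s y v] s y t by auto
    then show False using first[of r] s by auto
  qed
  have "level v i h j < y" if "j < n" for j
    using below[of "elapsed h j"] lev[of j] that k skeleton_elapsed_less_iff[OF sk i, of j n] skeleton_elapsed_nonneg[OF sk i, of j]
    by simp
  \<comment> \<open>If the last switching happens at \<open>t\<close> itself, its level is
    \<open>y\<close>; hence only the weak inequality at index \<open>n\<close>.\<close>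
  moreover have "level v i h n \<le> y"
    using below[of "elapsed h n"] lev[of n] k gt skeleton_elapsed_nonneg[OF sk i, of n]
    by (cases "elapsed h n = t") auto
  ultimately show "crosses v i y n h \<and> t = cross_time v i y n h"
    unfolding crosses_def cross_time_def d using k by (auto simp: elapsed_Suc)
next
  let ?g = "\<lambda>t. telegraph v X t w"
  assume R: "crosses v i y n h \<and> t = cross_time v i y n h"
  then have d: "(y - level v i h n) / v (alt i n) = t - elapsed h n"
    by (simp add: cross_time_def)
  then have gy: "y = level v i h n + v (alt i n) * (t - elapsed h n)"
    using v[of n] by (simp add: field_simps)
  have k: "elapsed h n \<le> t" "t < elapsed h (Suc n)"
    and lt: "\<And>j. j < n \<Longrightarrow> level v i h j < y" and le: "level v i h n \<le> y"
    using R unfolding crosses_def d by (auto simp: elapsed_Suc)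
  have g: "?g s = level v i h j + v (alt i j) * (s - elapsed h j)"
    if "elapsed h j \<le> s" "s \<le> elapsed h (Suc j)" "s \<le> t" for j s
    using skeleton_telegraph[where v=v and X=X and w=w, OF sk i that(1,2)] that t by simp
  have gt: "?g t = y" using g[of n t] k gy by simp
  have t0: "0 < t"
    using k skeleton_elapsed_nonneg[OF sk i, of n] gt y by (cases "t = 0") auto
  have below: "?g s < y" if s: "0 \<le> s" "s < t" for s :: real
  proof -
    obtain j where j: "elapsed h j \<le> s" "s < elapsed h (Suc j)"
      using skeleton_ex[OF sk i s(1)] by auto
    have "elapsed h j < elapsed h (Suc n)" using j s k by simp
    then have jn: "j \<le> n" using skeleton_elapsed_less_iff[OF sk i] by auto
    have gs: "?g s = level v i h j + v (alt i j) * (s - elapsed h j)" using g j s by simp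
    show ?thesis
    proof (cases "j = n")
      case True
      \<comment> \<open>On the last leg the distance to \<open>y\<close> shrinks linearly to 0 at
        time \<open>t\<close>; \<open>p\<close> is the fraction of it that is left at time
        \<open>s\<close>.\<close>
      define p where "p = (t - s) / (t - elapsed h n)"
      have td: "0 < t - elapsed h n" using j s True by simp
      have "level v i h n \<noteq> y" using gy v[of n] td by auto
      then have "level v i h n < y" using le by simp
      moreover have "y - ?g s = (y - level v i h n) * p"
      proof -
        have "y - level v i h n = v (alt i n) * (t - elapsed h n)" using gy by simp
        then have "(y - level v i h n) * p = v (alt i n) * (t - s)" unfolding p_def using td by simp
        also have "\<dots> = y - ?g s" unfolding gs True using gy by (simp add: algebra_simps)
        finally show ?thesis ..
      qed
      moreover have "0 < p" unfolding p_def using td s by simp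
      ultimately show ?thesis by (metis diff_gt_0_iff_gt mult_pos_pos)
    next
      case False
      then have jn: "j < n" using jn by simp
      \<comment> \<open>\<open>p\<close> is the fraction of the leg covered at time
        \<open>s\<close>. The end level may equal \<open>y\<close> when the next leg is the last, so
        strictness comes from the start level, whose weight \<open>1 - p\<close> is
        positive.\<close>
      define p where "p = (s - elapsed h j) / h j"
      have h: "0 < h j" by (rule skeleton_pos[OF sk i])
      have p: "0 \<le> p" "p < 1" unfolding p_def using h j by (auto simp: elapsed_Suc)
      have l1: "level v i h (Suc j) \<le> y"
        using lt[of "Suc j"] le jn by (cases "Suc j = n") auto
      have "?g s = (1 - p) * level v i h j + p * level v i h (Suc j)"
        unfolding gs level_Suc p_def using h by (simp add: field_simps)
      also have "\<dots> \<le> (1 - p) * level v i h j + p * y"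
        using p l1 by (simp add: mult_left_mono)
      also have "\<dots> < (1 - p) * y + p * y"
        using p lt[OF jn] by (simp add: mult_strict_left_mono)
      finally show ?thesis by (simp add: algebra_simps)
    qed
  qed
  have "passage_time v X y w = ereal t"
  proof (subst passage_time_eq_ereal_iff[OF c], assumption)
    show "y \<noteq> 0" using y by simp
    show "0 < t \<and> ?g t = y \<and> (\<forall>s. 0 < s \<longrightarrow> s < t \<longrightarrow> ?g s \<noteq> y)"
      using t0 gt below by (metis less_imp_le less_irrefl)
  qed
  then show "passage_time v X y w = ereal t \<and> switch_count X t w = n"
    using skeleton_switch_count[where X=X and w=w, OF sk i k t] by simp
qed

section \<open>Holding times read off from a path\<close>

text \<open>The number \<open>K\<close> stands in for an infinite holding time. A path that stops switching thus still
  has a full sequence of holding times, and they describe it correctly up to time \<open>K\<close>; this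
  gives measurability without discarding null sets.\<close>

definition switch_time :: "real \<Rightarrow> (real \<Rightarrow> nat) \<Rightarrow> nat \<Rightarrow> real" where
  "switch_time K x = rec_nat 0 (\<lambda>j a. if \<exists>s>a. x s \<noteq> x a then Inf {s. a < s \<and> x s \<noteq> x a} else a + K)"

lemma switch_time_0 [simp]: "switch_time K x 0 = 0"
  by (simp add: switch_time_def)

lemma switch_time_Suc:
  "switch_time K x (Suc j) =
    (let a = switch_time K x j in if \<exists>s>a. x s \<noteq> x a then Inf {s. a < s \<and> x s \<noteq> x a} else a + K)"
  by (simp add: switch_time_def Let_def)

definition holding :: "real \<Rightarrow> (real \<Rightarrow> nat) \<Rightarrow> nat \<Rightarrow> real" where
  "holding K x j = switch_time K x (Suc j) - switch_time K x j"

lemma elapsed_holding: "elapsed (holding K x) j = switch_time K x j"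
  by (induction j) (auto simp: elapsed_Suc holding_def)

context
  fixes K :: real and x :: "real \<Rightarrow> nat"
  assumes x: "cadlag_path x" and x01: "\<And>t. 0 \<le> t \<Longrightarrow> x t \<in> {0, 1}" and K: "0 < K"
begin

lemma right_constant:
  assumes "0 \<le> a" obtains b where "a < b" "\<And>s. a \<le> s \<Longrightarrow> s < b \<Longrightarrow> x s = x a"
proof -
  have "\<forall>\<^sub>F s in at_right a. x s = x a"
    using x assms by (auto simp: cadlag_path_def tendsto_discrete)
  then obtain b where "a < b" "\<forall>s>a. s < b \<longrightarrow> x s = x a"
    unfolding eventually_at_right[OF less_add_one] by auto
  then show thesis using that[of b] by (metis order.order_iff_strict)
qed

text \<open>Right continuity keeps the state constant for a while after each time. So the infimum
  lies strictly later than the previous switching, and the state at the infimum is a new one: the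
  old one would persist to its right. The premise of the third claim rules out the default step
  \<open>a + K\<close>.\<close>

lemma switch_time_step:
  assumes a: "0 \<le> switch_time K x j"
  shows "switch_time K x j < switch_time K x (Suc j)"
    and "\<And>s. switch_time K x j \<le> s \<Longrightarrow> s < switch_time K x (Suc j) \<Longrightarrow> x s = x (switch_time K x j)"
    and "switch_time K x (Suc j) < switch_time K x j + K \<or> (\<exists>s>switch_time K x j. x s \<noteq> x (switch_time K x j))
      \<Longrightarrow> x (switch_time K x (Suc j)) \<noteq> x (switch_time K x j)"
proof -
  define a where "a = switch_time K x j"
  let ?S = "{s. a < s \<and> x s \<noteq> x a}"
  have a0: "0 \<le> a" using assms by (simp add: a_def)
  obtain b where b: "a < b" "\<And>s. a \<le> s \<Longrightarrow> s < b \<Longrightarrow> x s = x a"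
    using right_constant[OF a0] by blast
  have J: "switch_time K x (Suc j) = (if ?S \<noteq> {} then Inf ?S else a + K)"
    unfolding switch_time_Suc by (auto simp: Let_def a_def)
  have bb: "bdd_below ?S" by (rule bdd_belowI[of _ a]) auto
  have bI: "b \<le> Inf ?S" if "?S \<noteq> {}"
  proof (rule cInf_greatest[OF that])
    show "b \<le> s" if "s \<in> ?S" for s using that b(2)[of s] by force
  qed
  show "switch_time K x j < switch_time K x (Suc j)"
    using bI b(1) K unfolding J a_def[symmetric] by (cases "?S = {}") auto
  show "x s = x (switch_time K x j)"
    if "switch_time K x j \<le> s" "s < switch_time K x (Suc j)" for s
  proof (rule ccontr)
    assume n: "x s \<noteq> x (switch_time K x j)"
    then have "s \<noteq> switch_time K x j" by blast
    then have s: "s \<in> ?S" using that(1) n unfolding a_def by simp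
    then have "switch_time K x (Suc j) = Inf ?S" unfolding J by (metis empty_iff)
    then show False using cInf_lower[OF s bb] that(2) by simp
  qed
  show "x (switch_time K x (Suc j)) \<noteq> x (switch_time K x j)"
    if "switch_time K x (Suc j) < switch_time K x j + K \<or> (\<exists>s>switch_time K x j. x s \<noteq> x (switch_time K x j))"
  proof
    assume e: "x (switch_time K x (Suc j)) = x (switch_time K x j)"
    have ne: "?S \<noteq> {}"
    proof
      assume e: "?S = {}"
      then have "switch_time K x (Suc j) = a + K" unfolding J by simp
      then show False using that e by (auto simp: a_def set_eq_iff)
    qed
    then have JI: "switch_time K x (Suc j) = Inf ?S" by (simp only: J if_True not_False_eq_True)
    have "0 \<le> Inf ?S" using bI[OF ne] b(1) a0 by simp
      from right_constant[OF this] obtain c where c: "Inf ?S < c" "\<And>s. Inf ?S \<le> s \<Longrightarrow> s < c \<Longrightarrow> x s = x (Inf ?S)"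
      by blast
    obtain s where s: "s \<in> ?S" "s < c" using c(1) cInf_less_iff[OF ne bb] by auto
    then have "x s = x (Inf ?S)" using c(2)[of s] cInf_lower[OF s(1) bb] by simp
    also have "\<dots> = x a" using e unfolding JI a_def .
    finally show False using s(1) by simp
  qed
qed

lemma switch_time_nonneg: "0 \<le> switch_time K x j"
proof (induction j)
  case (Suc j)
  then show ?case using switch_time_step(1)[of j] by simp
qed simp

lemma switch_time_mono: "strict_mono (switch_time K x)"
  by (rule strict_monoI_Suc) (rule switch_time_step(1)[OF switch_time_nonneg])

text \<open>If the switching times accumulated at \<open>l\<close>, the left limit there would make
  the path constant just before \<open>l\<close>, while consecutive switching times close to
  \<open>l\<close> have different states.\<close>

lemma switch_time_unbounded: "\<exists>j. t < switch_time K x j"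
proof (rule ccontr)
  let ?J = "switch_time K x"
  assume "\<nexists>j. t < ?J j"
  then have bd: "\<And>j. ?J j \<le> t" by (auto simp: not_less)
  have inc: "incseq ?J" using switch_time_mono by (rule strict_mono_mono)
  obtain l where l: "?J \<longlonglongrightarrow> l" "\<And>j. ?J j \<le> l"
    using incseq_convergent[OF inc] bd by metis
  have lt: "?J j < l" for j
    using l(2)[of "Suc j"] strict_monoD[OF switch_time_mono, of j "Suc j"] by simp
  have l0: "0 < l" using lt[of 0] by simp
  then obtain c where "(x \<longlongrightarrow> c) (at_left l)" using x by (auto simp: cadlag_path_def)
  then have "\<forall>\<^sub>F s in at_left l. x s = c" by (simp add: tendsto_discrete)
  then obtain b where b: "b < l" "\<And>s. b < s \<Longrightarrow> s < l \<Longrightarrow> x s = c"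
    unfolding eventually_at_left[OF l0] by auto
  have "\<forall>\<^sub>F j in sequentially. b < ?J j \<and> l - K < ?J j"
    using order_tendstoD(1)[OF l(1), of b] order_tendstoD(1)[OF l(1), of "l - K"] b K
    by (auto intro: eventually_conj)
  then obtain j where j: "b < ?J j" "l - K < ?J j" by (auto simp: eventually_sequentially)
  \<comment> \<open>This close to \<open>l\<close> the step is shorter than \<open>K\<close>, hence
    a genuine switching and not the default step.\<close>
  have "?J (Suc j) < ?J j + K" using j lt[of "Suc j"] by simp
  then have "x (?J (Suc j)) \<noteq> x (?J j)" by (intro switch_time_step(3)[OF switch_time_nonneg] disjI1)
  moreover have "b < ?J (Suc j)" using j strict_monoD[OF switch_time_mono, of j "Suc j"] by simp
  ultimately show False using b(2) j lt by metis
qed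

text \<open>A switching time below \<open>K\<close> is reached by steps shorter than
  \<open>K\<close>, hence without any default step.\<close>

lemma switch_time_state: "switch_time K x j < K \<Longrightarrow> x (switch_time K x j) = alt (x 0) j"
proof (induction j)
  case (Suc j)
  let ?J = "switch_time K x"
  have 1: "?J j < ?J (Suc j)" by (rule switch_time_step(1)[OF switch_time_nonneg])
  then have IH: "x (?J j) = alt (x 0) j" using Suc by simp
  have "?J (Suc j) < ?J j + K" using Suc.prems switch_time_nonneg[of j] by simp
  then have "x (?J (Suc j)) \<noteq> x (?J j)" by (intro switch_time_step(3)[OF switch_time_nonneg] disjI1)
  then show ?case
    using IH x01[of "?J (Suc j)"] x01[of 0] alt_in[of "x 0" j] switch_time_nonneg[of "Suc j"]
    by (subst alt_Suc') auto
qed simp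

lemma skeleton_holding: "skeleton K (x 0) (holding K x) x"
  unfolding skeleton_def elapsed_holding
proof (intro conjI allI impI)
  show "0 < holding K x j" for j
    unfolding holding_def using switch_time_step(1)[OF switch_time_nonneg, of j] by simp
  show "\<exists>j. t < switch_time K x j" for t by (rule switch_time_unbounded)
  show "x t = alt (x 0) j"
    if "switch_time K x j \<le> t" "t < switch_time K x (Suc j)" "t < K" for j t
    using switch_time_step(2)[OF switch_time_nonneg that(1,2)] switch_time_state[of j] that by simp
qed

end

section \<open>First passage under independent exponential holding times\<close>

abbreviation exp1 :: "real measure" where
  "exp1 \<equiv> density lborel (exponential_density 1)"

interpretation exp1: prob_space exp1
  by (rule prob_space_exponential_density) simp

interpretation exp1_seq: sequence_space exp1 ..

text \<open>The rates enter by scaling, so that one sequence of unit exponentials serves both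
  starting states; dropping its leading entry turns \<open>scaled lam i\<close> into
  \<open>scaled lam (1 - i)\<close>.\<close>

definition scaled :: "(nat \<Rightarrow> real) \<Rightarrow> nat \<Rightarrow> (nat \<Rightarrow> real) \<Rightarrow> nat \<Rightarrow> real" where
  "scaled lam i e j = e j / lam (alt i j)"

definition passage_mass :: "(nat \<Rightarrow> real) \<Rightarrow> (nat \<Rightarrow> real) \<Rightarrow> nat \<Rightarrow> nat \<Rightarrow> real \<Rightarrow> real set \<Rightarrow> ennreal" where
  "passage_mass lam v i n y A = emeasure (\<Pi>\<^sub>M j\<in>UNIV. exp1)
    {e. crosses v i y n (scaled lam i e) \<and> cross_time v i y n (scaled lam i e) \<in> A}"

text \<open>Measurability is required jointly in level and time, because the recursion integrates
  over a shift of both arguments and exchanges the order of integration.\<close>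

definition mass_density ::
  "(nat \<Rightarrow> real) \<Rightarrow> (nat \<Rightarrow> real) \<Rightarrow> nat \<Rightarrow> nat \<Rightarrow> (real \<Rightarrow> real \<Rightarrow> real) \<Rightarrow> bool" where
  "mass_density lam v i n f \<longleftrightarrow> (\<lambda>(y, t). f y t) \<in> borel_measurable borel \<and>
    (\<forall>y>0. \<forall>A\<in>sets borel. passage_mass lam v i n y A = (\<integral>\<^sup>+t\<in>A. ennreal (f y t) \<partial>lborel))"

lemma measurable_scaled [measurable]:
  "(\<lambda>e. scaled lam i e j) \<in> borel_measurable (\<Pi>\<^sub>M j\<in>UNIV. exp1)"
  unfolding scaled_def by (intro borel_measurable_divide borel_measurable_const)
    (rule measurable_compose[OF measurable_component_singleton], auto)

context
  fixes N :: "'b measure" and h :: "'b \<Rightarrow> nat \<Rightarrow> real"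
  assumes h: "\<And>j. (\<lambda>x. h x j) \<in> borel_measurable N"
begin

lemma measurable_level: "(\<lambda>x. level v i (h x) n) \<in> borel_measurable N"
  unfolding level_def by (intro borel_measurable_sum borel_measurable_times borel_measurable_const h)

lemma measurable_cross_time: "(\<lambda>x. cross_time v i y n (h x)) \<in> borel_measurable N"
  unfolding cross_time_def elapsed_def
  by (intro borel_measurable_add borel_measurable_sum borel_measurable_divide borel_measurable_diff
      borel_measurable_const h measurable_level)

lemma pred_crosses: "Measurable.pred N (\<lambda>x. crosses v i y n (h x))"
proof -
  have lev: "(\<lambda>x. level v i (h x) k) \<in> borel_measurable N" for k by (rule measurable_level)
  have hn: "(\<lambda>x. h x n) \<in> borel_measurable N" by (rule h)
  have 1: "Measurable.pred N (\<lambda>x. level v i (h x) k < y)" for k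
    using lev by measurable
  have 2: "Measurable.pred N (\<lambda>x. \<forall>k\<in>{..<n}. level v i (h x) k < y)"
    by (rule pred_intros_finite) (simp, rule 1)
  have "Measurable.pred N (\<lambda>x. level v i (h x) n \<le> y \<and>
     0 \<le> (y - level v i (h x) n) / v (alt i n) \<and> (y - level v i (h x) n) / v (alt i n) < h x n)"
    using lev[of n] hn by measurable
  with 2 have "Measurable.pred N (\<lambda>x. (\<forall>k\<in>{..<n}. level v i (h x) k < y) \<and> level v i (h x) n \<le> y \<and>
     0 \<le> (y - level v i (h x) n) / v (alt i n) \<and> (y - level v i (h x) n) / v (alt i n) < h x n)"
    by (rule pred_intros_logic)
  then show ?thesis unfolding crosses_def Ball_def lessThan_iff .
qed

lemma measurable_crossing_set:
  assumes A: "A \<in> sets borel"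
  shows "{x \<in> space N. crosses v i y n (h x) \<and> cross_time v i y n (h x) \<in> A} \<in> sets N"
proof -
  have "Measurable.pred N (\<lambda>x. cross_time v i y n (h x) \<in> A)"
    using measurable_cross_time A by measurable
  with pred_crosses have "Measurable.pred N (\<lambda>x. crosses v i y n (h x) \<and> cross_time v i y n (h x) \<in> A)"
    by (rule pred_intros_logic)
  then show ?thesis by (rule predE)
qed

end

text \<open>The product law is that of an independent unit exponential put in front of another such
  sequence; \<open>crosses_Suc\<close> and \<open>cross_time_Suc\<close> express the event for
  \<open>Suc n\<close> switchings through the one for \<open>n\<close>.\<close>

lemma passage_mass_Suc:
  assumes i: "i \<in> {0, 1}" and l: "0 < lam i" and y: "0 < y" and A: "A \<in> sets borel"
  shows "passage_mass lam v i (Suc n) y A =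
    (\<integral>\<^sup>+h. ennreal (lam i * exp (- (lam i * h))) * indicator {0..} h *
      passage_mass lam v (1 - i) n (y - v i * h) {t. h + t \<in> A} \<partial>lborel)"
proof -
  let ?S = "\<Pi>\<^sub>M j\<in>(UNIV :: nat set). exp1"
  let ?B = "\<lambda>i n y A. {e. crosses v i y n (scaled lam i e) \<and> cross_time v i y n (scaled lam i e) \<in> A}"
  have sp: "space ?S = UNIV" by (simp add: space_PiM)
  have B: "?B i n y A \<in> sets ?S" if "A \<in> sets borel" for i n y A
    using measurable_crossing_set[OF measurable_scaled that, of v i y n] by (simp add: sp)
  let ?f = "\<lambda>x. passage_mass lam v (1 - i) n (y - v i * (x / lam i)) {t. x / lam i + t \<in> A}"
  have sc0: "scaled lam i (case_nat x e) 0 = x / lam i" for x e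
    by (simp add: scaled_def)
  have sc: "(\<lambda>k. scaled lam i (case_nat x e) (Suc k)) = scaled lam (1 - i) e" for x e
    by (simp add: scaled_def alt_Suc[OF i] fun_eq_iff)
  have in_B: "case_nat x e \<in> ?B i (Suc n) y A \<longleftrightarrow>
      e \<in> ?B (1 - i) n (y - v i * (x / lam i)) {t. x / lam i + t \<in> A}" for x e
    using y by (simp add: crosses_Suc[OF i] cross_time_Suc[OF i] sc sc0)
  have meas: "(\<lambda>(x, e). case_nat x e) \<in> exp1 \<Otimes>\<^sub>M ?S \<rightarrow>\<^sub>M ?S" by measurable
  have ind: "(\<lambda>z. indicator (?B i (Suc n) y A) (case z of (x, e) \<Rightarrow> case_nat x e) :: ennreal)
      \<in> borel_measurable (exp1 \<Otimes>\<^sub>M ?S)"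
    by (rule measurable_compose[OF meas borel_measurable_indicator[OF B[OF A]]])
  have inner: "(\<integral>\<^sup>+e. indicator (?B i (Suc n) y A) (case_nat x e) \<partial>?S) = ?f x" for x
  proof -
    have A': "{t. x / lam i + t \<in> A} \<in> sets borel"
      using measurable_sets[of "\<lambda>t. x / lam i + t" borel borel A] A by (simp add: vimage_def)
    have "(\<integral>\<^sup>+e. indicator (?B i (Suc n) y A) (case_nat x e) \<partial>?S) =
        (\<integral>\<^sup>+e. indicator (?B (1 - i) n (y - v i * (x / lam i)) {t. x / lam i + t \<in> A}) e \<partial>?S)"
      by (intro nn_integral_cong) (simp only: indicator_def in_B)
    then show ?thesis unfolding passage_mass_def using B[OF A'] by simp
  qed
  \<comment> \<open>Measurability in the first holding time is inherited from a partial integral of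
    an indicator that is measurable on the product.\<close>
  have f: "?f \<in> borel_measurable borel"
  proof -
    have "(\<lambda>x. \<integral>\<^sup>+e. indicator (?B i (Suc n) y A) (case_nat x e) \<partial>?S) \<in> borel_measurable exp1"
      by (rule exp1_seq.P.borel_measurable_nn_integral) (use ind in \<open>simp add: case_prod_unfold\<close>)
    then show ?thesis unfolding inner by simp
  qed
  let ?g = "\<lambda>x. ennreal (exponential_density 1 x) * ?f x"
  have g: "?g \<in> borel_measurable borel" using f by measurable
  have g': "(\<lambda>h. ?g (0 + lam i * h)) \<in> borel_measurable borel"
    by (rule measurable_compose[OF _ g]) measurable
  have "passage_mass lam v i (Suc n) y A = emeasure (distr (exp1 \<Otimes>\<^sub>M ?S) ?S (\<lambda>(x, e). case_nat x e)) (?B i (Suc n) y A)"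
    unfolding passage_mass_def exp1_seq.PiM_iter ..
  also have "\<dots> = (\<integral>\<^sup>+z. indicator (?B i (Suc n) y A) z \<partial>distr (exp1 \<Otimes>\<^sub>M ?S) ?S (\<lambda>(x, e). case_nat x e))"
    using B[OF A] by simp
  also have "\<dots> = (\<integral>\<^sup>+z. indicator (?B i (Suc n) y A) (case z of (x, e) \<Rightarrow> case_nat x e) \<partial>(exp1 \<Otimes>\<^sub>M ?S))"
    by (rule nn_integral_distr[OF meas]) (use B[OF A] in simp)
  also have "\<dots> = (\<integral>\<^sup>+x. \<integral>\<^sup>+e. indicator (?B i (Suc n) y A) (case_nat x e) \<partial>?S \<partial>exp1)"
    by (subst exp1_seq.P.nn_integral_fst[symmetric, OF ind]) simp
  also have "\<dots> = (\<integral>\<^sup>+x. ?f x \<partial>exp1)" unfolding inner ..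
  also have "\<dots> = (\<integral>\<^sup>+x. ?g x \<partial>lborel)"
    by (rule nn_integral_density) (use f in auto)
  \<comment> \<open>The substitution \<open>x = lam i * h\<close> turns the unit exponential into a
    holding time of rate \<open>lam i\<close>.\<close>
  also have "\<dots> = ennreal \<bar>lam i\<bar> * (\<integral>\<^sup>+h. ?g (0 + lam i * h) \<partial>lborel)"
    by (rule nn_integral_real_affine[OF g]) (use l in simp)
  also have "\<dots> = (\<integral>\<^sup>+h. ennreal \<bar>lam i\<bar> * ?g (0 + lam i * h) \<partial>lborel)"
    by (rule nn_integral_cmult[symmetric]) (use g' in simp)
  also have "\<dots> = (\<integral>\<^sup>+h. ennreal (lam i * exp (- (lam i * h))) * indicator {0..} h *
      passage_mass lam v (1 - i) n (y - v i * h) {t. h + t \<in> A} \<partial>lborel)"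
  proof (rule nn_integral_cong)
    fix h :: real
    have "lam i * h < 0 \<longleftrightarrow> h < 0" using l by (simp add: mult_less_0_iff)
    then show "ennreal \<bar>lam i\<bar> * (ennreal (exponential_density 1 (0 + lam i * h)) * ?f (0 + lam i * h)) =
      ennreal (lam i * exp (- (lam i * h))) * indicator {0..} h *
      passage_mass lam v (1 - i) n (y - v i * h) {t. h + t \<in> A}"
      using l by (simp add: exponential_density_def ennreal_mult' mult.assoc indicator_def)
  qed
  finally show ?thesis .
qed

text \<open>With at least one switching, the starting level 0 must lie strictly below
  \<open>y\<close>. Without switching, \<open>y = 0\<close> would be crossed at time 0, so only
  successors are covered.\<close>

lemma passage_mass_Suc_nonpos:
  "i \<in> {0, 1} \<Longrightarrow> y \<le> 0 \<Longrightarrow> passage_mass lam v i (Suc n) y A = 0"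
  by (simp add: passage_mass_def crosses_Suc)

text \<open>Without switching the level is met at the fixed time \<open>y / v i\<close>, if the
  velocity is upward and the holding time is longer than that: an atom, not a density.\<close>

lemma passage_mass_0:
  assumes i: "i \<in> {0, 1}" and l: "0 < lam i" and y: "0 < y" and g: "v i \<noteq> 0" and A: "A \<in> sets borel"
  shows "passage_mass lam v i 0 y A =
    (if 0 < v i then indicator A (y / v i) * ennreal (exp (- (lam i * (y / v i)))) else 0)"
proof (cases "0 < v i \<and> y / v i \<in> A")
  case False
  have "passage_mass lam v i 0 y A = 0"
  proof (cases "0 < v i")
    case True
    then show ?thesis using False by (simp add: passage_mass_def crosses_def cross_time_def)
  next
    case neg: False
    then have "y / v i < 0" using y g by (simp add: divide_less_0_iff)
    then show ?thesis by (simp add: passage_mass_def crosses_def not_le[symmetric])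
  qed
  then show ?thesis using False by (auto simp: indicator_def)
next
  case True
  let ?S = "\<Pi>\<^sub>M j\<in>(UNIV :: nat set). exp1"
  define c where "c = lam i * (y / v i)"
  have c: "0 \<le> c" using l y True by (simp add: c_def)
  have set: "{e. crosses v i y 0 (scaled lam i e) \<and> cross_time v i y 0 (scaled lam i e) \<in> A} =
      (\<lambda>e. e 0) -` {c<..} \<inter> space ?S"
    using True y l by (auto simp: crosses_def cross_time_def scaled_def space_PiM c_def pos_less_divide_eq mult.commute)
  have "passage_mass lam v i 0 y A = emeasure (distr ?S exp1 (\<lambda>e. e 0)) {c<..}"
    unfolding passage_mass_def set by (subst emeasure_distr) auto
  also have "\<dots> = emeasure exp1 {c<..}"
    by (simp add: exp1_seq.PiM_component)
  also have "\<dots> = exp1.prob {x \<in> space exp1. c < x}"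
    by (simp add: exp1.emeasure_eq_measure greaterThan_def)
  also have "exp1.prob {x \<in> space exp1. c < x} = exp (- c * 1)"
    by (rule exp1.exponential_distributedD_gt[OF _ c]) (auto simp: distributed_def distr_id2)
  finally show ?thesis using True by (simp add: c_def)
qed

text \<open>Conditioning on the first leg and Fubini. The factor
  \<open>indicator {0<..} (y - v i * h)\<close> says that the first leg ends strictly below
  \<open>y\<close>; where it is 0 the remaining mass vanishes, because \<open>n\<close> is
  positive.\<close>

lemma mass_density_Suc:
  assumes i: "i \<in> {0, 1}" and l: "0 < lam i"
    and f: "mass_density lam v (1 - i) n f" and n: "0 < n"
    and f' [measurable]: "(\<lambda>(y, t). f' y t) \<in> borel_measurable borel"
    and eq: "\<And>y t. 0 < y \<Longrightarrow> (\<integral>\<^sup>+h. ennreal (lam i * exp (- (lam i * h))) * indicator {0..} h *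
      indicator {0<..} (y - v i * h) * ennreal (f (y - v i * h) (t - h)) \<partial>lborel) = ennreal (f' y t)"
  shows "mass_density lam v i (Suc n) f'"
  unfolding mass_density_def
proof (intro conjI allI impI ballI f')
  fix y :: real and A :: "real set" assume y: "0 < y" and A [measurable]: "A \<in> sets borel"
  have f_m: "(\<lambda>(y, t). f y t) \<in> borel_measurable borel"
    and fV: "\<And>y A. 0 < y \<Longrightarrow> A \<in> sets borel \<Longrightarrow>
      passage_mass lam v (1 - i) n y A = (\<integral>\<^sup>+t\<in>A. ennreal (f y t) \<partial>lborel)"
    using f by (auto simp: mass_density_def)
  have f_m' [measurable]: "(\<lambda>z. f (p z) (q z)) \<in> borel_measurable N"
    if [measurable]: "p \<in> borel_measurable N" "q \<in> borel_measurable N" for p q and N :: "'x measure"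
    using measurable_compose[OF measurable_Pair[OF that, unfolded borel_prod] f_m] by simp
  let ?k = "\<lambda>h. ennreal (lam i * exp (- (lam i * h))) * indicator {0..} h * indicator {0<..} (y - v i * h)"
  have shift: "(\<integral>\<^sup>+t\<in>{t. h + t \<in> A}. ennreal (f u t) \<partial>lborel) =
      (\<integral>\<^sup>+t. ennreal (f u (t - h)) * indicator A t \<partial>lborel)" for h u
  proof -
    have "(\<integral>\<^sup>+t. ennreal (f u (t - h)) * indicator A t \<partial>lborel) =
        ennreal \<bar>1\<bar> * (\<integral>\<^sup>+t. ennreal (f u (h + 1 * t - h)) * indicator A (h + 1 * t) \<partial>lborel)"
      by (rule nn_integral_real_affine) auto
    also have "\<dots> = (\<integral>\<^sup>+t\<in>{t. h + t \<in> A}. ennreal (f u t) \<partial>lborel)"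
      by (simp add: indicator_def)
    finally show ?thesis ..
  qed
  have "passage_mass lam v i (Suc n) y A =
      (\<integral>\<^sup>+h. ennreal (lam i * exp (- (lam i * h))) * indicator {0..} h *
        passage_mass lam v (1 - i) n (y - v i * h) {t. h + t \<in> A} \<partial>lborel)"
    by (rule passage_mass_Suc[where lam=lam and v=v, OF i l y A])
  also have "\<dots> = (\<integral>\<^sup>+h. ?k h * (\<integral>\<^sup>+t. ennreal (f (y - v i * h) (t - h)) * indicator A t \<partial>lborel) \<partial>lborel)"
  proof (rule nn_integral_cong)
    fix h :: real
    have A': "{t. h + t \<in> A} \<in> sets borel"
      using measurable_sets[of "\<lambda>t. h + t" borel borel A] A by (simp add: vimage_def)
    have i': "1 - i \<in> {0, 1}" by auto
    show "ennreal (lam i * exp (- (lam i * h))) * indicator {0..} h *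
        passage_mass lam v (1 - i) n (y - v i * h) {t. h + t \<in> A} =
        ?k h * (\<integral>\<^sup>+t. ennreal (f (y - v i * h) (t - h)) * indicator A t \<partial>lborel)"
    proof (cases "0 < y - v i * h")
      case True
      then show ?thesis by (simp only: fV[OF True A'] shift) simp
    next
      case False
      then have "passage_mass lam v (1 - i) n (y - v i * h) {t. h + t \<in> A} = 0"
        using passage_mass_Suc_nonpos[OF i', of "y - v i * h" lam v "n - 1"] n by simp
      then show ?thesis using False by simp
    qed
  qed
  also have "\<dots> = (\<integral>\<^sup>+h. \<integral>\<^sup>+t. ?k h * (ennreal (f (y - v i * h) (t - h)) * indicator A t) \<partial>lborel \<partial>lborel)"
    by (intro nn_integral_cong nn_integral_cmult[symmetric]) measurable
  also have "\<dots> = (\<integral>\<^sup>+t. \<integral>\<^sup>+h. ?k h * (ennreal (f (y - v i * h) (t - h)) * indicator A t) \<partial>lborel \<partial>lborel)"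
    by (rule lborel_pair.Fubini') measurable
  also have "\<dots> = (\<integral>\<^sup>+t. (\<integral>\<^sup>+h. ?k h * ennreal (f (y - v i * h) (t - h)) \<partial>lborel) * indicator A t \<partial>lborel)"
    by (intro nn_integral_cong) (simp add: mult.assoc flip: nn_integral_multc)
  also have "\<dots> = (\<integral>\<^sup>+t\<in>A. ennreal (f' y t) \<partial>lborel)"
    unfolding eq[OF y] ..
  finally show "passage_mass lam v i (Suc n) y A = (\<integral>\<^sup>+t\<in>A. ennreal (f' y t) \<partial>lborel)" .
qed

text \<open>\<open>occ v i t y\<close> is the time spent in state \<open>i\<close> up to time \<open>t\<close> by a path at level \<open>y\<close>. For the pair of
  states \<open>0\<close>, \<open>1\<close> it is \<open>tel_xi\<close>, but in a form symmetric under exchange of the states.\<close>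

definition occ :: "(nat \<Rightarrow> real) \<Rightarrow> nat \<Rightarrow> real \<Rightarrow> real \<Rightarrow> real" where
  "occ v i t y = (y - v (1 - i) * t) / (v i - v (1 - i))"

text \<open>For the states 0 and 1 this is the modulus of \<open>tel_theta\<close>; the absolute
  value in the denominator makes it invariant under exchange of the states.\<close>

definition occ_weight :: "(nat \<Rightarrow> real) \<Rightarrow> (nat \<Rightarrow> real) \<Rightarrow> nat \<Rightarrow> real \<Rightarrow> real \<Rightarrow> real" where
  "occ_weight lam v i t y =
     exp (- (lam i * occ v i t y) - lam (1 - i) * occ v (1 - i) t y) / \<bar>v i - v (1 - i)\<bar>"

lemma measurable_occ [measurable]:
  assumes [measurable]: "f \<in> borel_measurable N" "g \<in> borel_measurable N"
  shows "(\<lambda>x. occ v i (f x) (g x)) \<in> borel_measurable N"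
  unfolding occ_def by measurable

lemma measurable_occ_weight [measurable]:
  assumes [measurable]: "f \<in> borel_measurable N" "g \<in> borel_measurable N"
  shows "(\<lambda>x. occ_weight lam v i (f x) (g x)) \<in> borel_measurable N"
  unfolding occ_weight_def by measurable

text \<open>For velocities of the same sign, a further switching integrates a power of the remaining
  occupation time \<open>a - h\<close>; the gained factor \<open>1 / (n + 1)\<close> builds up the
  factorials.\<close>

lemma nn_integral_power_down:
  fixes K a :: real
  assumes "0 \<le> K"
  shows "(\<integral>\<^sup>+h. ennreal (K * (a - h) ^ n) * indicator {0..a} h \<partial>lborel) =
    ennreal (if 0 \<le> a then K * a ^ Suc n / real (Suc n) else 0)"
proof (cases "0 \<le> a")
  case True
  have "(\<integral>\<^sup>+h. ennreal (K * (a - h) ^ n) * indicator {0..a} h \<partial>lborel) =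
      ennreal (- (K * (a - a) ^ Suc n / real (Suc n)) - - (K * (a - 0) ^ Suc n / real (Suc n)))"
  proof (rule nn_integral_FTC_Icc)
    fix x
    show "((\<lambda>h. - (K * (a - h) ^ Suc n / real (Suc n))) has_real_derivative K * (a - x) ^ n) (at x)"
    proof -
      have "((\<lambda>h. a - h) has_real_derivative - 1) (at x)"
        by (auto intro!: derivative_eq_intros)
      from DERIV_cmult[OF DERIV_power[OF this, of "Suc n"], of "- (K / real (Suc n))"]
      show ?thesis by (simp del: of_nat_Suc power_Suc)
    qed
    show "x \<in> {0..a} \<Longrightarrow> 0 \<le> K * (a - x) ^ n" using assms by simp
  qed (use True in auto)
  then show ?thesis using True by simp
qed simp

lemma mass_density_cong:
  assumes f: "mass_density lam v i n f" and m: "(\<lambda>(y, t). f' y t) \<in> borel_measurable borel"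
    and eq: "\<And>y. 0 < y \<Longrightarrow> AE t in lborel. f y t = f' y t"
  shows "mass_density lam v i n f'"
  unfolding mass_density_def
proof (intro conjI allI impI ballI m)
  fix y :: real and A :: "real set" assume y: "0 < y" and A: "A \<in> sets borel"
  have "passage_mass lam v i n y A = (\<integral>\<^sup>+t\<in>A. ennreal (f y t) \<partial>lborel)"
    using f y A by (simp add: mass_density_def)
  also have "\<dots> = (\<integral>\<^sup>+t\<in>A. ennreal (f' y t) \<partial>lborel)"
    by (rule nn_integral_cong_AE) (use eq[OF y] in \<open>auto elim!: eventually_mono\<close>)
  finally show "passage_mass lam v i n y A = (\<integral>\<^sup>+t\<in>A. ennreal (f' y t) \<partial>lborel)" .
qed

lemma compl_in: "1 - i \<in> {0, 1 :: nat}"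
  by auto

lemma compl_compl: "i \<in> {0, 1 :: nat} \<Longrightarrow> 1 - (1 - i) = i"
  by auto

section \<open>Occupation times under one more leg, and the densities for one switching\<close>

context
  fixes lam v :: "nat \<Rightarrow> real" and i :: nat
  assumes i: "i \<in> {0, 1}" and lam: "0 < lam i" "0 < lam (1 - i)" and ne: "v i \<noteq> v (1 - i)"
begin

lemmas compl_i = compl_compl[OF i]

lemma occ_shift: "occ v i (t - h) (y - v i * h) = occ v i t y - h"
  using ne by (simp add: occ_def field_simps)

lemma occ_shift': "occ v (1 - i) (t - h) (y - v i * h) = occ v (1 - i) t y"
  unfolding occ_def compl_i by (simp add: algebra_simps)

lemma occ_swap: "occ v (1 - i) t y = (v i * t - y) / (v i - v (1 - i))"
  unfolding occ_def compl_i by (metis minus_diff_eq minus_divide_divide)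

lemma occ_level: "v i * occ v i t y + v (1 - i) * occ v (1 - i) t y = y"
proof -
  have "v i * occ v i t y + v (1 - i) * occ v (1 - i) t y =
      (v i * (y - v (1 - i) * t) + v (1 - i) * (v i * t - y)) / (v i - v (1 - i))"
    unfolding occ_swap unfolding occ_def by (simp only: add_divide_distrib times_divide_eq_right)
  also have "\<dots> = y * (v i - v (1 - i)) / (v i - v (1 - i))" by (simp add: algebra_simps)
  finally show ?thesis using ne by simp
qed

lemma occ_sum: "occ v i t y + occ v (1 - i) t y = t"
proof -
  have "occ v i t y + occ v (1 - i) t y =
      (y - v (1 - i) * t + (v i * t - y)) / (v i - v (1 - i))"
    unfolding occ_swap unfolding occ_def by (simp only: add_divide_distrib times_divide_eq_right)
  also have "\<dots> = t * (v i - v (1 - i)) / (v i - v (1 - i))" by (simp add: algebra_simps)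
  finally show ?thesis using ne by simp
qed

lemma occ_weight_swap: "occ_weight lam v (1 - i) t y = occ_weight lam v i t y"
  unfolding occ_weight_def compl_i by (simp add: abs_minus_commute algebra_simps)

lemma occ_weight_shift:
  "exp (- (lam i * h)) * occ_weight lam v i (t - h) (y - v i * h) = occ_weight lam v i t y"
  unfolding occ_weight_def occ_shift occ_shift' by (simp add: algebra_simps flip: exp_add)

lemma occ_weight_pos: "0 < occ_weight lam v i t y"
  unfolding occ_weight_def using ne by simp

text \<open>One switching is the least number for which the law has a density, so it is treated
  separately, from the atoms for no switching.\<close>

lemma passage_mass_1:
  assumes g: "v i \<noteq> 0" "v (1 - i) \<noteq> 0" and y: "0 < y" and A: "A \<in> sets borel"
  shows "passage_mass lam v i 1 y A =
    (\<integral>\<^sup>+h. ennreal (lam i * exp (- (lam i * h))) * indicator {0..} h * (if 0 < v (1 - i) then indicator {0<..} (y - v i * h) *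
      (indicator A (h + (y - v i * h) / v (1 - i)) * ennreal (exp (- (lam (1 - i) * ((y - v i * h) / v (1 - i)))))) else 0) \<partial>lborel)"
proof -
  have "passage_mass lam v i 1 y A = (\<integral>\<^sup>+h. ennreal (lam i * exp (- (lam i * h))) * indicator {0..} h *
      passage_mass lam v (1 - i) 0 (y - v i * h) {t. h + t \<in> A} \<partial>lborel)"
    using passage_mass_Suc[where lam=lam and v=v and n=0, OF i lam(1) y A] by simp
  also have "\<dots> = (\<integral>\<^sup>+h. ennreal (lam i * exp (- (lam i * h))) * indicator {0..} h * (if 0 < v (1 - i) then indicator {0<..} (y - v i * h) *
      (indicator A (h + (y - v i * h) / v (1 - i)) * ennreal (exp (- (lam (1 - i) * ((y - v i * h) / v (1 - i)))))) else 0) \<partial>lborel)"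
    (is "_ = integral\<^sup>N _ ?r")
  proof (rule nn_integral_cong_AE)
    \<comment> \<open>At \<open>h = y / v i\<close> the first leg ends exactly at \<open>y\<close>
      and the remaining level is 0, outside the scope of \<open>passage_mass_0\<close>; this is a
      null set of \<open>h\<close>.\<close>
    show "AE h in lborel. ennreal (lam i * exp (- (lam i * h))) * indicator {0..} h *
        passage_mass lam v (1 - i) 0 (y - v i * h) {t. h + t \<in> A} = ?r h"
      using AE_lborel_singleton[of "y / v i"]
    proof eventually_elim
      case (elim h)
      have A': "{t. h + t \<in> A} \<in> sets borel"
        using measurable_sets[of "\<lambda>t. h + t" borel borel A] A by (simp add: vimage_def)
      have "y - v i * h \<noteq> 0" using elim g(1) by (auto simp: eq_divide_eq mult.commute)
      then consider "0 < y - v i * h" | "y - v i * h < 0" by linarith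
      then show ?case
      proof cases
        case 1
        show ?thesis
          using passage_mass_0[where lam=lam and v=v, OF compl_in lam(2) 1 g(2) A'] 1
          by (simp add: indicator_def)
      next
        case 2
        then show ?thesis by (simp add: passage_mass_def crosses_def)
      qed
    qed
  qed
  finally show ?thesis .
qed

text \<open>The passage time \<open>t = h + (y - v i * h) / v (1 - i)\<close> is affine in the first
  holding time \<open>h\<close>. Its inverse is \<open>h = occ v i t y\<close>, with Jacobian
  \<open>v (1 - i) / \<bar>v i - v (1 - i)\<bar>\<close>, and the second leg is used for the time
  \<open>occ v (1 - i) t y\<close>.\<close>

lemma mass_density_1:
  assumes g: "0 < v (1 - i)" "v i \<noteq> 0"
  shows "mass_density lam v i 1 (\<lambda>y t. lam i * v (1 - i) * occ_weight lam v i t y *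
    of_bool (0 \<le> occ v i t y \<and> 0 < occ v (1 - i) t y))"
    (is "mass_density _ _ _ _ ?f")
  unfolding mass_density_def
proof (intro conjI allI impI ballI)
  show "(\<lambda>(y, t). ?f y t) \<in> borel_measurable borel"
    unfolding borel_prod[symmetric] by measurable
next
  fix y :: real and A :: "real set" assume y: "0 < y" and A [measurable]: "A \<in> sets borel"
  define l l' g g' where "l = lam i" "l' = lam (1 - i)" "g = v i" "g' = v (1 - i)"
  note defs = this
  let ?F = "\<lambda>h. ennreal (l * exp (- (l * h))) * indicator {0..} h * (indicator {0<..} (y - g * h) *
      (indicator A (h + (y - g * h) / g') * ennreal (exp (- (l' * ((y - g * h) / g'))))))"
  have "passage_mass lam v i 1 y A = (\<integral>\<^sup>+h. ?F h \<partial>lborel)"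
    unfolding passage_mass_1[OF g(2) _ y A, OF less_imp_neq[OF g(1), symmetric]]
    using g(1) by (simp add: defs mult.assoc)
  also have "\<dots> = ennreal \<bar>- g' / (g - g')\<bar> * (\<integral>\<^sup>+t. ?F (y / (g - g') + (- g' / (g - g')) * t) \<partial>lborel)"
    by (rule nn_integral_real_affine) (use g ne in \<open>auto simp: defs\<close>)
  also have "\<dots> = (\<integral>\<^sup>+t. ennreal \<bar>- g' / (g - g')\<bar> * ?F (y / (g - g') + (- g' / (g - g')) * t) \<partial>lborel)"
    by (rule nn_integral_cmult[symmetric]) measurable
  also have "\<dots> = (\<integral>\<^sup>+t\<in>A. ennreal (?f y t) \<partial>lborel)"
  proof (rule nn_integral_cong)
    fix t :: real
    let ?a = "occ v i t y" and ?b = "occ v (1 - i) t y"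
    have h: "y / (g - g') + (- g' / (g - g')) * t = ?a"
      unfolding occ_def defs by (simp add: diff_divide_distrib)
    have yb: "y - g * ?a = g' * ?b" using occ_level[of t y] unfolding defs by simp
    have g'0: "0 < g'" using g unfolding defs by simp
    have q: "(y - g * ?a) / g' = ?b" using yb g'0 by simp
    have pos: "0 < y - g * ?a \<longleftrightarrow> 0 < ?b" unfolding yb using g'0 by (simp add: zero_less_mult_iff)
    have tt: "?a + ?b = t" by (rule occ_sum)
    have w: "\<bar>- g' / (g - g')\<bar> * (l * exp (- (l * ?a)) * exp (- (l' * ?b))) = l * g' * occ_weight lam v i t y"
      unfolding occ_weight_def using g'0 by (simp add: defs abs_divide flip: exp_add)
    have "ennreal \<bar>- g' / (g - g')\<bar> * ?F ?a =
        ennreal (\<bar>- g' / (g - g')\<bar> * (l * exp (- (l * ?a)) * exp (- (l' * ?b)))) *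
        (of_bool (0 \<le> ?a \<and> 0 < ?b) * indicator A t)"
    proof (cases "0 \<le> ?a \<and> 0 < ?b \<and> t \<in> A")
      case True
      have "0 \<le> l" using lam(1) by (simp add: defs)
      have mul: "ennreal c * (ennreal (l * u) * ennreal w) = ennreal (c * (l * u * w))"
        if "0 \<le> c" "0 \<le> u" "0 \<le> w" for c u w
        using that \<open>0 \<le> l\<close> by (simp flip: ennreal_mult)
      then show ?thesis
        unfolding q tt using True pos mul[of "\<bar>- g' / (g - g')\<bar>" "exp (- (l * ?a))" "exp (- (l' * ?b))"]
        by (simp del: abs_divide)
    next
      case False
      then show ?thesis unfolding q tt using pos by (auto simp: indicator_def)
    qed
    then show "ennreal \<bar>- g' / (g - g')\<bar> * ?F (y / (g - g') + (- g' / (g - g')) * t) =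
        ennreal (?f y t) * indicator A t"
      unfolding h w by (simp add: defs)
  qed
  finally show "passage_mass lam v i 1 y A = (\<integral>\<^sup>+t\<in>A. ennreal (?f y t) \<partial>lborel)" .
qed

text \<open>A descending second leg that starts below the level never meets it.\<close>

lemma mass_density_zero_1:
  assumes g: "v (1 - i) < 0" "v i \<noteq> 0"
  shows "mass_density lam v i 1 (\<lambda>y t. 0)"
  using g passage_mass_1[OF g(2) less_imp_neq[OF g(1)]] by (simp add: mass_density_def)

lemma mass_density_zero_Suc:
  assumes "mass_density lam v (1 - i) n (\<lambda>y t. 0)" "0 < n"
  shows "mass_density lam v i (Suc n) (\<lambda>y t. 0)"
  by (rule mass_density_Suc[OF i lam(1) assms]) simp_all


lemma occ_weight_step:
  "ennreal (lam i * exp (- (lam i * h))) * ennreal (c * occ_weight lam v (1 - i) (t - h) (y - v i * h)) =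
    ennreal (lam i * c * occ_weight lam v i t y)"
proof -
  have "ennreal (lam i * exp (- (lam i * h))) * ennreal (c * occ_weight lam v (1 - i) (t - h) (y - v i * h)) =
      ennreal (lam i * exp (- (lam i * h)) * (c * occ_weight lam v i (t - h) (y - v i * h)))"
    unfolding occ_weight_swap using lam(1) by (intro ennreal_mult'[symmetric]) simp
  also have "lam i * exp (- (lam i * h)) * (c * occ_weight lam v i (t - h) (y - v i * h)) =
      lam i * c * (exp (- (lam i * h)) * occ_weight lam v i (t - h) (y - v i * h))"
    by (simp add: mult_ac)
  finally show ?thesis unfolding occ_weight_shift .
qed

text \<open>A leg in state \<open>i\<close> leaves the occupation time of the other state alone, so
  the factor \<open>C\<close> passes through the integral and only the power of
  \<open>occ v i t y\<close> is integrated.\<close>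

lemma mass_density_step_same_sign:
  assumes g: "0 < v i" "0 < v (1 - i)"
    and C: "\<And>b. 0 \<le> b \<Longrightarrow> 0 \<le> C b" and C_m [measurable]: "C \<in> borel_measurable borel" and m: "0 < m"
    and f: "mass_density lam v (1 - i) m (\<lambda>y t. C (occ v (1 - i) t y) * occ v i t y ^ n *
      of_bool (0 \<le> occ v i t y \<and> 0 \<le> occ v (1 - i) t y) * occ_weight lam v (1 - i) t y)"
      (is "mass_density _ _ _ _ ?f")
  shows "mass_density lam v i (Suc m) (\<lambda>y t. lam i * C (occ v (1 - i) t y) * occ v i t y ^ Suc n / real (Suc n) *
      of_bool (0 \<le> occ v i t y \<and> 0 \<le> occ v (1 - i) t y) * occ_weight lam v i t y)"
    (is "mass_density _ _ _ _ ?f'")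
proof (rule mass_density_Suc[OF i lam(1) f m])
  show "(\<lambda>(y, t). ?f' y t) \<in> borel_measurable borel"
    unfolding borel_prod[symmetric] by measurable
  fix y t :: real assume y: "0 < y"
  let ?I = "\<lambda>h. ennreal (lam i * exp (- (lam i * h))) * indicator {0..} h *
      indicator {0<..} (y - v i * h) * ennreal (?f (y - v i * h) (t - h))"
  define a b w where "a = occ v i t y" "b = occ v (1 - i) t y" "w = occ_weight lam v i t y"
  note defs = this
  have w: "0 < w" unfolding defs by (rule occ_weight_pos)
  \<comment> \<open>The case distinction absorbs the indicator of \<open>0 \<le> b\<close> and keeps
    the constant nonnegative, since \<open>C\<close> is known to be nonnegative only for nonnegative
    arguments.\<close>
  define K where "K = (if 0 \<le> b then lam i * C b * w else 0)"
  have K: "0 \<le> K" unfolding K_def using C[of b] w lam by simp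
  have yh: "y - v i * h = v i * (a - h) + v (1 - i) * b" for h
    using occ_level[of t y] unfolding defs by (simp add: algebra_simps)
  have "(\<integral>\<^sup>+h. ?I h \<partial>lborel) =
      (\<integral>\<^sup>+h. ennreal (K * (a - h) ^ n) * indicator {0..a} h \<partial>lborel)"
  proof (rule nn_integral_cong_AE)
    \<comment> \<open>For \<open>h < a\<close> and \<open>0 \<le> b\<close> the remaining level is
      positive because both velocities are; at \<open>h = a\<close> it may vanish, which is a null
      set.\<close>
    show "AE h in lborel. ?I h =
      ennreal (K * (a - h) ^ n) * indicator {0..a} h"
      using AE_lborel_singleton[of a]
    proof eventually_elim
      case (elim h)
      have f: "?f (y - v i * h) (t - h) =
          C b * (a - h) ^ n * of_bool (h \<le> a \<and> 0 \<le> b) * occ_weight lam v (1 - i) (t - h) (y - v i * h)"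
        unfolding occ_shift occ_shift' defs by simp
      have E: "ennreal (lam i * exp (- (lam i * h))) * ennreal (?f (y - v i * h) (t - h)) =
          ennreal (lam i * (C b * (a - h) ^ n * of_bool (h \<le> a \<and> 0 \<le> b)) * w)"
        unfolding f occ_weight_step defs ..
      have "0 < y - v i * h" if "0 \<le> b" "h \<le> a"
        unfolding yh using that elim g by (intro add_pos_nonneg) auto
      then have "?I h =
          (ennreal (lam i * exp (- (lam i * h))) * ennreal (?f (y - v i * h) (t - h))) * indicator {0..} h"
        unfolding f by (auto simp: indicator_def)
      then show ?case unfolding E K_def by (auto simp: indicator_def mult_ac)
    qed
  qed
  also have "\<dots> = ennreal (if 0 \<le> a then K * a ^ Suc n / real (Suc n) else 0)"
    by (rule nn_integral_power_down[OF K])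
  also have "(if 0 \<le> a then K * a ^ Suc n / real (Suc n) else 0) = ?f' y t"
    unfolding K_def defs by (simp del: of_nat_Suc power_Suc)
  finally show "(\<integral>\<^sup>+h. ?I h \<partial>lborel) = ennreal (?f' y t)" .
qed

end

section \<open>Closed forms of the densities and their recursions\<close>

definition same_sign_odd :: "(nat \<Rightarrow> real) \<Rightarrow> (nat \<Rightarrow> real) \<Rightarrow> nat \<Rightarrow> nat \<Rightarrow> real \<Rightarrow> real \<Rightarrow> real" where
  "same_sign_odd lam v i n y t = lam i * v (1 - i) *
     ((lam i * lam (1 - i) * occ v i t y * occ v (1 - i) t y) ^ n / (fact n)\<^sup>2) *
     of_bool (0 \<le> occ v i t y \<and> 0 \<le> occ v (1 - i) t y) * occ_weight lam v i t y"

definition same_sign_even :: "(nat \<Rightarrow> real) \<Rightarrow> (nat \<Rightarrow> real) \<Rightarrow> nat \<Rightarrow> nat \<Rightarrow> real \<Rightarrow> real \<Rightarrow> real" where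
  "same_sign_even lam v i n y t = lam i * lam (1 - i) * v i * occ v i t y *
     ((lam i * lam (1 - i) * occ v i t y * occ v (1 - i) t y) ^ n / (fact n * fact (n + 1))) *
     of_bool (0 \<le> occ v i t y \<and> 0 \<le> occ v (1 - i) t y) * occ_weight lam v i t y"

text \<open>Velocities of opposite sign, start in the ascending state: the level is met on an
  ascending leg, here after \<open>2 * n + 2\<close> switchings. The indicator says that some time
  has been spent descending.\<close>

definition climb_even :: "(nat \<Rightarrow> real) \<Rightarrow> (nat \<Rightarrow> real) \<Rightarrow> nat \<Rightarrow> nat \<Rightarrow> real \<Rightarrow> real \<Rightarrow> real" where
  "climb_even lam v i n y t = lam i * lam (1 - i) * y *
     ((lam i * lam (1 - i) * occ v i t y * occ v (1 - i) t y) ^ n / (fact n * fact (n + 1))) *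
     of_bool (0 < occ v (1 - i) t y) * occ_weight lam v i t y"

text \<open>Velocities of opposite sign, start in the descending state \<open>i\<close>, passage
  after \<open>2 * n + 1\<close> switchings. Again the indicator says that some time has been spent
  descending.\<close>

definition descend_odd :: "(nat \<Rightarrow> real) \<Rightarrow> (nat \<Rightarrow> real) \<Rightarrow> nat \<Rightarrow> nat \<Rightarrow> real \<Rightarrow> real \<Rightarrow> real" where
  "descend_odd lam v i n y t = lam i / occ v (1 - i) t y *
     ((lam i * lam (1 - i) * occ v i t y * occ v (1 - i) t y) ^ n / (fact n)\<^sup>2) *
     (y - v i / real (n + 1) * occ v i t y) *
     of_bool (0 < occ v i t y) * occ_weight lam v i t y"

lemma measurable_densities:
  "(\<lambda>(y, t). same_sign_odd lam v i n y t) \<in> borel_measurable borel"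
  "(\<lambda>(y, t). climb_even lam v i n y t) \<in> borel_measurable borel"
  "(\<lambda>(y, t). descend_odd lam v i n y t) \<in> borel_measurable borel"
  unfolding same_sign_odd_def climb_even_def descend_odd_def borel_prod[symmetric] by measurable

context
  fixes lam v :: "nat \<Rightarrow> real"
  assumes lam: "\<And>i. i \<in> {0, 1} \<Longrightarrow> 0 < lam i" and ne: "v 0 \<noteq> v 1"
begin

lemma velocity_neq: "i \<in> {0, 1} \<Longrightarrow> v i \<noteq> v (1 - i)"
  using ne by auto

text \<open>Putting a leg in state \<open>i\<close> in front of a path started in
  \<open>1 - i\<close> raises the count by one and exchanges the states. So the induction carries
  both states and both parities at once.\<close>

lemma same_sign_densities:
  assumes g: "\<And>i. i \<in> {0, 1} \<Longrightarrow> 0 < v i"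
  shows "i \<in> {0, 1} \<Longrightarrow> mass_density lam v i (2 * n + 1) (same_sign_odd lam v i n)"
    and "i \<in> {0, 1} \<Longrightarrow> mass_density lam v i (2 * n + 2) (same_sign_even lam v i n)"
proof -
  have even: "mass_density lam v i (2 * n + 2) (same_sign_even lam v i n)"
    if i: "i \<in> {0, 1}" and f: "mass_density lam v (1 - i) (2 * n + 1) (same_sign_odd lam v (1 - i) n)" for i n
  proof -
    note compl_i = compl_compl[OF i]
    \<comment> \<open>In the odd density for \<open>1 - i\<close> both occupation times have
      exponent \<open>n\<close>: the \<open>n\<close>-th power of \<open>occ v i t y\<close> is left
      to be integrated and the rest goes into \<open>C\<close>.\<close>
    define C where "C b = lam (1 - i) * v i * ((lam i * lam (1 - i) * b) ^ n / (fact n)\<^sup>2)" for b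
    have "same_sign_odd lam v (1 - i) n = (\<lambda>y t. C (occ v (1 - i) t y) * occ v i t y ^ n *
      of_bool (0 \<le> occ v i t y \<and> 0 \<le> occ v (1 - i) t y) * occ_weight lam v (1 - i) t y)"
      unfolding same_sign_odd_def compl_i C_def by (intro ext) (simp add: power_mult_distrib conj_commute mult_ac)
    note f = f[unfolded this]
    have C: "0 \<le> C b" if "0 \<le> b" for b
      using lam[OF i] lam[OF compl_in, of i] g[OF i] that by (simp add: C_def)
    have C_m: "C \<in> borel_measurable borel" unfolding C_def by measurable
    have "mass_density lam v i (Suc (2 * n + 1)) (\<lambda>y t. lam i * C (occ v (1 - i) t y) * occ v i t y ^ Suc n / real (Suc n) *
      of_bool (0 \<le> occ v i t y \<and> 0 \<le> occ v (1 - i) t y) * occ_weight lam v i t y)"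
      by (rule mass_density_step_same_sign[OF i lam[OF i] lam[OF compl_in] velocity_neq[OF i] g[OF i] g[OF compl_in] C C_m _ f]) simp_all
    moreover have "(\<lambda>y t. lam i * C (occ v (1 - i) t y) * occ v i t y ^ Suc n / real (Suc n) *
      of_bool (0 \<le> occ v i t y \<and> 0 \<le> occ v (1 - i) t y) * occ_weight lam v i t y) = same_sign_even lam v i n"
      unfolding same_sign_even_def C_def
      by (intro ext) (simp add: power_mult_distrib power2_eq_square mult_ac)
    ultimately show ?thesis by simp
  qed
  have odd: "mass_density lam v i (2 * Suc n + 1) (same_sign_odd lam v i (Suc n))"
    if i: "i \<in> {0, 1}" and f: "mass_density lam v (1 - i) (2 * n + 2) (same_sign_even lam v (1 - i) n)" for i n
  proof -
    note compl_i = compl_compl[OF i]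
    \<comment> \<open>The even density for \<open>1 - i\<close> has one extra factor of its own
      occupation time, which goes into \<open>C\<close>. Integration raises the other exponent as
      well, so both become \<open>n + 1\<close>.\<close>
    define C where "C b = lam i * lam (1 - i) * v (1 - i) * b * ((lam i * lam (1 - i) * b) ^ n / (fact n * fact (n + 1)))" for b
    have "same_sign_even lam v (1 - i) n = (\<lambda>y t. C (occ v (1 - i) t y) * occ v i t y ^ n *
      of_bool (0 \<le> occ v i t y \<and> 0 \<le> occ v (1 - i) t y) * occ_weight lam v (1 - i) t y)"
      unfolding same_sign_even_def compl_i C_def by (intro ext) (simp add: power_mult_distrib conj_commute mult_ac)
    note f = f[unfolded this]
    have C: "0 \<le> C b" if "0 \<le> b" for b
      using lam[OF i] lam[OF compl_in, of i] g[OF compl_in, of i] that by (simp add: C_def)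
    have C_m: "C \<in> borel_measurable borel" unfolding C_def by measurable
    have "mass_density lam v i (Suc (2 * n + 2)) (\<lambda>y t. lam i * C (occ v (1 - i) t y) * occ v i t y ^ Suc n / real (Suc n) *
      of_bool (0 \<le> occ v i t y \<and> 0 \<le> occ v (1 - i) t y) * occ_weight lam v i t y)"
      by (rule mass_density_step_same_sign[OF i lam[OF i] lam[OF compl_in] velocity_neq[OF i] g[OF i] g[OF compl_in] C C_m _ f]) simp_all
    moreover have "(\<lambda>y t. lam i * C (occ v (1 - i) t y) * occ v i t y ^ Suc n / real (Suc n) *
      of_bool (0 \<le> occ v i t y \<and> 0 \<le> occ v (1 - i) t y) * occ_weight lam v i t y) = same_sign_odd lam v i (Suc n)"
      unfolding same_sign_odd_def C_def
      by (intro ext) (simp add: power_mult_distrib power2_eq_square mult_ac)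
    ultimately show ?thesis by simp
  qed
  have base: "mass_density lam v i (2 * 0 + 1) (same_sign_odd lam v i 0)" if i: "i \<in> {0, 1}" for i
  proof -
    have g0: "v i \<noteq> 0" using g[OF i] by simp
    show ?thesis
    proof (rule mass_density_cong)
      show "mass_density lam v i (2 * 0 + 1) (\<lambda>y t. lam i * v (1 - i) * occ_weight lam v i t y *
          of_bool (0 \<le> occ v i t y \<and> 0 < occ v (1 - i) t y))"
        using mass_density_1[OF i lam[OF i] lam[OF compl_in] velocity_neq[OF i] g[OF compl_in] g0] by simp
      fix y :: real assume "0 < y"
      \<comment> \<open>The strict and the weak inequality differ only where
        \<open>occ v (1 - i) t y = 0\<close>, that is at \<open>t = y / v i\<close>.\<close>
      show "AE t in lborel. lam i * v (1 - i) * occ_weight lam v i t y *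
          of_bool (0 \<le> occ v i t y \<and> 0 < occ v (1 - i) t y) = same_sign_odd lam v i 0 y t"
        using AE_lborel_singleton[of "y / v i"]
      proof eventually_elim
        case (elim t)
        have "occ v (1 - i) t y \<noteq> 0"
          unfolding occ_def compl_compl[OF i] using elim g0 velocity_neq[OF i] by (auto simp: field_simps)
        then show ?case by (simp add: same_sign_odd_def less_le)
      qed
    qed (rule measurable_densities)
  qed
  have "\<forall>i\<in>{0, 1}. mass_density lam v i (2 * n + 1) (same_sign_odd lam v i n) \<and>
      mass_density lam v i (2 * n + 2) (same_sign_even lam v i n)"
  proof (induction n)
    case 0
    show ?case using base even[of _ 0] compl_in by blast
  next
    case (Suc n)
    have "mass_density lam v i (2 * Suc n + 1) (same_sign_odd lam v i (Suc n))" if "i \<in> {0, 1}" for i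
      using odd[OF that] Suc compl_in by blast
    then show ?case using even[of _ "Suc n"] compl_in by blast
  qed
  then show "i \<in> {0, 1} \<Longrightarrow> mass_density lam v i (2 * n + 1) (same_sign_odd lam v i n)"
    and "i \<in> {0, 1} \<Longrightarrow> mass_density lam v i (2 * n + 2) (same_sign_even lam v i n)"
    by blast+
qed

text \<open>An ascending leg must end below \<open>y\<close>, so \<open>h\<close> ranges over
  \<open>{0..y / v i}\<close> instead of \<open>{0..a}\<close>. The integrand is minus the
  derivative of \<open>K * (a - h) ^ n * (y - v i * h)\<close>, a function that vanishes at
  \<open>y / v i\<close> and equals \<open>K * a ^ n * y\<close> at 0. This is the source of the
  factor \<open>y\<close> in \<open>climb_even\<close>.\<close>

lemma climb_even_from_descend_odd:
  assumes i: "i \<in> {0, 1}" and g: "0 < v i" "v (1 - i) < 0"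
    and f: "mass_density lam v (1 - i) (2 * n + 1) (descend_odd lam v (1 - i) n)"
  shows "mass_density lam v i (2 * n + 2) (climb_even lam v i n)"
proof -
  note ctx = i lam[OF i] lam[OF compl_in] velocity_neq[OF i]
  have "mass_density lam v i (Suc (2 * n + 1)) (climb_even lam v i n)"
  proof (rule mass_density_Suc[OF i lam[OF i] f])
    fix y t :: real assume y: "0 < y"
    define a b w where "a = occ v i t y" "b = occ v (1 - i) t y" "w = occ_weight lam v i t y"
    note defs = this
    have w: "0 < w" unfolding defs by (rule occ_weight_pos[OF ctx])
    have ab: "v i * a + v (1 - i) * b = y" unfolding defs by (rule occ_level[OF ctx])
    \<comment> \<open>\<open>K\<close> gathers the factors without \<open>h\<close>. It also takes
      over the denominator \<open>n + 1\<close> of the correction term in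
      \<open>descend_odd\<close>, which leaves \<open>D\<close> free of fractions.\<close>
    define K where "K = lam i * lam (1 - i) * ((lam i * lam (1 - i) * b) ^ n / (fact n)\<^sup>2) * w / real (n + 1)"
    define D where "D h = real (n + 1) * v i * (a - h) ^ n + v (1 - i) * b * (real n * (a - h) ^ (n - 1))" for h
    let ?c = "\<lambda>h. lam (1 - i) / (a - h) * ((lam (1 - i) * lam i * b * (a - h)) ^ n / (fact n)\<^sup>2) *
      (y - v i * h - v (1 - i) / real (n + 1) * b) * of_bool (0 < b)"
    have f: "descend_odd lam v (1 - i) n (y - v i * h) (t - h) =
        ?c h * occ_weight lam v (1 - i) (t - h) (y - v i * h)" for h
      unfolding descend_odd_def compl_compl[OF i] occ_shift[OF ctx] occ_shift'[OF ctx] defs by simp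
    have E: "ennreal (lam i * exp (- (lam i * h))) * ennreal (descend_odd lam v (1 - i) n (y - v i * h) (t - h)) =
        ennreal (lam i * ?c h * w)" for h
      unfolding f defs(3) by (rule occ_weight_step[OF ctx])
    let ?I = "\<lambda>h. ennreal (lam i * exp (- (lam i * h))) * indicator {0..} h *
      indicator {0<..} (y - v i * h) * ennreal (descend_odd lam v (1 - i) n (y - v i * h) (t - h))"
    have I: "?I h = ennreal (lam i * ?c h * w) * (indicator {0..} h * indicator {0<..} (y - v i * h))" for h
      unfolding E[symmetric] by (simp add: mult_ac)
    show "(\<integral>\<^sup>+h. ?I h \<partial>lborel) = ennreal (climb_even lam v i n y t)"
    proof (cases "0 < b")
      case False
      then have "(\<integral>\<^sup>+h. ?I h \<partial>lborel) = (\<integral>\<^sup>+h. 0 \<partial>(lborel :: real measure))" unfolding I by simp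
      then show ?thesis using False by (simp add: climb_even_def defs)
    next
      case b: True
      have K: "0 \<le> K" unfolding K_def using lam[OF i] lam[OF compl_in, of i] b w by simp
      \<comment> \<open>Up to \<open>y / v i\<close> the remaining level is nonnegative, although
        the descending part contributes negatively to it; so the ascending part
        \<open>v i * (a - h)\<close> is positive.\<close>
      have ah: "0 < a - h" if "h \<le> y / v i" for h
      proof -
        have "v i * h \<le> y" using that g by (simp add: field_simps)
        then have "v (1 - i) * b \<ge> - (v i * (a - h))" using ab by (simp add: algebra_simps)
        moreover have "v (1 - i) * b < 0" using g b by (simp add: mult_neg_pos)
        ultimately have "0 < v i * (a - h)" by linarith
        then show ?thesis using g by (simp add: zero_less_mult_iff)
      qed
      have cD: "lam i * ?c h * w = K * D h" if h: "h \<le> y / v i" for h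
      proof -
        have yh: "y - v i * h = v i * (a - h) + v (1 - i) * b" using ab by (simp add: algebra_simps)
        define x where "x = a - h"
        have x: "0 < x" using ah[OF h] by (simp add: x_def)
        have D: "x ^ n / x * ((v i * x + v (1 - i) * b) - v (1 - i) / real (n + 1) * b) = D h / real (n + 1)"
          unfolding D_def x_def[symmetric] using x by (cases n) (simp_all add: field_simps)
        have "lam i * ?c h * w = lam i * lam (1 - i) * ((lam i * lam (1 - i) * b) ^ n / (fact n)\<^sup>2) * w *
            (x ^ n / x * ((v i * x + v (1 - i) * b) - v (1 - i) / real (n + 1) * b))"
          unfolding yh x_def[symmetric] using b by (simp add: power_mult_distrib mult_ac)
        also have "\<dots> = K * D h" unfolding D K_def by simp
        finally show ?thesis .
      qed
      have D_nonneg: "0 \<le> D h" if h: "h \<le> y / v i" for h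
      proof -
        \<comment> \<open>In terms of the remaining level \<open>y - v i * h\<close> every summand
          of \<open>D\<close> is visibly nonnegative.\<close>
        have "D h = (a - h) ^ (n - 1) * (real n * (y - v i * h)) + v i * (a - h) ^ n"
          unfolding D_def ab[symmetric] by (cases n) (simp_all add: algebra_simps)
        moreover have "0 \<le> y - v i * h" using h g by (simp add: field_simps)
        ultimately show ?thesis using ah[OF h] g by simp
      qed
      have "(\<integral>\<^sup>+h. ?I h \<partial>lborel) = (\<integral>\<^sup>+h. ennreal (K * D h) * indicator {0..y / v i} h \<partial>lborel)"
      proof (rule nn_integral_cong_AE)
        show "AE h in lborel. ?I h = ennreal (K * D h) * indicator {0..y / v i} h"
          using AE_lborel_singleton[of "y / v i"]
        proof eventually_elim
          case (elim h)
          have "0 < y - v i * h \<longleftrightarrow> h < y / v i" using g by (simp add: field_simps)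
          then show ?case unfolding I using elim cD[of h] by (auto simp: indicator_def)
        qed
      qed
      also have "\<dots> = ennreal (- (K * ((a - y / v i) ^ n * (v i * (a - y / v i) + v (1 - i) * b)))
          - - (K * ((a - 0) ^ n * (v i * (a - 0) + v (1 - i) * b))))"
      proof (rule nn_integral_FTC_Icc)
        show "(\<lambda>h. K * D h) \<in> borel_measurable borel" unfolding D_def by measurable
        show "0 \<le> y / v i" using y g by simp
        fix h assume "h \<in> {0..y / v i}"
        then show "0 \<le> K * D h" using K D_nonneg[of h] by simp
        have 1: "((\<lambda>h. a - h) has_real_derivative - 1) (at h)" by (auto intro!: derivative_eq_intros)
        have 2: "((\<lambda>h. v i * (a - h) + v (1 - i) * b) has_real_derivative - v i) (at h)"
          by (auto intro!: derivative_eq_intros)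
        have "((\<lambda>h. - K * ((a - h) ^ n * (v i * (a - h) + v (1 - i) * b))) has_real_derivative
            - K * (real n * (- 1 * (a - h) ^ (n - Suc 0)) * (v i * (a - h) + v (1 - i) * b) + - v i * (a - h) ^ n)) (at h)"
          by (intro DERIV_cmult DERIV_mult DERIV_power 1 2)
        moreover have "- K * (real n * (- 1 * (a - h) ^ (n - Suc 0)) * (v i * (a - h) + v (1 - i) * b) + - v i * (a - h) ^ n) = K * D h"
          unfolding D_def by (cases n) (simp_all add: algebra_simps)
        ultimately show "((\<lambda>h. - (K * ((a - h) ^ n * (v i * (a - h) + v (1 - i) * b)))) has_real_derivative K * D h) (at h)"
          by simp
      qed
      also have "v i * (a - y / v i) + v (1 - i) * b = 0" using ab g by (simp add: algebra_simps)
      also have "- (K * ((a - y / v i) ^ n * 0)) - - (K * ((a - 0) ^ n * (v i * (a - 0) + v (1 - i) * b))) = K * a ^ n * y"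
        using ab by simp
      also have "K * a ^ n * y = climb_even lam v i n y t"
        using b unfolding climb_even_def defs(1,2,3)[symmetric] K_def
        by (simp add: power_mult_distrib power2_eq_square mult_ac)
      finally show ?thesis .
    qed
  qed (simp_all add: measurable_densities)
  then show ?thesis by simp
qed

text \<open>A descending leg moves away from the level, so the remaining level is positive for all
  \<open>h \<ge> 0\<close> and the range is \<open>{0..a}\<close>. The remaining level is
  \<open>v (1 - i) * b + v i * (a - h)\<close>; the two terms are integrated with factors
  \<open>1 / (n + 1)\<close> and \<open>1 / (n + 2)\<close>, whose mismatch produces the correction
  in \<open>descend_odd\<close>.\<close>

lemma descend_odd_Suc_from_climb_even:
  assumes i: "i \<in> {0, 1}" and g: "v i < 0" "0 < v (1 - i)"
    and f: "mass_density lam v (1 - i) (2 * n + 2) (climb_even lam v (1 - i) n)"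
  shows "mass_density lam v i (2 * Suc n + 1) (descend_odd lam v i (Suc n))"
proof -
  note ctx = i lam[OF i] lam[OF compl_in] velocity_neq[OF i]
  have "mass_density lam v i (Suc (2 * n + 2)) (descend_odd lam v i (Suc n))"
  proof (rule mass_density_Suc[OF i lam[OF i] f])
    fix y t :: real assume y: "0 < y"
    define a b w where "a = occ v i t y" "b = occ v (1 - i) t y" "w = occ_weight lam v i t y"
    note defs = this
    have w: "0 < w" unfolding defs by (rule occ_weight_pos[OF ctx])
    have ab: "v i * a + v (1 - i) * b = y" unfolding defs by (rule occ_level[OF ctx])
    define K where "K = lam i * (lam i * lam (1 - i)) * ((lam i * lam (1 - i) * b) ^ n / (fact n * fact (n + 1))) * w"
    define D where "D h = v (1 - i) * b * (a - h) ^ n + v i * (a - h) ^ Suc n" for h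
    let ?c = "\<lambda>h. lam i * lam (1 - i) * (y - v i * h) *
      ((lam i * lam (1 - i) * b * (a - h)) ^ n / (fact n * fact (n + 1))) * of_bool (0 < a - h)"
    have f: "climb_even lam v (1 - i) n (y - v i * h) (t - h) =
        ?c h * occ_weight lam v (1 - i) (t - h) (y - v i * h)" for h
      unfolding climb_even_def compl_compl[OF i] occ_shift[OF ctx] occ_shift'[OF ctx] defs by (simp add: mult_ac)
    have E: "ennreal (lam i * exp (- (lam i * h))) * ennreal (climb_even lam v (1 - i) n (y - v i * h) (t - h)) =
        ennreal (lam i * ?c h * w)" for h
      unfolding f defs(3) by (rule occ_weight_step[OF ctx])
    let ?I = "\<lambda>h. ennreal (lam i * exp (- (lam i * h))) * indicator {0..} h *
      indicator {0<..} (y - v i * h) * ennreal (climb_even lam v (1 - i) n (y - v i * h) (t - h))"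
    have I: "?I h = ennreal (lam i * ?c h * w) * (indicator {0..} h * indicator {0<..} (y - v i * h))" for h
      unfolding E[symmetric] by (simp add: mult_ac)
    have yh: "0 < y - v i * h" if "0 \<le> h" for h
      using y g mult_nonpos_nonneg[of "v i" h] that by linarith
    show "(\<integral>\<^sup>+h. ?I h \<partial>lborel) = ennreal (descend_odd lam v i (Suc n) y t)"
    proof (cases "0 < a")
      case False
      then have I0: "?I h = 0" for h unfolding I by (auto simp: indicator_def)
      have "(\<integral>\<^sup>+h. ?I h \<partial>lborel) = (\<integral>\<^sup>+h. 0 \<partial>(lborel :: real measure))"
        by (intro nn_integral_cong) (rule I0)
      then show ?thesis using False by (simp add: descend_odd_def defs)
    next
      case a: True
      have "0 < v (1 - i) * b" using ab yh[of a] a by simp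
      then have b: "0 < b" using g by (simp add: zero_less_mult_iff)
      have K: "0 \<le> K" unfolding K_def using lam[OF i] lam[OF compl_in, of i] b w by simp
      have D: "D h = (y - v i * h) * (a - h) ^ n" for h
        unfolding D_def using ab by (simp add: algebra_simps flip: ab)
      have "(\<integral>\<^sup>+h. ?I h \<partial>lborel) = (\<integral>\<^sup>+h. ennreal (K * D h) * indicator {0..a} h \<partial>lborel)"
      proof (rule nn_integral_cong_AE)
        show "AE h in lborel. ?I h = ennreal (K * D h) * indicator {0..a} h"
          using AE_lborel_singleton[of a]
        proof eventually_elim
          case (elim h)
          have "lam i * ?c h * w = K * D h * of_bool (0 < a - h)"
            unfolding D K_def by (simp add: power_mult_distrib mult_ac)
          then show ?case unfolding I using elim yh[of h] by (auto simp: indicator_def)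
        qed
      qed
      also have "\<dots> = ennreal (- K * (v (1 - i) * b / real (Suc n) * (a - a) ^ Suc n + v i / real (n + 2) * (a - a) ^ (n + 2))
          - - K * (v (1 - i) * b / real (Suc n) * (a - 0) ^ Suc n + v i / real (n + 2) * (a - 0) ^ (n + 2)))"
      proof (rule nn_integral_FTC_Icc)
        show "(\<lambda>h. K * D h) \<in> borel_measurable borel" unfolding D_def by measurable
        show "0 \<le> a" using a by simp
        fix h assume "h \<in> {0..a}"
        then show "0 \<le> K * D h" unfolding D using K yh[of h] by simp
        have 1: "((\<lambda>h. a - h) has_real_derivative - 1) (at h)" by (auto intro!: derivative_eq_intros)
        have "((\<lambda>h. - K * (v (1 - i) * b / real (Suc n) * (a - h) ^ Suc n + v i / real (n + 2) * (a - h) ^ (n + 2)))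
            has_real_derivative - K * (v (1 - i) * b / real (Suc n) * (real (Suc n) * (- 1 * (a - h) ^ (Suc n - Suc 0))) +
              v i / real (n + 2) * (real (n + 2) * (- 1 * (a - h) ^ (n + 2 - Suc 0))))) (at h)"
          by (intro DERIV_cmult DERIV_add DERIV_power 1)
        moreover have "- K * (v (1 - i) * b / real (Suc n) * (real (Suc n) * (- 1 * (a - h) ^ (Suc n - Suc 0))) +
              v i / real (n + 2) * (real (n + 2) * (- 1 * (a - h) ^ (n + 2 - Suc 0)))) = K * D h"
          unfolding D_def by (simp add: algebra_simps del: of_nat_Suc of_nat_add)
        ultimately show "((\<lambda>h. - K * (v (1 - i) * b / real (Suc n) * (a - h) ^ Suc n + v i / real (n + 2) * (a - h) ^ (n + 2)))
            has_real_derivative K * D h) (at h)" by simp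
      qed
      also have "- K * (v (1 - i) * b / real (Suc n) * (a - a) ^ Suc n + v i / real (n + 2) * (a - a) ^ (n + 2))
          - - K * (v (1 - i) * b / real (Suc n) * (a - 0) ^ Suc n + v i / real (n + 2) * (a - 0) ^ (n + 2)) =
          K * (v (1 - i) * b / real (Suc n) * a ^ Suc n + v i / real (n + 2) * a ^ (n + 2))"
        by simp
      also have "\<dots> = K / real (Suc n) * a ^ Suc n * (y - v i / real (Suc n + 1) * a)"
      proof -
        \<comment> \<open>Since \<open>1 - 1 / (n + 2) = (n + 1) / (n + 2)\<close>, pulling out the
          common factor \<open>1 / (n + 1)\<close> lets the second term complete the first one to
          \<open>y\<close>.\<close>
        have "v i / real (n + 2) * a ^ (n + 2) = a ^ Suc n / real (Suc n) * (v i * a - v i / real (Suc n + 1) * a)"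
        proof -
          define m where "m = real (Suc n)"
          have m: "0 < m" "real (n + 2) = m + 1" "real (Suc n + 1) = m + 1" by (simp_all add: m_def)
          have "v i * a - v i / (m + 1) * a = m * (v i * a / (m + 1))"
            using m(1) by (simp add: field_simps)
          then show ?thesis unfolding m m_def[symmetric] using m(1) by simp
        qed
        moreover have "K * (u / m * r + r / m * (x - q)) = K / m * r * (x + u - q)" for u m r x q
          by (simp add: algebra_simps add_divide_distrib diff_divide_distrib)
        ultimately show ?thesis unfolding ab[symmetric] by (simp only:)
      qed
      \<comment> \<open>The integral contains \<open>b ^ n\<close>, the power in the closed form
        \<open>b ^ Suc n\<close>; hence the division by \<open>occ v (1 - i) t y\<close>
        there.\<close>
      also have "\<dots> = descend_odd lam v i (Suc n) y t"
        using a b unfolding descend_odd_def defs(1,2,3)[symmetric] K_def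
        by (simp add: power_mult_distrib power2_eq_square mult_ac)
      finally show ?thesis .
    qed
  qed (simp_all add: measurable_densities)
  then show ?thesis by simp
qed

text \<open>With occupation times \<open>a\<close> and \<open>b\<close>, the level balance
  \<open>y - v i * a = v (1 - i) * b\<close> turns the constant \<open>v (1 - i)\<close> of the
  density for one switching into the quotient in \<open>descend_odd\<close>. It also yields
  \<open>0 < b\<close> from \<open>0 < a\<close>.\<close>

lemma descend_odd_0:
  assumes i: "i \<in> {0, 1}" and g: "v i < 0" "0 < v (1 - i)"
  shows "mass_density lam v i 1 (descend_odd lam v i 0)"
proof (rule mass_density_cong)
  note ctx = i lam[OF i] lam[OF compl_in] velocity_neq[OF i]
  have g0: "v i \<noteq> 0" using g by simp
  show "mass_density lam v i 1 (\<lambda>y t. lam i * v (1 - i) * occ_weight lam v i t y *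
      of_bool (0 \<le> occ v i t y \<and> 0 < occ v (1 - i) t y))"
    by (rule mass_density_1[OF ctx g(2) g0])
  fix y :: real assume y: "0 < y"
  show "AE t in lborel. lam i * v (1 - i) * occ_weight lam v i t y *
      of_bool (0 \<le> occ v i t y \<and> 0 < occ v (1 - i) t y) = descend_odd lam v i 0 y t"
    using AE_lborel_singleton[of "y / v (1 - i)"]
  proof eventually_elim
    case (elim t)
    let ?a = "occ v i t y" and ?b = "occ v (1 - i) t y"
    have a0: "?a \<noteq> 0" unfolding occ_def using elim g(2) velocity_neq[OF i] by (auto simp: field_simps)
    have ab: "y - v i * ?a = v (1 - i) * ?b" using occ_level[OF ctx, of t y] by simp
    have "0 < ?b" if "0 < ?a"
    proof -
      have "0 < y - v i * ?a" using y g mult_neg_pos[of "v i" ?a] that by linarith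
      then show ?thesis unfolding ab using g by (simp add: zero_less_mult_iff)
    qed
    then show ?case using a0 ab by (auto simp: descend_odd_def less_le)
  qed
qed (rule measurable_densities)

text \<open>The two recursions alternate: descending start with \<open>2 * n + 1\<close> switchings,
  ascending start with \<open>2 * n + 2\<close>, descending start with \<open>2 * n + 3\<close>. In
  the other parity the last leg would descend; those zero densities begin at one switching and
  propagate.\<close>

lemma opposite_sign_densities:
  assumes i: "i \<in> {0, 1}" and g: "0 < v i" "v (1 - i) < 0"
  shows "mass_density lam v (1 - i) (2 * n + 1) (descend_odd lam v (1 - i) n)"
    and "mass_density lam v i (2 * n + 2) (climb_even lam v i n)"
    and "mass_density lam v i (2 * n + 1) (\<lambda>y t. 0)"
    and "mass_density lam v (1 - i) (2 * n + 2) (\<lambda>y t. 0)"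
proof -
  note compl_i = compl_compl[OF i]
  note ctx = i lam[OF i] lam[OF compl_in] velocity_neq[OF i]
  have g': "0 < v (1 - (1 - i))" "v i \<noteq> 0" using g compl_i by simp_all
  have *: "mass_density lam v (1 - i) (2 * n + 1) (descend_odd lam v (1 - i) n)" for n
  proof (induction n)
    case 0
    show ?case using descend_odd_0[OF compl_in g(2) g'(1)] by simp
  next
    case (Suc n)
    show ?case
      by (rule descend_odd_Suc_from_climb_even[OF compl_in g(2) g'(1)])
        (use climb_even_from_descend_odd[OF i g Suc] compl_i in simp)
  qed
  show "mass_density lam v (1 - i) (2 * n + 1) (descend_odd lam v (1 - i) n)" by (rule *)
  show "mass_density lam v i (2 * n + 2) (climb_even lam v i n)"
    by (rule climb_even_from_descend_odd[OF i g *])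
  have lam': "0 < lam (1 - (1 - i))" using lam[OF i] compl_i by simp
  have down: "mass_density lam v (1 - i) (Suc m) (\<lambda>y t. 0)"
    if "mass_density lam v i m (\<lambda>y t. 0)" "0 < m" for m
    by (rule mass_density_zero_Suc[where i="1 - i" and lam=lam and v=v,
          OF compl_in lam[OF compl_in] lam' velocity_neq[OF compl_in]])
      (use that compl_i in simp_all)
  have z: "mass_density lam v i (2 * n + 1) (\<lambda>y t. 0)" for n
  proof (induction n)
    case 0
    show ?case using mass_density_zero_1[OF ctx g(2) g'(2)] by simp
  next
    case (Suc n)
    show ?case using mass_density_zero_Suc[OF ctx down[OF Suc]] by simp
  qed
  show "mass_density lam v i (2 * n + 1) (\<lambda>y t. 0)" by (rule z)
  show "mass_density lam v (1 - i) (2 * n + 2) (\<lambda>y t. 0)" using down[OF z] by simp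
qed

end

section \<open>Holding times of a two-state Markov process\<close>

text \<open>For samples from index \<open>r\<close> on: the next \<open>n\<close> runs, the leading
  one in state \<open>s\<close>, have more than \<open>c 0\<close>, \<open>c 1\<close>, ... samples.
  A run of \<open>l\<close> samples occupies \<open>r\<close> to \<open>r + l - 1\<close>; the
  recursive call forces the other state at \<open>r + l\<close>.\<close>

fun grid_hold :: "nat \<Rightarrow> (nat \<Rightarrow> nat) \<Rightarrow> nat \<Rightarrow> nat \<Rightarrow> (nat \<Rightarrow> nat) \<Rightarrow> bool" where
  "grid_hold 0 c s r X \<longleftrightarrow> X r = s"
| "grid_hold (Suc n) c s r X \<longleftrightarrow>
    (\<exists>l>c 0. (\<forall>k<l. X (r + k) = s) \<and> grid_hold n (\<lambda>j. c (Suc j)) (1 - s) (r + l) X)"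

lemma grid_hold_start: "grid_hold n c s r X \<Longrightarrow> X r = s"
  by (cases n) (fastforce dest: spec[of _ "0::nat"])+

text \<open>Fixes the transition function \<open>p\<close> whose existence
  \<open>two_state_markov\<close> asserts. It is known only through conditional probabilities on
  events of positive probability and through its rates at 0.\<close>

locale two_state = prob_space M for M :: "'a measure" +
  fixes lam :: "nat \<Rightarrow> real" and X :: "real \<Rightarrow> 'a \<Rightarrow> nat" and p :: "real \<Rightarrow> nat \<Rightarrow> nat \<Rightarrow> real"
  assumes lam_pos: "i \<in> {0, 1} \<Longrightarrow> 0 < lam i"
    and meas: "0 \<le> t \<Longrightarrow> X t \<in> M \<rightarrow>\<^sub>M count_space {0, 1}"
    and cadlag: "w \<in> space M \<Longrightarrow> cadlag_path (\<lambda>t. X t w)"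
    and markov: "0 \<le> \<tau> 0 \<Longrightarrow> strict_mono_on {..Suc n} \<tau> \<Longrightarrow> (\<And>k. k \<le> Suc n \<Longrightarrow> s k \<in> {0, 1}) \<Longrightarrow>
      \<P>(w in M. \<forall>k\<le>n. X (\<tau> k) w = s k) > 0 \<Longrightarrow>
      \<P>(w in M. X (\<tau> (Suc n)) w = s (Suc n) \<bar> \<forall>k\<le>n. X (\<tau> k) w = s k)
        = p (\<tau> (Suc n) - \<tau> n) (s n) (s (Suc n))"
    and rate: "i \<in> {0, 1} \<Longrightarrow> ((\<lambda>h. p h i (1 - i) / h) \<longlongrightarrow> lam i) (at_right 0)"
begin

lemma state_01: "0 \<le> t \<Longrightarrow> w \<in> space M \<Longrightarrow> X t w \<in> {0, 1}"
  using measurable_space[OF meas] by simp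

lemma pred_state [measurable]: "0 \<le> t \<Longrightarrow> Measurable.pred M (\<lambda>w. X t w = s)"
proof -
  assume t: "0 \<le> t"
  have "{w \<in> space M. X t w = s} = X t -` ({s} \<inter> {0, 1}) \<inter> space M"
    using state_01[OF t] by auto
  then show ?thesis using measurable_sets[OF meas[OF t], of "{s} \<inter> {0, 1}"] by (simp add: pred_def)
qed

text \<open>The Markov property is given for conditioning events of positive probability; for the
  others both sides are 0.\<close>

lemma chain_step:
  assumes "0 \<le> \<tau> 0" "strict_mono_on {..Suc n} \<tau>" "\<And>k. k \<le> Suc n \<Longrightarrow> s k \<in> {0, 1}"
  shows "prob {w \<in> space M. \<forall>k\<le>Suc n. X (\<tau> k) w = s k} =
    prob {w \<in> space M. \<forall>k\<le>n. X (\<tau> k) w = s k} * p (\<tau> (Suc n) - \<tau> n) (s n) (s (Suc n))"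
proof -
  let ?A = "{w \<in> space M. \<forall>k\<le>n. X (\<tau> k) w = s k}"
  let ?B = "{w \<in> space M. \<forall>k\<le>Suc n. X (\<tau> k) w = s k}"
  have t: "0 \<le> \<tau> k" if "k \<le> Suc n" for k
    using assms(1) strict_mono_onD[OF assms(2), of 0 k] that by (cases "k = 0") force+
  have B: "?B = {w \<in> space M. X (\<tau> (Suc n)) w = s (Suc n) \<and> (\<forall>k\<le>n. X (\<tau> k) w = s k)}"
    by (auto simp: le_Suc_eq)
  show ?thesis
  proof (cases "prob ?A > 0")
    case True
    with markov[where s=s, OF assms(1,2) assms(3)]
    have "\<P>(w in M. X (\<tau> (Suc n)) w = s (Suc n) \<bar> \<forall>k\<le>n. X (\<tau> k) w = s k)
        = p (\<tau> (Suc n) - \<tau> n) (s n) (s (Suc n))" by blast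
    then show ?thesis using True unfolding B cond_prob_def by (simp add: field_simps)
  next
    case False
    then have "prob ?A = 0" using measure_nonneg[of M ?A] by linarith
    moreover have m: "Measurable.pred M (\<lambda>w. k \<le> n \<longrightarrow> X (\<tau> k) w = s k)" for k
      using pred_state[OF t] by (cases "k \<le> n") simp_all
    have "prob ?B \<le> prob ?A"
    proof (rule finite_measure_mono)
      show "?B \<subseteq> ?A" by auto
      show "?A \<in> events"
        by (rule sets.sets_Collect_countable_All) (rule m[unfolded pred_def])
    qed
    ultimately show ?thesis using measure_nonneg[of M ?B] by simp
  qed
qed

section \<open>Transition probabilities over a short time\<close>

lemma two_step:
  assumes "0 \<le> t" "0 < d" "i \<in> {0, 1}" "j \<in> {0, 1}"
  shows "prob {w \<in> space M. X t w = i \<and> X (t + d) w = j} = prob {w \<in> space M. X t w = i} * p d i j"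
proof -
  define \<tau> where "\<tau> k = t + real k * d" for k
  define s where "s k = (if k = 0 then i else j)" for k :: nat
  have 1: "0 \<le> \<tau> 0" unfolding \<tau>_def using assms(1) by simp
  have 2: "strict_mono_on {..Suc 0} \<tau>"
    unfolding \<tau>_def using assms(2) by (intro strict_mono_onI) simp
  have 3: "s k \<in> {0, 1}" for k unfolding s_def using assms(3,4) by (cases "k = 0") simp_all
  have two: "(\<forall>k\<le>Suc 0. Q k) \<longleftrightarrow> Q 0 \<and> Q (Suc 0)" for Q :: "nat \<Rightarrow> bool"
    by (auto simp: le_Suc_eq)
  have v: "\<tau> 0 = t" "\<tau> (Suc 0) = t + d" "s 0 = i" "s (Suc 0) = j"
    by (simp_all add: \<tau>_def s_def)
  show ?thesis using chain_step[where s=s, OF 1 2 3] unfolding two v by (simp add: v)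
qed

lemma prob_split:
  assumes "0 \<le> t" and [measurable]: "Measurable.pred M Q"
  shows "prob {w \<in> space M. Q w} =
    prob {w \<in> space M. Q w \<and> X t w = 0} + prob {w \<in> space M. Q w \<and> X t w = 1}"
proof -
  note [measurable] = pred_state[OF assms(1)]
  have "{w \<in> space M. Q w} = {w \<in> space M. Q w \<and> X t w = 0} \<union> {w \<in> space M. Q w \<and> X t w = 1}"
    using state_01[OF assms(1)] by auto
  then show ?thesis by (simp only:) (rule finite_measure_Union; auto)
qed

text \<open>Nothing ties \<open>p\<close> to probabilities in the row of a state that is never
  occupied, hence the premise that \<open>i\<close> has positive probability at some time.\<close>

lemma p_row_sum:
  assumes "0 \<le> t" "0 < d" "i \<in> {0, 1}" "0 < prob {w \<in> space M. X t w = i}"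
  shows "p d i 0 + p d i 1 = 1"
proof -
  have "prob {w \<in> space M. X t w = i} = prob {w \<in> space M. X t w = i} * (p d i 0 + p d i 1)"
  proof (subst prob_split[of "t + d"])
    show "0 \<le> t + d" using assms by simp
    show "Measurable.pred M (\<lambda>w. X t w = i)" using assms(1) by (rule pred_state)
    show "prob {w \<in> space M. X t w = i \<and> X (t + d) w = 0} + prob {w \<in> space M. X t w = i \<and> X (t + d) w = 1} =
        prob {w \<in> space M. X t w = i} * (p d i 0 + p d i 1)"
      unfolding two_step[OF assms(1-3) insertI1] two_step[OF assms(1-3) insertI2[OF singletonI]]
      by (rule distrib_left[symmetric])
  qed
  then show ?thesis using assms(4) by simp
qed

lemma ev_p_pos: assumes "i \<in> {0, 1}" shows "\<forall>\<^sub>F d in at_right 0. 0 < p d i (1 - i)"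
  using order_tendstoD(1)[OF rate[OF assms] lam_pos[OF assms]] eventually_at_right_less[of "0::real"]
  by eventually_elim (simp add: zero_less_divide_iff)

lemma p_tendsto_0: "i \<in> {0, 1} \<Longrightarrow> ((\<lambda>d. p d i (1 - i)) \<longlongrightarrow> 0) (at_right 0)"
proof -
  assume i: "i \<in> {0, 1}"
  have "((\<lambda>d. p d i (1 - i) / d * d) \<longlongrightarrow> lam i * 0) (at_right 0)"
    by (intro tendsto_mult rate i) (simp add: tendsto_ident_at)
  then show ?thesis
    unfolding mult_zero_right
    by (rule Lim_transform_eventually)
       (use eventually_at_right_less[of "0::real"] in eventually_elim, simp)
qed

text \<open>If state \<open>i\<close> is excluded at time 0, the other state is certain there, and
  its positive rate makes a jump into \<open>i\<close> possible within a short time. So both rows of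
  \<open>p\<close> carry information.\<close>

lemma reachable:
  assumes "i \<in> {0, 1}"
  obtains t where "0 \<le> t" "0 < prob {w \<in> space M. X t w = i}"
proof (cases "0 < prob {w \<in> space M. X 0 w = i}")
  case False
  have "prob {w \<in> space M. X 0 w = 0} + prob {w \<in> space M. X 0 w = 1} = 1"
    using prob_split[of 0 "\<lambda>_. True"] prob_space by simp
  then have pos: "0 < prob {w \<in> space M. X 0 w = 1 - i}"
    using assms False measure_nonneg[of M "{w \<in> space M. X 0 w = i}"] by auto
  have i': "1 - i \<in> {0, 1}" "1 - (1 - i) = i" using assms by auto
  obtain d where d: "0 < d" "0 < p d (1 - i) i"
    using eventually_happens'[OF _ eventually_conj[OF ev_p_pos[OF i'(1)] eventually_at_right_less]] i'
    by (metis trivial_limit_at_right_real)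
  have "0 < prob {w \<in> space M. X 0 w = 1 - i \<and> X (0 + d) w = i}"
    using two_step[of 0 d "1 - i" i] i' assms d pos by simp
  also have "\<dots> \<le> prob {w \<in> space M. X d w = i}"
    using d pred_state[of d i] by (intro finite_measure_mono) (auto simp: pred_def)
  finally show thesis using that[of d] d by simp
qed (use that[of 0] in simp)

text \<open>Defined through the probability of leaving, because the hypothesis on the rates concerns
  \<open>p d i (1 - i)\<close>.\<close>

definition stay :: "real \<Rightarrow> nat \<Rightarrow> real" where
  "stay d i = 1 - p d i (1 - i)"

lemma p_stay: "i \<in> {0, 1} \<Longrightarrow> 0 < d \<Longrightarrow> p d i i = stay d i"
proof -
  assume i: "i \<in> {0, 1}" and d: "0 < d"
  obtain t where "0 \<le> t" "0 < prob {w \<in> space M. X t w = i}" using reachable[OF i] by blast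
  from p_row_sum[OF this(1) d i this(2)] show ?thesis using i by (auto simp: stay_def)
qed

section \<open>Geometric holding times of the sampled chain\<close>

lemma pred_grid: "0 < d \<Longrightarrow> Measurable.pred M (\<lambda>w. X (real k * d) w = s)"
  by (intro pred_state) auto

lemma pred_grid_hold:
  assumes "0 < d"
  shows "Measurable.pred M (\<lambda>w. grid_hold n c s r (\<lambda>k. X (real k * d) w))"
proof (induction n arbitrary: c s r)
  case (Suc n)
  note [measurable] = Suc pred_grid[OF assms]
  show ?case unfolding grid_hold.simps by measurable
qed (simp add: pred_grid[OF assms])

context
  fixes d :: real
  assumes d: "0 < d" and stay: "\<And>i. i \<in> {0, 1} \<Longrightarrow> 0 < stay d i \<and> stay d i < 1"
begin

lemma grid_step:
  assumes "\<And>k. s k \<in> {0, 1}"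
  shows "prob {w \<in> space M. \<forall>k\<le>Suc n. X (real k * d) w = s k} =
    prob {w \<in> space M. \<forall>k\<le>n. X (real k * d) w = s k} * p d (s n) (s (Suc n))"
  using chain_step[of "\<lambda>k. real k * d" n s] assms d
  by (simp add: strict_mono_on_def algebra_simps)

lemmas [measurable] = pred_grid[OF d] pred_grid_hold[OF d]

text \<open>\<open>f (min k r)\<close> is the history \<open>f\<close> frozen at its value at index
  \<open>r\<close>: \<open>m\<close> further samples without a change.\<close>

lemma grid_stay:
  assumes f: "\<And>k. f k \<in> {0, 1}"
  shows "prob {w \<in> space M. \<forall>k\<le>r + m. X (real k * d) w = f (min k r)} =
    prob {w \<in> space M. \<forall>k\<le>r. X (real k * d) w = f k} * stay d (f r) ^ m"
proof (induction m)
  case 0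
  show ?case by (auto intro!: arg_cong[of _ _ prob])
next
  case (Suc m)
  then show ?case using grid_step[of "\<lambda>k. f (min k r)" "r + m"] f p_stay[OF f d, of r] by simp
qed

lemma grid_leave:
  assumes f: "\<And>k. f k \<in> {0, 1}"
  shows "prob {w \<in> space M. \<forall>k\<le>r + Suc m. X (real k * d) w = (if k \<le> r + m then f (min k r) else 1 - f r)} =
    prob {w \<in> space M. \<forall>k\<le>r. X (real k * d) w = f k} * stay d (f r) ^ m * (1 - stay d (f r))"
proof -
  let ?f = "\<lambda>k. if k \<le> r + m then f (min k r) else 1 - f r"
  have "1 - f r \<in> {0, 1}" using f[of r] by auto
  then have "?f k \<in> {0, 1}" for k using f[of "min k r"] by (simp split: if_split)
  from grid_step[of ?f "r + m", OF this]
  have "prob {w \<in> space M. \<forall>k\<le>r + Suc m. X (real k * d) w = ?f k} =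
      prob {w \<in> space M. \<forall>k\<le>r + m. X (real k * d) w = ?f k} * p d (f r) (1 - f r)"
    by simp
  also have "{w \<in> space M. \<forall>k\<le>r + m. X (real k * d) w = ?f k} =
      {w \<in> space M. \<forall>k\<le>r + m. X (real k * d) w = f (min k r)}"
    by auto
  finally show ?thesis unfolding grid_stay[of f, OF f] by (simp add: stay_def)
qed

text \<open>Stated for an arbitrary history \<open>f\<close> up to \<open>r\<close>, so that the
  induction hypothesis applies to the history prolonged by one run. Summing over the length of that
  run is a geometric series: the terms \<open>q ^ (c 0 + m) * (1 - q)\<close> add up to
  \<open>q ^ c 0\<close>.\<close>

lemma prob_grid_hold:
  assumes "\<And>k. f k \<in> {0, 1}"
  shows "prob {w \<in> space M. (\<forall>k\<le>r. X (real k * d) w = f k) \<and> grid_hold n c (f r) r (\<lambda>k. X (real k * d) w)} =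
    prob {w \<in> space M. \<forall>k\<le>r. X (real k * d) w = f k} * (\<Prod>j<n. stay d (alt (f r) j) ^ c j)"
  using assms
proof (induction n arbitrary: c r f)
  case 0
  show ?case by (auto intro!: arg_cong[of _ _ prob])
next
  case (Suc n)
  let ?X = "\<lambda>w k. X (real k * d) w"
  let ?c = "\<lambda>j. c (Suc j)"
  let ?f = "\<lambda>m k. if k \<le> r + m then f (min k r) else 1 - f r"
  let ?P = "prob {w \<in> space M. \<forall>k\<le>r. ?X w k = f k}"
  \<comment> \<open>In \<open>?E m\<close> the run from \<open>r\<close> has \<open>m + 1\<close>
    samples, so more than \<open>c 0\<close> samples means \<open>m \<ge> c 0\<close>; hence the
    index \<open>c 0 + m\<close> below.\<close>
  let ?E = "\<lambda>m. {w \<in> space M. (\<forall>k\<le>r + Suc m. ?X w k = ?f m k) \<and> grid_hold n ?c (1 - f r) (r + Suc m) (?X w)}"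
  let ?q = "stay d (f r)"
  let ?R = "\<Prod>j<n. stay d (alt (f r) (Suc j)) ^ c (Suc j)"
  have wr: "1 - f r \<in> {0, 1}" using Suc.prems[of r] by auto
  have f': "?f m k \<in> {0, 1}" for m k using Suc.prems[of "min k r"] wr by (simp split: if_split)
  have E: "prob (?E m) = ?P * ?q ^ m * (1 - ?q) * ?R" for m
    using Suc.IH[of "?f m" "r + Suc m" ?c, OF f'] grid_leave[of f r m, OF Suc.prems] Suc.prems[of r]
    by (simp add: alt_Suc)
  have disj: "disjoint_family (\<lambda>m. ?E (c 0 + m))"
    unfolding disjoint_family_on_def
  proof (intro ballI impI)
    fix m m' :: nat assume "m \<noteq> m'"
    have *: "?E (c 0 + m) \<inter> ?E (c 0 + m') = {}" if "m < m'" for m m'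
    proof -
      have "False" if "w \<in> ?E (c 0 + m)" "w \<in> ?E (c 0 + m')" for w
      proof -
        have "?X w (r + Suc (c 0 + m)) = 1 - f r" using that(1) by auto
        moreover have "?X w k = ?f (c 0 + m') k" if "k \<le> r + Suc (c 0 + m')" for k
          using \<open>w \<in> ?E (c 0 + m')\<close> that by blast
        from this[of "r + Suc (c 0 + m)"] have "?X w (r + Suc (c 0 + m)) = f r"
          using \<open>m < m'\<close> by (simp add: min_def)
        ultimately show False using Suc.prems[of r] by auto
      qed
      then show ?thesis by blast
    qed
    show "?E (c 0 + m) \<inter> ?E (c 0 + m') = {}"
      using *[of m m'] *[of m' m] \<open>m \<noteq> m'\<close> by (metis Int_commute nat_neq_iff)
  qed
  have un: "{w \<in> space M. (\<forall>k\<le>r. ?X w k = f k) \<and> grid_hold (Suc n) c (f r) r (?X w)} = (\<Union>m. ?E (c 0 + m))"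
  proof (intro equalityI subsetI)
    fix w assume "w \<in> {w \<in> space M. (\<forall>k\<le>r. ?X w k = f k) \<and> grid_hold (Suc n) c (f r) r (?X w)}"
    then obtain l where l: "w \<in> space M" "\<forall>k\<le>r. ?X w k = f k" "c 0 < l" "\<forall>k<l. ?X w (r + k) = f r"
      "grid_hold n ?c (1 - f r) (r + l) (?X w)" by auto
    obtain m where m: "l = Suc (c 0 + m)" using l(3) less_imp_Suc_add by blast
    have "?X w k = ?f (c 0 + m) k" if kle: "k \<le> r + Suc (c 0 + m)" for k
    proof -
      consider "k \<le> r" | "r < k" "k < r + l" | "k = r + l" using kle m by linarith
      then show ?thesis
      proof cases
        case 2
        then show ?thesis using l(4)[rule_format, of "k - r"] m by (simp add: min_def)
      next
        case 3
        then show ?thesis using grid_hold_start[OF l(5)] m by simp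
      qed (use l(2) in \<open>simp add: min_def\<close>)
    qed
    then have "w \<in> ?E (c 0 + m)" using l m by blast
    then show "w \<in> (\<Union>m. ?E (c 0 + m))" by blast
  next
    fix w assume "w \<in> (\<Union>m. ?E (c 0 + m))"
    then obtain m where m: "w \<in> ?E (c 0 + m)" by blast
    then have X: "\<And>k. k \<le> r + Suc (c 0 + m) \<Longrightarrow> ?X w k = ?f (c 0 + m) k" by blast
    have "?X w k = f k" if "k \<le> r" for k using X[of k] that by (simp add: min_def)
    moreover have "?X w (r + k) = f r" if "k < Suc (c 0 + m)" for k using X[of "r + k"] that by (simp add: min_def)
    ultimately show "w \<in> {w \<in> space M. (\<forall>k\<le>r. ?X w k = f k) \<and> grid_hold (Suc n) c (f r) r (?X w)}"
      using m by (auto intro!: exI[of _ "Suc (c 0 + m)"])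
  qed
  have "(\<lambda>m. prob (?E (c 0 + m))) sums prob (\<Union>m. ?E (c 0 + m))"
    by (rule finite_measure_UNION[OF _ disj]) auto
  moreover have "(\<lambda>m. prob (?E (c 0 + m))) sums (?P * ?q ^ c 0 * ?R)"
  proof -
    have q: "0 < ?q" "?q < 1" using stay[OF Suc.prems[of r]] by auto
    have "(\<lambda>m. ?q ^ m) sums (1 / (1 - ?q))" using q by (intro geometric_sums) auto
    then have "(\<lambda>m. ?P * ?q ^ c 0 * (1 - ?q) * ?R * ?q ^ m) sums (?P * ?q ^ c 0 * (1 - ?q) * ?R * (1 / (1 - ?q)))"
      by (rule sums_mult)
    moreover have "?P * ?q ^ c 0 * (1 - ?q) * ?R * (1 / (1 - ?q)) = ?P * ?q ^ c 0 * ?R" using q by simp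
    ultimately show ?thesis unfolding E by (simp add: power_add mult_ac)
  qed
  ultimately have "prob (\<Union>m. ?E (c 0 + m)) = ?P * ?q ^ c 0 * ?R" by (rule sums_unique2)
  then show ?case unfolding un prod.lessThan_Suc_shift by simp
qed

end

end

text \<open>\<open>C j\<close> is the index at which run \<open>j\<close> starts. The run length in
  \<open>grid_hold\<close> is unique: at a smaller one the state has not changed yet, and a longer
  run would contain the change.\<close>

lemma grid_hold_iff:
  fixes X C :: "nat \<Rightarrow> nat"
  assumes i: "i \<in> {0, 1}" and C: "\<And>j. j \<le> N \<Longrightarrow> C j < C (Suc j)"
    and X: "\<And>j k. j \<le> N \<Longrightarrow> C j \<le> k \<Longrightarrow> k < C (Suc j) \<Longrightarrow> X k = alt i j"
    and "a + n \<le> N"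
  shows "grid_hold n c (alt i a) (C a) X \<longleftrightarrow> (\<forall>j<n. c j < C (Suc (a + j)) - C (a + j))"
  using assms(4)
proof (induction n arbitrary: c a)
  case 0
  then show ?case using X[of a "C a"] C[of a] by simp
next
  case (Suc n)
  let ?L = "C (Suc a) - C a"
  have aN: "a < N" using Suc.prems by simp
  have alt: "1 - alt i a = alt i (Suc a)" using alt_Suc'[OF i] by simp
  have CL: "C (Suc a) = C a + ?L" "0 < ?L" using C[of a] aN by auto
  have stay: "X (C a + k) = alt i a" if "k < ?L" for k
    using X[of a "C a + k"] that aN by simp
  have leave: "X (C a + ?L) = alt i (Suc a)"
    using X[of "Suc a" "C (Suc a)"] C[of "Suc a"] aN CL(1) by simp
  have uniq: "l = ?L" if "\<forall>k<l. X (C a + k) = alt i a" "X (C a + l) = alt i (Suc a)" for l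
  proof (rule ccontr)
    assume "l \<noteq> ?L"
    then consider "l < ?L" | "?L < l" by linarith
    then show False
      using that stay[of l] leave alt_Suc_neq[OF i, of a] by cases auto
  qed
  have "grid_hold (Suc n) c (alt i a) (C a) X \<longleftrightarrow>
      c 0 < ?L \<and> grid_hold n (\<lambda>j. c (Suc j)) (alt i (Suc a)) (C a + ?L) X"
    unfolding grid_hold.simps alt
    using uniq stay grid_hold_start[of n "\<lambda>j. c (Suc j)" "alt i (Suc a)" _ X] by blast
  also have "\<dots> \<longleftrightarrow> c 0 < ?L \<and> (\<forall>j<n. c (Suc j) < C (Suc (Suc a + j)) - C (Suc a + j))"
    using Suc.IH[of "Suc a" "\<lambda>j. c (Suc j)"] Suc.prems CL by simp
  also have "\<dots> \<longleftrightarrow> (\<forall>j<Suc n. c j < C (Suc (a + j)) - C (a + j))"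
    by (simp add: All_less_Suc2)
  finally show ?case .
qed

text \<open>The earliest sample of leg \<open>j\<close> has index
  \<open>\<lceil>elapsed h j / d\<rceil>\<close>. A mesh of at most \<open>h j\<close> puts a sample
  into leg \<open>j\<close>, so no switching is overlooked.\<close>

lemma grid_hold_path:
  fixes d :: real
  assumes i: "i \<in> {0, 1}" and h: "\<And>j. 0 < h j" and d: "0 < d" "\<And>j. j \<le> n \<Longrightarrow> d \<le> h j"
    and x: "\<And>j t. elapsed h j \<le> t \<Longrightarrow> t < elapsed h (Suc j) \<Longrightarrow> x t = alt i j"
  shows "grid_hold n (\<lambda>j. nat \<lfloor>c j / d\<rfloor>) i 0 (\<lambda>k. x (real k * d)) \<longleftrightarrow>
    (\<forall>j<n. c j < d * real (nat \<lceil>elapsed h (Suc j) / d\<rceil>) - d * real (nat \<lceil>elapsed h j / d\<rceil>))"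
proof -
  let ?C = "\<lambda>j. nat \<lceil>elapsed h j / d\<rceil>"
  have e0: "0 \<le> elapsed h j" for j unfolding elapsed_def using h by (intro sum_nonneg) (auto intro: less_imp_le)
  have C: "?C j < ?C (Suc j)" if "j \<le> n" for j
  proof -
    have "elapsed h j / d + 1 \<le> elapsed h (Suc j) / d"
      using d(1) d(2)[OF that] by (simp add: elapsed_Suc field_simps)
    then have "\<lceil>elapsed h j / d\<rceil> + 1 \<le> \<lceil>elapsed h (Suc j) / d\<rceil>" by linarith
    moreover have "0 \<le> elapsed h j / d" using e0 d by simp
    then have "0 \<le> \<lceil>elapsed h j / d\<rceil>" by linarith
    ultimately show ?thesis by linarith
  qed
  have X: "x (real k * d) = alt i j" if "?C j \<le> k" "k < ?C (Suc j)" for j k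
  proof (rule x)
    have "elapsed h j / d \<le> real k" using that(1) by linarith
    then show "elapsed h j \<le> real k * d" using d by (simp add: field_simps)
    have "real k < elapsed h (Suc j) / d" using that(2) by linarith
    then show "real k * d < elapsed h (Suc j)" using d by (simp add: field_simps)
  qed
  have "grid_hold n (\<lambda>j. nat \<lfloor>c j / d\<rfloor>) (alt i 0) (?C 0) (\<lambda>k. x (real k * d)) \<longleftrightarrow>
      (\<forall>j<n. nat \<lfloor>c j / d\<rfloor> < ?C (Suc (0 + j)) - ?C (0 + j))"
    by (rule grid_hold_iff[OF i, of n]) (use C X in auto)
  moreover have "nat \<lfloor>c j / d\<rfloor> < ?C (Suc j) - ?C j \<longleftrightarrow> c j < d * real (?C (Suc j)) - d * real (?C j)"
    if "j < n" for j
  proof -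
    \<comment> \<open>Positivity of the run length covers negative \<open>c j\<close>, where
      \<open>nat\<close> truncates the floor to 0.\<close>
    have "0 < ?C (Suc j) - ?C j" using C[of j] that by simp
    then have "nat \<lfloor>c j / d\<rfloor> < ?C (Suc j) - ?C j \<longleftrightarrow> c j / d < real (?C (Suc j) - ?C j)" by linarith
    also have "real (?C (Suc j) - ?C j) = real (?C (Suc j)) - real (?C j)"
      by (rule of_nat_diff[OF less_imp_le[OF C]]) (use that in simp)
    also have "c j / d < real (?C (Suc j)) - real (?C j) \<longleftrightarrow> c j < d * real (?C (Suc j)) - d * real (?C j)"
      unfolding pos_divide_less_eq[OF d(1)] by (simp add: algebra_simps)
    finally show ?thesis .
  qed
  ultimately show ?thesis by simp
qed

text \<open>Rounding moves \<open>a / d\<close> by at most 1, hence \<open>a\<close> by at most one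
  mesh.\<close>

lemma grid_round_tendsto:
  fixes a :: real
  assumes "\<And>d. 0 < d \<Longrightarrow> \<bar>f d - a / d\<bar> \<le> 1"
  shows "((\<lambda>d. d * f d) \<longlongrightarrow> a) (at_right 0)"
proof (rule Lim_transform_bound[OF _ tendsto_ident_at, THEN LIM_zero_cancel])
  show "\<forall>\<^sub>F d in at_right 0. norm (d * f d - a) \<le> norm d"
    using eventually_at_right_less[of "0::real"]
  proof eventually_elim
    case (elim d)
    then have "d * \<bar>f d - a / d\<bar> \<le> d * 1" by (intro mult_left_mono assms) auto
    moreover have "d * f d - a = d * (f d - a / d)" using elim by (simp add: field_simps)
    ultimately show ?case using elim by (simp add: abs_mult)
  qed
qed

lemma grid_ceiling_tendsto:
  assumes "0 \<le> a"
  shows "((\<lambda>d. d * real (nat \<lceil>a / d\<rceil>)) \<longlongrightarrow> a) (at_right 0)"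
proof (rule grid_round_tendsto)
  fix d :: real assume "0 < d"
  with assms have "0 \<le> a / d" by simp
  then show "\<bar>real (nat \<lceil>a / d\<rceil>) - a / d\<bar> \<le> 1" by linarith
qed

lemma grid_floor_tendsto:
  assumes "0 \<le> a"
  shows "((\<lambda>d. d * real (nat \<lfloor>a / d\<rfloor>)) \<longlongrightarrow> a) (at_right 0)"
proof (rule grid_round_tendsto)
  fix d :: real assume "0 < d"
  with assms have "0 \<le> a / d" by simp
  then show "\<bar>real (nat \<lfloor>a / d\<rfloor>) - a / d\<bar> \<le> 1" by linarith
qed

text \<open>Sampled holding times converge to the true ones, so strict inequalities in either
  direction are decided for all small meshes; the case of equality stays open.\<close>

lemma eventually_grid_hold:
  assumes i: "i \<in> {0, 1}" and h: "\<And>j. 0 < h j"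
    and x: "\<And>j t. elapsed h j \<le> t \<Longrightarrow> t < elapsed h (Suc j) \<Longrightarrow> x t = alt i j"
  shows "(\<And>j. j < n \<Longrightarrow> c j < h j) \<Longrightarrow>
      \<forall>\<^sub>F d in at_right 0. grid_hold n (\<lambda>j. nat \<lfloor>c j / d\<rfloor>) i 0 (\<lambda>k. x (real k * d))"
    and "\<exists>j<n. h j < c j \<Longrightarrow>
      \<forall>\<^sub>F d in at_right 0. \<not> grid_hold n (\<lambda>j. nat \<lfloor>c j / d\<rfloor>) i 0 (\<lambda>k. x (real k * d))"
proof -
  let ?D = "\<lambda>d j. d * real (nat \<lceil>elapsed h (Suc j) / d\<rceil>) - d * real (nat \<lceil>elapsed h j / d\<rceil>)"
  have e0: "0 \<le> elapsed h j" for j unfolding elapsed_def using h by (intro sum_nonneg) (auto intro: less_imp_le)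
  have lim: "((\<lambda>d. ?D d j) \<longlongrightarrow> h j) (at_right 0)" for j
    using tendsto_diff[OF grid_ceiling_tendsto[OF e0[of "Suc j"]] grid_ceiling_tendsto[OF e0[of j]]]
    by (simp add: elapsed_Suc)
  have "\<forall>\<^sub>F d in at_right 0. \<forall>j\<in>{..n}. d \<le> h j"
  proof (rule eventually_ball_finite)
    show "\<forall>j\<in>{..n}. \<forall>\<^sub>F d in at_right 0. d \<le> h j"
      using h by (auto simp: eventually_at_right_field intro!: exI[of _ "h _"] less_imp_le)
  qed simp
  with eventually_at_right_less[of "0::real"]
  have iff: "\<forall>\<^sub>F d in at_right 0. grid_hold n (\<lambda>j. nat \<lfloor>c j / d\<rfloor>) i 0 (\<lambda>k. x (real k * d)) \<longleftrightarrow>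
      (\<forall>j<n. c j < ?D d j)"
    by eventually_elim (rule grid_hold_path[OF i h]; use x in auto)
  show "\<forall>\<^sub>F d in at_right 0. grid_hold n (\<lambda>j. nat \<lfloor>c j / d\<rfloor>) i 0 (\<lambda>k. x (real k * d))"
    if "\<And>j. j < n \<Longrightarrow> c j < h j"
  proof -
    have "\<forall>\<^sub>F d in at_right 0. \<forall>j\<in>{..<n}. c j < ?D d j"
      using order_tendstoD(1)[OF lim] that by (intro eventually_ball_finite) auto
    with iff show ?thesis by eventually_elim auto
  qed
  show "\<forall>\<^sub>F d in at_right 0. \<not> grid_hold n (\<lambda>j. nat \<lfloor>c j / d\<rfloor>) i 0 (\<lambda>k. x (real k * d))"
    if ex: "\<exists>j<n. h j < c j"
  proof -
    obtain j where j: "j < n" "h j < c j" using ex by blast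
    from iff order_tendstoD(2)[OF lim j(2)] show ?thesis
      by eventually_elim (use j(1) in \<open>auto dest: less_asym\<close>)
  qed
qed

text \<open>Fatou's lemma for events: \<open>U\<close> lies in the limit inferior of the
  \<open>W m\<close>.\<close>

lemma (in finite_measure) measure_le_liminf:
  assumes W: "\<And>m::nat. W m \<in> sets M" and U: "U \<in> sets M"
    and sub: "\<And>w. w \<in> U \<Longrightarrow> \<forall>\<^sub>F m in sequentially. w \<in> W m"
    and lim: "(\<lambda>m. measure M (W m)) \<longlonglongrightarrow> l"
  shows "measure M U \<le> l"
proof -
  let ?I = "\<lambda>k. \<Inter>m\<in>{k..}. W m"
  have I: "?I k \<in> sets M" for k using W by auto
  have "incseq ?I" by (rule monoI) force
  then have "(\<lambda>k. measure M (?I k)) \<longlonglongrightarrow> measure M (\<Union>k. ?I k)"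
    using I by (intro finite_Lim_measure_incseq) auto
  then have "measure M (\<Union>k. ?I k) \<le> l"
  proof (rule LIMSEQ_le[OF _ lim])
    show "\<exists>N. \<forall>k\<ge>N. measure M (?I k) \<le> measure M (W k)"
      using W by (intro exI[of _ 0] allI impI finite_measure_mono) auto
  qed
  moreover have "U \<subseteq> (\<Union>k. ?I k)" using sub by (force simp: eventually_sequentially)
  then have "measure M U \<le> measure M (\<Union>k. ?I k)" using I by (intro finite_measure_mono) auto
  ultimately show ?thesis by simp
qed

lemma ln_one_minus_tendsto: "((\<lambda>u::real. ln (1 - u) / u) \<longlongrightarrow> -1) (at 0)"
proof -
  have "((\<lambda>u::real. ln (1 - u)) has_real_derivative -1) (at 0)"
    by (auto intro!: derivative_eq_intros)
  then show ?thesis by (simp add: has_field_derivative_iff)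
qed

context two_state
begin

lemma ev_stay: "\<forall>\<^sub>F d in at_right 0. \<forall>i\<in>{0, 1}. 0 < stay d i \<and> stay d i < 1"
proof (rule eventually_ball_finite)
  show "\<forall>i\<in>{0, 1}. \<forall>\<^sub>F d in at_right 0. 0 < stay d i \<and> stay d i < 1"
  proof
    fix i :: nat assume i: "i \<in> {0, 1}"
    from order_tendstoD(2)[OF p_tendsto_0[OF i] zero_less_one] ev_p_pos[OF i]
    show "\<forall>\<^sub>F d in at_right 0. 0 < stay d i \<and> stay d i < 1"
      by eventually_elim (auto simp: stay_def)
  qed
qed simp

text \<open>The logarithm of the power is a product of \<open>ln (1 - p) / p\<close>,
  \<open>p / d\<close> and \<open>d * \<lfloor>c / d\<rfloor>\<close>, with limits
  \<open>-1\<close>, \<open>lam i\<close> and \<open>c\<close>.\<close>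

lemma stay_power_tendsto:
  assumes i: "i \<in> {0, 1}" and c: "0 \<le> c"
  shows "((\<lambda>d. stay d i ^ nat \<lfloor>c / d\<rfloor>) \<longlongrightarrow> exp (- (lam i * c))) (at_right 0)"
proof -
  let ?p = "\<lambda>d. p d i (1 - i)"
  have "filterlim ?p (at 0) (at_right 0)"
    using p_tendsto_0[OF i] ev_p_pos[OF i]
    by (intro filterlim_atI) (auto elim: eventually_mono)
  then have "((\<lambda>d. ln (1 - ?p d) / ?p d) \<longlongrightarrow> -1) (at_right 0)"
    by (rule filterlim_compose[OF ln_one_minus_tendsto])
  then have "((\<lambda>d. ln (1 - ?p d) / ?p d * (?p d / d) * (d * real (nat \<lfloor>c / d\<rfloor>))) \<longlongrightarrow> -1 * lam i * c) (at_right 0)"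
    by (intro tendsto_mult rate i grid_floor_tendsto c)
  then have "((\<lambda>d. exp (ln (1 - ?p d) / ?p d * (?p d / d) * (d * real (nat \<lfloor>c / d\<rfloor>)))) \<longlongrightarrow> exp (-1 * lam i * c)) (at_right 0)"
    by (rule tendsto_exp)
  moreover have "\<forall>\<^sub>F d in at_right 0. exp (ln (1 - ?p d) / ?p d * (?p d / d) * (d * real (nat \<lfloor>c / d\<rfloor>))) = stay d i ^ nat \<lfloor>c / d\<rfloor>"
    using ev_stay ev_p_pos[OF i] eventually_at_right_less[of "0::real"]
  proof eventually_elim
    case (elim d)
    then have "0 < stay d i" using i by blast
    then have "stay d i ^ nat \<lfloor>c / d\<rfloor> = exp (real (nat \<lfloor>c / d\<rfloor>) * ln (stay d i))"
      by (simp add: exp_of_nat_mult)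
    then show ?case using elim by (simp add: stay_def mult.commute)
  qed
  ultimately show ?thesis by (simp add: Lim_transform_eventually)
qed

text \<open>One fixed mesh suffices: \<open>n\<close> further samples in the same state have
  probability at most the \<open>n\<close>-th power of a number below 1, and only countably many
  starting samples have to be excluded.\<close>

lemma AE_leaves: "AE w in M. \<forall>t\<ge>0. \<exists>s>t. X s w \<noteq> X t w"
proof -
  obtain d where d: "0 < d" and stay: "\<forall>i\<in>{0, 1}. 0 < stay d i \<and> stay d i < 1"
    using eventually_happens'[OF _ eventually_conj[OF ev_stay eventually_at_right_less]]
    by (metis trivial_limit_at_right_real)
  have const: "prob {w \<in> space M. \<forall>k\<le>n. X (real (m + k) * d) w = i} \<le> stay d i ^ n"
    if i: "i \<in> {0, 1}" for i m n
  proof (induction n)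
    case 0
    then show ?case by simp
  next
    case (Suc n)
    have "prob {w \<in> space M. \<forall>k\<le>Suc n. X (real (m + k) * d) w = i} =
        prob {w \<in> space M. \<forall>k\<le>n. X (real (m + k) * d) w = i} *
        p (real (m + Suc n) * d - real (m + n) * d) i i"
      by (rule chain_step) (use d i in \<open>auto simp: strict_mono_on_def\<close>)
    also have "real (m + Suc n) * d - real (m + n) * d = d" by (simp add: algebra_simps)
    also have "p d i i = stay d i" by (rule p_stay[OF i d])
    finally have "prob {w \<in> space M. \<forall>k\<le>Suc n. X (real (m + k) * d) w = i} =
        prob {w \<in> space M. \<forall>k\<le>n. X (real (m + k) * d) w = i} * stay d i" .
    also have "\<dots> \<le> stay d i ^ n * stay d i"
      using stay i Suc by (intro mult_right_mono) (auto intro: less_imp_le)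
    finally show ?case by (simp add: mult.commute)
  qed
  have ev [measurable]: "Measurable.pred M (\<lambda>w. X (real k * d) w = s)" for k s
    using d by (intro pred_state) auto
  have "AE w in M. \<not> (\<forall>k. X (real (m + k) * d) w = i)" if i: "i \<in> {0, 1}" for i m
  proof -
    let ?A = "{w \<in> space M. \<forall>k. X (real (m + k) * d) w = i}"
    have A: "?A \<in> events" by measurable
    have "prob ?A \<le> stay d i ^ n" for n
    proof -
      have "prob ?A \<le> prob {w \<in> space M. \<forall>k\<le>n. X (real (m + k) * d) w = i}"
      proof (rule finite_measure_mono)
        show "?A \<subseteq> {w \<in> space M. \<forall>k\<le>n. X (real (m + k) * d) w = i}" by auto
        show "{w \<in> space M. \<forall>k\<le>n. X (real (m + k) * d) w = i} \<in> events"
          by (intro sets.sets_Collect_countable_All sets.sets_Collect_imp sets.sets_Collect_const ev[unfolded pred_def])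
      qed
      with const[OF i] show ?thesis by (rule order_trans[rotated])
    qed
    moreover have "(\<lambda>n. stay d i ^ n) \<longlonglongrightarrow> 0"
      using stay i by (intro LIMSEQ_realpow_zero) (auto intro: less_imp_le)
    ultimately have "prob ?A \<le> 0" by (intro LIMSEQ_le_const) auto
    then have "prob ?A = 0" using measure_nonneg[of M ?A] by linarith
    then have "?A \<in> null_sets M" using A by (simp add: null_sets_def emeasure_eq_measure)
    from AE_not_in[OF this] AE_space show ?thesis by eventually_elim auto
  qed
  then have "AE w in M. \<forall>m. \<not> (\<forall>k. X (real (m + k) * d) w = i)" if "i \<in> {0, 1}" for i
    using that by (simp only: AE_all_countable) blast
  from AE_conjI[OF this[of 0] this[of 1]]
  have "AE w in M. \<forall>i\<in>{0, 1}. \<forall>m. \<not> (\<forall>k. X (real (m + k) * d) w = i)"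
    by simp
  with AE_space show ?thesis
  proof eventually_elim
    case (elim w)
    show ?case
    proof (intro allI impI)
      fix t :: real assume t: "0 \<le> t"
      define m where "m = nat \<lceil>t / d\<rceil>"
      have "t / d \<le> real m" unfolding m_def by linarith
      then have m: "t \<le> real m * d" using d by (simp add: field_simps)
      have "X t w \<in> {0, 1}" using elim t by (intro state_01)
      then obtain k where k: "X (real (m + k) * d) w \<noteq> X t w" using elim by blast
      have "real m * d \<le> real (m + k) * d" using d by (intro mult_right_mono) auto
      with m have "t \<le> real (m + k) * d" by simp
      moreover have "t \<noteq> real (m + k) * d" using k by auto
      ultimately show "\<exists>s>t. X s w \<noteq> X t w" using k by (auto intro!: exI[of _ "real (m + k) * d"])
    qed
  qed
qed

text \<open>Made for a random \<open>a\<close>: evaluating \<open>X\<close> at a random time is not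
  obviously measurable, while two rationals after \<open>a\<close> at which the states differ
  involve fixed times only. The \<open>max 0\<close> keeps these times where \<open>X\<close> is
  known to be measurable.\<close>

lemma switches_before_iff:
  assumes w: "w \<in> space M" and a: "0 \<le> a"
  shows "(\<exists>s>a. X s w \<noteq> X a w \<and> s < t) \<longleftrightarrow>
    (\<exists>r q::rat. a < real_of_rat r \<and> r < q \<and> real_of_rat q < t \<and>
      X (max 0 (real_of_rat r)) w \<noteq> X (max 0 (real_of_rat q)) w)"
    (is "?L \<longleftrightarrow> ?R")
proof
  assume ?R
  then obtain r q :: rat where rq: "a < real_of_rat r" "r < q" "real_of_rat q < t"
    "X (max 0 (real_of_rat r)) w \<noteq> X (max 0 (real_of_rat q)) w" by blast
  have m: "max 0 (real_of_rat r) = real_of_rat r" "max 0 (real_of_rat q) = real_of_rat q"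
    and lt: "real_of_rat r < real_of_rat q"
    using rq a of_rat_less[of r q, where 'a = real] by auto
  show ?L
  proof (cases "X (real_of_rat r) w = X a w")
    case True
    then have "X (real_of_rat q) w \<noteq> X a w" using rq(4) m by simp
    then show ?L using rq lt by (intro exI[of _ "real_of_rat q"]) simp
  next
    case False
    then show ?L using rq lt by (intro exI[of _ "real_of_rat r"]) simp
  qed
next
  assume ?L
  then obtain s where s: "a < s" "X s w \<noteq> X a w" "s < t" by blast
  have rc: "\<exists>b>u. \<forall>s. u \<le> s \<longrightarrow> s < b \<longrightarrow> X s w = X u w" if u: "0 \<le> u" for u
  proof (rule right_constant[OF cadlag[OF w] _ zero_less_one u])
    show "X t w \<in> {0, 1}" if "0 \<le> t" for t using that w by (rule state_01)
  qed blast
  have s0: "0 \<le> s" using a s(1) by simp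
  obtain b where b: "a < b" "\<And>u. a \<le> u \<Longrightarrow> u < b \<Longrightarrow> X u w = X a w"
    using rc[OF a] by blast
  obtain c where c: "s < c" "\<And>u. s \<le> u \<Longrightarrow> u < c \<Longrightarrow> X u w = X s w"
    using rc[OF s0] by blast
  obtain r where r: "a < real_of_rat r" "real_of_rat r < min b s"
    using of_rat_dense[of a "min b s"] b(1) s(1) by auto
  obtain q where q: "s < real_of_rat q" "real_of_rat q < min c t"
    using of_rat_dense[of s "min c t"] c(1) s(3) by auto
  have "real_of_rat r < real_of_rat q" using r q by simp
  then have "r < q" by (simp only: of_rat_less)
  moreover have "X (real_of_rat r) w = X a w" using b(2)[of "real_of_rat r"] r by simp
  moreover have "X (real_of_rat q) w = X s w" using c(2)[of "real_of_rat q"] q by simp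
  moreover have "max 0 (real_of_rat r) = real_of_rat r" "max 0 (real_of_rat q) = real_of_rat q"
    using r(1) q(1) a s0 by linarith+
  ultimately show ?R using r q s(2) by (intro exI[of _ r] exI[of _ q]) simp
qed

lemma switch_time_measurable [measurable]:
  assumes K: "0 < K"
  shows "(\<lambda>w. switch_time K (\<lambda>t. X t w) j) \<in> borel_measurable M"
proof (induction j)
  case (Suc j)
  let ?J = "\<lambda>w. switch_time K (\<lambda>t. X t w) j"
  let ?S = "\<lambda>w. {s. ?J w < s \<and> X s w \<noteq> X (?J w) w}"
  let ?Q = "\<lambda>w (r::rat) q. ?J w < real_of_rat r \<and> r < q \<and>
    X (max 0 (real_of_rat r)) w \<noteq> X (max 0 (real_of_rat q)) w"
  note [measurable] = Suc
  have [measurable]: "Measurable.pred M (\<lambda>w. X (max 0 u) w \<noteq> X (max 0 s) w)" for u s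
  proof -
    have [measurable]: "Measurable.pred M (\<lambda>w. X (max 0 a) w = s)" for a s
      by (rule pred_state) simp
    have "Measurable.pred M (\<lambda>w. \<exists>j. X (max 0 u) w = j \<and> \<not> X (max 0 s) w = j)" by measurable
    then show ?thesis by (rule back_subst[where P="Measurable.pred M"]) auto
  qed
  have iff: "switch_time K (\<lambda>t. X t w) (Suc j) < t \<longleftrightarrow>
      (\<exists>r q. ?Q w r q \<and> real_of_rat q < t) \<or> (\<not> (\<exists>r q. ?Q w r q) \<and> ?J w + K < t)"
    if w: "w \<in> space M" for w t
  proof -
    have J0: "0 \<le> ?J w"
      by (rule switch_time_nonneg[OF cadlag[OF w] _ K]) (use state_01[OF _ w] in blast)
    note sb = switches_before_iff[OF w J0]
    have 1: "(\<exists>r q. ?Q w r q \<and> real_of_rat q < u) \<longleftrightarrow> (\<exists>s\<in>?S w. s < u)" for u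
      using sb[of u] by blast
    \<comment> \<open>The equivalence above carries an upper bound; here a bound just beyond the
      witness is inserted.\<close>
    have 2: "(\<exists>r q. ?Q w r q) \<longleftrightarrow> ?S w \<noteq> {}"
    proof
      assume "\<exists>r q. ?Q w r q"
      then obtain r q where rq: "?Q w r q" by blast
      have "\<exists>r q'. ?Q w r q' \<and> real_of_rat q' < real_of_rat q + 1"
        by (rule exI[of _ r], rule exI[of _ q]) (use rq in simp)
      with 1 show "?S w \<noteq> {}" by blast
    next
      assume "?S w \<noteq> {}"
      then obtain s where "s \<in> ?S w" by blast
      then have "\<exists>r q. ?Q w r q \<and> real_of_rat q < s + 1" unfolding 1 by (intro bexI[of _ s]) simp_all
      then show "\<exists>r q. ?Q w r q" by blast
    qed
    have J: "switch_time K (\<lambda>t. X t w) (Suc j) = (if ?S w \<noteq> {} then Inf (?S w) else ?J w + K)"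
      unfolding switch_time_Suc by (auto simp: Let_def)
    have bb: "bdd_below (?S w)" by (rule bdd_belowI[of _ "?J w"]) auto
    show ?thesis unfolding 1 2 J using cInf_less_iff[OF _ bb, of t] by auto
  qed
  show ?case
  proof (subst borel_measurable_iff_less, intro allI)
    fix t
    have "{w \<in> space M. switch_time K (\<lambda>t. X t w) (Suc j) < t} = {w \<in> space M.
        (\<exists>r q. ?Q w r q \<and> real_of_rat q < t) \<or> (\<not> (\<exists>r q. ?Q w r q) \<and> ?J w + K < t)}"
      using iff by blast
    also have "\<dots> \<in> sets M" by measurable
    finally show "{w \<in> space M. switch_time K (\<lambda>t. X t w) (Suc j) < t} \<in> sets M" .
  qed
qed simp

lemma holding_measurable [measurable]:
  "0 < K \<Longrightarrow> (\<lambda>w. holding K (\<lambda>t. X t w) j) \<in> borel_measurable M"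
  unfolding holding_def by measurable

lemma holding_pos: "0 < K \<Longrightarrow> w \<in> space M \<Longrightarrow> 0 < holding K (\<lambda>t. X t w) j"
  using switch_time_step(1)[OF cadlag _ _ switch_time_nonneg[OF cadlag]] state_01
  unfolding holding_def by (metis diff_gt_0_iff_gt)

lemma skeleton_path:
  assumes "0 < K" "w \<in> space M"
  shows "skeleton K (X 0 w) (holding K (\<lambda>t. X t w)) (\<lambda>t. X t w)"
  by (rule skeleton_holding[OF cadlag[OF assms(2)] _ assms(1)]) (rule state_01[OF _ assms(2)])

text \<open>If no state is kept forever, the default step is never taken. Almost surely, the fixed
  choice \<open>K = 1\<close> therefore describes the whole path.\<close>

lemma holding_eq_of_leaves:
  assumes w: "w \<in> space M" and K: "0 < K" "0 < K'" and lv: "\<forall>t\<ge>0. \<exists>s>t. X s w \<noteq> X t w"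
  shows "holding K (\<lambda>t. X t w) = holding K' (\<lambda>t. X t w)"
proof -
  have "switch_time K (\<lambda>t. X t w) j = switch_time K' (\<lambda>t. X t w) j" for j
  proof (induction j)
    case (Suc j)
    have "0 \<le> switch_time K' (\<lambda>t. X t w) j"
      by (rule switch_time_nonneg[OF cadlag[OF w] _ K(2)]) (use state_01[OF _ w] in blast)
    with lv show ?case unfolding switch_time_Suc Suc Let_def by simp
  qed simp
  then show ?thesis by (auto simp: holding_def)
qed

lemma skeleton_of_leaves:
  assumes w: "w \<in> space M" and lv: "\<forall>t\<ge>0. \<exists>s>t. X s w \<noteq> X t w"
  shows "skeleton K (X 0 w) (holding 1 (\<lambda>t. X t w)) (\<lambda>t. X t w)"
proof -
  have "skeleton (max 1 K) (X 0 w) (holding 1 (\<lambda>t. X t w)) (\<lambda>t. X t w)"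
    using skeleton_path[of "max 1 K" w] w holding_eq_of_leaves[OF w _ _ lv, of "max 1 K" 1] by simp
  then show ?thesis unfolding skeleton_def less_max_iff_disj by blast
qed

text \<open>Outside a null set, exceeding all thresholds \<open>c\<close> implies the grid event for
  all small meshes, and failing to exceed them implies its failure for larger thresholds
  \<open>c'\<close>. \<open>measure_le_liminf\<close> turns the former into an upper bound and the
  latter, through complements, into a lower one.\<close>

lemma prob_holding_tail:
  assumes i: "i \<in> {0, 1}" and c: "\<And>j. 0 \<le> c j"
  shows "prob {w \<in> space M. X 0 w = i \<and> (\<forall>j<n. c j < holding 1 (\<lambda>t. X t w) j)} =
    prob {w \<in> space M. X 0 w = i} * (\<Prod>j<n. exp (- (lam (alt i j) * c j)))"
proof -
  define L where "L = {w \<in> space M. \<forall>t\<ge>0. \<exists>s>t. X s w \<noteq> X t w}"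
  let ?H = "\<lambda>w. holding 1 (\<lambda>t. X t w)"
  let ?U = "\<lambda>c. {w \<in> space M. X 0 w = i \<and> (\<forall>j<n. c j < ?H w j)}"
  let ?W = "\<lambda>c d. {w \<in> space M. grid_hold n (\<lambda>j. nat \<lfloor>c j / d\<rfloor>) i 0 (\<lambda>k. X (real k * d) w)}"
  let ?\<pi> = "prob {w \<in> space M. X 0 w = i}"
  let ?G = "\<lambda>c. ?\<pi> * (\<Prod>j<n. exp (- (lam (alt i j) * c j)))"
  have m0 [measurable]: "Measurable.pred M (\<lambda>w. X 0 w = i)" by (rule pred_state) simp
  have mH [measurable]: "(\<lambda>w. ?H w j) \<in> borel_measurable M" for j by (rule holding_measurable) simp
  obtain N where N: "N \<in> null_sets M" and NL: "\<And>w. w \<in> space M \<Longrightarrow> w \<notin> N \<Longrightarrow> w \<in> L"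
    using AE_leaves unfolding L_def eventually_ae_filter by blast
  have N_ev [measurable]: "N \<in> sets M" using N by auto
  have U_N: "prob (?U c - N) = prob (?U c)" for c using N by (intro measure_Diff_null_set) auto
  have W: "prob (?W c d) = ?\<pi> * (\<Prod>j<n. stay d (alt i j) ^ nat \<lfloor>c j / d\<rfloor>)"
    if "0 < d" "\<forall>i\<in>{0, 1}. 0 < stay d i \<and> stay d i < 1" for d c
  proof -
    have "?W c d = {w \<in> space M. (\<forall>k\<le>0. X (real k * d) w = i) \<and>
        grid_hold n (\<lambda>j. nat \<lfloor>c j / d\<rfloor>) i 0 (\<lambda>k. X (real k * d) w)}"
      using grid_hold_start by fastforce
    then show ?thesis
      using prob_grid_hold[of d "\<lambda>_. i" 0 n "\<lambda>j. nat \<lfloor>c j / d\<rfloor>"] that i by simp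
  qed
  have limW: "((\<lambda>d. prob (?W c d)) \<longlongrightarrow> ?G c) (at_right 0)" if c: "\<And>j. 0 \<le> c j" for c
  proof -
    have "((\<lambda>d. ?\<pi> * (\<Prod>j<n. stay d (alt i j) ^ nat \<lfloor>c j / d\<rfloor>)) \<longlongrightarrow> ?G c) (at_right 0)"
      by (intro tendsto_mult tendsto_const tendsto_prod stay_power_tendsto alt_in i c)
    moreover have "\<forall>\<^sub>F d in at_right 0. ?\<pi> * (\<Prod>j<n. stay d (alt i j) ^ nat \<lfloor>c j / d\<rfloor>) = prob (?W c d)"
      using ev_stay eventually_at_right_less[of "0::real"] by eventually_elim (simp add: W)
    ultimately show ?thesis by (rule Lim_transform_eventually)
  qed
  define \<delta> :: "nat \<Rightarrow> real" where "\<delta> m = inverse (real (Suc m))" for m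
  have \<delta>: "filterlim \<delta> (at_right 0) sequentially"
    unfolding \<delta>_def by (simp add: filterlim_at LIMSEQ_inverse_real_of_nat del: of_nat_Suc)
  have \<delta>_pos: "0 < \<delta> m" for m by (simp add: \<delta>_def)
  have W_ev [measurable]: "?W c (\<delta> m) \<in> events" for c m
    by (rule predE[OF pred_grid_hold[OF \<delta>_pos]])
  have limW\<delta>: "(\<lambda>m. prob (?W c (\<delta> m))) \<longlonglongrightarrow> ?G c" if "\<And>j. 0 \<le> c j" for c
    by (rule filterlim_compose[OF limW \<delta>]) (rule that)
  have path: "X t w = alt (X 0 w) j"
    if "w \<in> L" "elapsed (?H w) j \<le> t" "t < elapsed (?H w) (Suc j)" for w j t
  proof -
    have "skeleton (t + 1) (X 0 w) (?H w) (\<lambda>t. X t w)"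
      by (rule skeleton_of_leaves) (use that(1) in \<open>simp_all add: L_def\<close>)
    then show ?thesis unfolding skeleton_def using that(2,3) by (meson less_add_one)
  qed
  have Hpos: "0 < ?H w j" if "w \<in> space M" for w j
    by (rule holding_pos) (use that in auto)
  have upper: "prob (?U c) \<le> ?G c" if c: "\<And>j. 0 \<le> c j" for c
  proof -
    have "prob (?U c - N) \<le> ?G c"
    proof (rule measure_le_liminf[OF W_ev _ _ limW\<delta>[OF c]])
      show "?U c - N \<in> events" by measurable
      fix w assume w: "w \<in> ?U c - N"
      then have L: "w \<in> L" using NL by blast
      have "\<forall>\<^sub>F d in at_right 0. grid_hold n (\<lambda>j. nat \<lfloor>c j / d\<rfloor>) i 0 (\<lambda>k. X (real k * d) w)"
        by (rule eventually_grid_hold(1)[OF i, of "?H w"]) (use w Hpos path[OF L] in auto)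
      then have "\<forall>\<^sub>F d in at_right 0. w \<in> ?W c d" using w by simp
      then show "\<forall>\<^sub>F m in sequentially. w \<in> ?W c (\<delta> m)"
        using \<delta> by (rule eventually_compose_filterlim)
    qed
    then show ?thesis unfolding U_N .
  qed
  have lower: "?G c' \<le> prob (?U c)" if c: "\<And>j. 0 \<le> c j" "\<And>j. c j < c' j" for c c'
  proof -
    let ?V = "space M - ?U c - N"
    have "prob ?V \<le> 1 - ?G c'"
    proof (rule measure_le_liminf[where W="\<lambda>m. space M - ?W c' (\<delta> m)"])
      show "space M - ?W c' (\<delta> m) \<in> events" for m by measurable
      show "?V \<in> events" by measurable
      have "\<And>j. 0 \<le> c' j" using c by (meson less_imp_le order_trans)
      from tendsto_diff[OF tendsto_const[of 1] limW\<delta>[OF this]]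
      show "(\<lambda>m. prob (space M - ?W c' (\<delta> m))) \<longlonglongrightarrow> 1 - ?G c'"
        by (simp only: prob_compl[OF W_ev])
      fix w assume w: "w \<in> ?V"
      then have L: "w \<in> L" using NL by blast
      have "\<forall>\<^sub>F d in at_right 0. \<not> grid_hold n (\<lambda>j. nat \<lfloor>c' j / d\<rfloor>) i 0 (\<lambda>k. X (real k * d) w)"
      proof (cases "X 0 w = i")
        case True
        then obtain j where "j < n" "?H w j \<le> c j" using w by (auto simp: not_less)
        then have "\<exists>j<n. ?H w j < c' j" using c(2)[of j] by (intro exI[of _ j]) simp
        then show ?thesis
          by (rule eventually_grid_hold(2)[OF i, of "?H w", rotated 2]) (use w True Hpos path[OF L] in auto)
      next
        case False
        then have "\<not> grid_hold n (\<lambda>j. nat \<lfloor>c' j / d\<rfloor>) i 0 (\<lambda>k. X (real k * d) w)" for d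
          using grid_hold_start[of n _ i 0 "\<lambda>k. X (real k * d) w"] by auto
        then show ?thesis by simp
      qed
      then have "\<forall>\<^sub>F d in at_right 0. w \<in> space M - ?W c' d" using w by simp
      then show "\<forall>\<^sub>F m in sequentially. w \<in> space M - ?W c' (\<delta> m)"
        using \<delta> by (rule eventually_compose_filterlim)
    qed
    moreover have "prob ?V = 1 - prob (?U c)"
    proof -
      have "prob ?V = prob (space M - ?U c)" using N by (intro measure_Diff_null_set) auto
      also have "\<dots> = 1 - prob (?U c)" by (rule prob_compl) measurable
      finally show ?thesis .
    qed
    ultimately show ?thesis by simp
  qed
  \<comment> \<open>Letting the larger thresholds \<open>c + e\<close> decrease to \<open>c\<close>
    closes the gap.\<close>
  have "?G c \<le> prob (?U c)"
  proof (rule tendsto_upperbound)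
    have "((\<lambda>e. ?G (\<lambda>j. c j + e)) \<longlongrightarrow> ?G (\<lambda>j. c j + 0)) (at_right 0)"
      by (intro tendsto_intros)
    then show "((\<lambda>e. ?G (\<lambda>j. c j + e)) \<longlongrightarrow> ?G c) (at_right 0)" by simp
    show "\<forall>\<^sub>F e in at_right 0. ?G (\<lambda>j. c j + e) \<le> prob (?U c)"
      using eventually_at_right_less[of "0::real"] by eventually_elim (rule lower, use c in auto)
  qed simp
  moreover have "prob (?U c) \<le> ?G c" by (rule upper) (rule c)
  ultimately show ?thesis by simp
qed

end

text \<open>Together with the whole line, the tails \<open>{c<..}\<close> form an
  intersection-stable generator of the Borel sets, so factoring joint tails give independence;
  single tails identify the marginals.\<close>

lemma (in prob_space) distr_iid_exponential:
  assumes X: "\<And>j. X j \<in> borel_measurable M" and pos: "\<And>j w. w \<in> space M \<Longrightarrow> 0 < X j w"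
    and tails: "\<And>n c. (\<And>j. 0 \<le> c j) \<Longrightarrow>
      prob {w \<in> space M. \<forall>j<n. c j < X j w} = (\<Prod>j<n. exp (- c j))"
  shows "distr M (\<Pi>\<^sub>M j\<in>UNIV. borel) (\<lambda>w j::nat. X j w) =
    (\<Pi>\<^sub>M j\<in>UNIV. density lborel (exponential_density 1))"
proof -
  note [measurable] = X
  have tail: "prob {w \<in> space M. \<forall>j\<in>J. c j < X j w} = (\<Prod>j\<in>J. exp (- max 0 (c j)))"
    if J: "finite J" for J :: "nat set" and c
  proof -
    obtain n where n: "J \<subseteq> {..<n}" using finite_nat_bounded[OF J] by blast
    \<comment> \<open>Positive variables exceed the threshold 0, so indices outside \<open>J\<close>
      can be given 0 and negative thresholds can be raised to it.\<close>
    let ?c = "\<lambda>j. if j \<in> J then max 0 (c j) else 0"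
    have "{w \<in> space M. \<forall>j\<in>J. c j < X j w} = {w \<in> space M. \<forall>j<n. ?c j < X j w}"
      using n pos by (auto split: if_splits)
    then have "prob {w \<in> space M. \<forall>j\<in>J. c j < X j w} = (\<Prod>j<n. exp (- ?c j))"
      using tails[of ?c n] by simp
    also have "\<dots> = (\<Prod>j\<in>J. exp (- ?c j))" using n by (intro prod.mono_neutral_right) auto
    finally show ?thesis by simp
  qed
  have D: "distr M borel (X j) = density lborel (exponential_density 1)" for j
  proof -
    have "distributed M lborel (X j) (exponential_density 1)"
    proof (rule exponential_distributedI)
      fix a :: real assume a: "0 \<le> a"
      have "{w \<in> space M. X j w \<le> a} = space M - {w \<in> space M. a < X j w}" by auto
      then have "prob {w \<in> space M. X j w \<le> a} = 1 - prob {w \<in> space M. a < X j w}"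
        by (simp only:) (rule prob_compl, measurable)
      also have "\<dots> = 1 - exp (- a)" using tail[of "{j}" "\<lambda>_. a"] a by simp
      finally show "emeasure M {w \<in> space M. X j w \<le> a} = 1 - ennreal (exp (- a * 1))"
        by (simp add: emeasure_eq_measure ennreal_minus flip: ennreal_1)
    qed (use X in auto)
    from distributed_distr_eq_density[OF this] show ?thesis
      by (metis distr_cong sets_lborel)
  qed
  have "indep_vars (\<lambda>_. borel) X UNIV"
    unfolding indep_vars_def2
  proof (intro conjI ballI)
    show "indep_sets (\<lambda>i. {X i -` A \<inter> space M |A. A \<in> sets borel}) UNIV"
      unfolding indep_sets_finite_index_sets[of _ UNIV]
    proof (intro allI impI)
      fix J :: "nat set" assume J: "J \<noteq> {}" "finite J"
      let ?E = "insert UNIV (range greaterThan) :: real set set"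
      have "indep_vars (\<lambda>_. borel) X J"
      proof (subst indep_vars_finite[where E="\<lambda>_. ?E", OF J])
        show "sets borel = sigma_sets (space borel) ?E"
          unfolding borel_Ioi by (auto intro!: sigma_sets_eqI intro: sigma_sets_top sigma_sets.Basic)
        show "Int_stable ?E"
        proof -
          have "{a<..} \<inter> {b<..} = {max a b<..}" for a b :: real by auto
          then show ?thesis by (auto simp: Int_stable_def)
        qed
        show "\<forall>A\<in>J \<rightarrow> ?E. prob (\<Inter>j\<in>J. X j -` A j \<inter> space M) = (\<Prod>j\<in>J. prob (X j -` A j \<inter> space M))"
        proof
          fix A assume A: "A \<in> J \<rightarrow> ?E"
          have "\<exists>c. X j -` A j \<inter> space M = {w \<in> space M. c < X j w}" if "j \<in> J" for j
          proof -
            have "A j \<in> ?E" using A that by auto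
            then consider "A j = UNIV" | c where "A j = {c<..}" by auto
            then show ?thesis
            proof cases
              case 1
              then show ?thesis using pos by (intro exI[of _ 0]) auto
            qed auto
          qed
          then obtain c where c: "\<And>j. j \<in> J \<Longrightarrow> X j -` A j \<inter> space M = {w \<in> space M. c j < X j w}"
            by metis
          have "(\<Inter>j\<in>J. X j -` A j \<inter> space M) = {w \<in> space M. \<forall>j\<in>J. c j < X j w}"
            using c J(1) by auto
          moreover have "prob (X j -` A j \<inter> space M) = exp (- max 0 (c j))" if "j \<in> J" for j
            using tail[of "{j}" c] c[OF that] by simp
          ultimately show "prob (\<Inter>j\<in>J. X j -` A j \<inter> space M) = (\<Prod>j\<in>J. prob (X j -` A j \<inter> space M))"
            using tail[OF J(2), of c] by simp
        qed
      qed (use X in auto)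
      then show "indep_sets (\<lambda>i. {X i -` A \<inter> space M |A. A \<in> sets borel}) J"
        by (simp add: indep_vars_def2)
    qed
  qed (use X in auto)
  then show ?thesis
    by (subst (asm) indep_vars_iff_distr_eq_PiM) (auto simp: D restrict_def)
qed

section \<open>Passage laws of the telegraph process\<close>

lemma telegraph_uminus: "telegraph (\<lambda>i. - v i) X t w = - telegraph v X t w"
  by (simp add: telegraph_def)

lemma passage_time_uminus: "passage_time (\<lambda>i. - v i) X (- y) = passage_time v X y"
  by (simp add: passage_time_def telegraph_uminus fun_eq_iff)

context two_state
begin

lemma skeleton_path_ex:
  assumes "w \<in> space M"
  shows "\<exists>h. skeleton K (X 0 w) h (\<lambda>t. X t w)"
proof -
  have "skeleton (max 1 K) (X 0 w) (holding (max 1 K) (\<lambda>t. X t w)) (\<lambda>t. X t w)"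
    using assms by (intro skeleton_path) simp_all
  then have "skeleton K (X 0 w) (holding (max 1 K) (\<lambda>t. X t w)) (\<lambda>t. X t w)"
    unfolding skeleton_def less_max_iff_disj by blast
  then show ?thesis by blast
qed

lemma telegraph_continuous_path:
  assumes w: "w \<in> space M" and t: "0 \<le> t"
  shows "continuous_on {0..t} (\<lambda>t. telegraph v X t w)"
proof -
  obtain h where "skeleton (t + 1) (X 0 w) h (\<lambda>t. X t w)" using skeleton_path_ex[OF w] by blast
  from telegraph_continuous[where X=X and w=w, OF this state_01[OF order_refl w] t] show ?thesis by simp
qed

lemma telegraph_bounds:
  assumes w: "w \<in> space M" and t: "0 \<le> t"
  shows "min (v 0) (v 1) * t \<le> telegraph v X t w" "telegraph v X t w \<le> max (v 0) (v 1) * t"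
proof -
  obtain h where sk: "skeleton (t + 1) (X 0 w) h (\<lambda>t. X t w)" using skeleton_path_ex[OF w] by blast
  note i = state_01[OF order_refl w]
  obtain j where j: "elapsed h j \<le> t" "t < elapsed h (Suc j)" using skeleton_ex[OF sk i t] by blast
  have int: "((\<lambda>s. v (X s w)) has_integral telegraph v X t w) {0..t}"
    unfolding telegraph_def
    using skeleton_has_integral[OF sk i, of j t v] j by (intro integrable_integral) (auto simp: integrable_on_def)
  have c: "((\<lambda>s. c) has_integral c * t) {0..t}" for c :: real
    using has_integral_const_real[of c 0 t] t by (simp add: mult.commute)
  have b: "min (v 0) (v 1) \<le> v (X s w) \<and> v (X s w) \<le> max (v 0) (v 1)" if "s \<in> {0..t}" for s
    using state_01[of s w] that w by auto
  show "min (v 0) (v 1) * t \<le> telegraph v X t w" by (rule has_integral_le[OF c int]) (use b in blast)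
  show "telegraph v X t w \<le> max (v 0) (v 1) * t" by (rule has_integral_le[OF int c]) (use b in blast)
qed

text \<open>Holds for every path: its position at time \<open>t\<close> lies between the extreme
  velocities times \<open>t\<close>, on the other side of 0 from \<open>y\<close>.\<close>

lemma passage_time_never:
  assumes "(y < 0 \<and> 0 < v 1 \<and> v 1 \<le> v 0) \<or> (0 < y \<and> v 0 < 0 \<and> v 1 \<le> v 0)" and w: "w \<in> space M"
  shows "passage_time v X y w = \<infinity>"
proof -
  have "telegraph v X t w \<noteq> y" if t: "0 < t" for t
    using assms(1)
  proof
    assume a: "y < 0 \<and> 0 < v 1 \<and> v 1 \<le> v 0"
    then have "0 < min (v 0) (v 1) * t" using t by (intro mult_pos_pos) auto
    then show ?thesis using telegraph_bounds(1)[OF w, of t v] t a by linarith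
  next
    assume a: "0 < y \<and> v 0 < 0 \<and> v 1 \<le> v 0"
    then have "max (v 0) (v 1) * t < 0" using t by (intro mult_neg_pos) auto
    then show ?thesis using telegraph_bounds(2)[OF w, of t v] t a by linarith
  qed
  then show ?thesis by (auto simp: passage_time_def)
qed

definition passage_event :: "(nat \<Rightarrow> real) \<Rightarrow> real \<Rightarrow> nat \<Rightarrow> real set \<Rightarrow> 'a set" where
  "passage_event v y n A =
    {w \<in> space M. \<exists>t\<in>A. passage_time v X y w = ereal t \<and> switch_count X t w = n}"

text \<open>The restriction to \<open>t < K\<close> makes this valid for any description of the path
  up to the horizon \<open>K\<close>, also when the path stops switching.\<close>

lemma in_passage_event_iff:
  assumes w: "w \<in> space M" and y: "0 < y" and g: "v 0 \<noteq> 0" "v 1 \<noteq> 0"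
    and sk: "skeleton K (X 0 w) h (\<lambda>t. X t w)"
  shows "(\<exists>t\<in>A. t < K \<and> passage_time v X y w = ereal t \<and> switch_count X t w = n) \<longleftrightarrow>
    crosses v (X 0 w) y n h \<and> cross_time v (X 0 w) y n h \<in> A \<inter> {..<K}"
proof -
  note i = state_01[OF order_refl w]
  have alt: "v (alt (X 0 w) j) \<noteq> 0" for j using alt_in[OF i, of j] g by auto
  have cont: "continuous_on {0..t} (\<lambda>t. telegraph v X t w)" if "0 \<le> t" for t
    using w that by (rule telegraph_continuous_path)
  have iff: "passage_time v X y w = ereal t \<and> switch_count X t w = n \<longleftrightarrow>
      crosses v (X 0 w) y n h \<and> t = cross_time v (X 0 w) y n h" if "t < K" for t
    by (rule passage_iff_crosses[where X=X and w=w and h=h and v=v, OF sk i that cont y alt])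
  show ?thesis (is "?L \<longleftrightarrow> ?R")
  proof
    assume ?L
    then obtain t where "t \<in> A" "t < K" "passage_time v X y w = ereal t \<and> switch_count X t w = n"
      by blast
    with iff[of t] show ?R by simp
  next
    assume ?R
    then show ?L using iff[of "cross_time v (X 0 w) y n h"]
      by (intro bexI[of _ "cross_time v (X 0 w) y n h"]) simp_all
  qed
qed

text \<open>\<open>M\<close> may be incomplete, so measurability must not rest on discarding the
  paths that stop switching. Each horizon describes the passages before it exactly, and the event is
  the countable union over horizons.\<close>

lemma passage_event_sets:
  assumes y: "0 < y" and g: "v 0 \<noteq> 0" "v 1 \<noteq> 0" and A: "A \<in> sets borel"
  shows "passage_event v y n A \<in> sets M"
proof -
  let ?H = "\<lambda>K w. holding (real (Suc K)) (\<lambda>t. X t w)"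
  let ?C = "\<lambda>K i. {w \<in> space M. crosses v i y n (?H K w) \<and> cross_time v i y n (?H K w) \<in> A \<inter> {..<real (Suc K)}}"
  have C: "?C K i \<in> sets M" for K i
    by (rule measurable_crossing_set) (use A holding_measurable[of "real (Suc K)"] in auto)
  have "passage_event v y n A =
      (\<Union>K. \<Union>i\<in>{0, 1}. {w \<in> space M. X 0 w = i} \<inter> ?C K i)"
  proof (intro set_eqI iffI)
    fix w assume w: "w \<in> passage_event v y n A"
    then have wM: "w \<in> space M" by (simp add: passage_event_def)
    obtain t where t: "t \<in> A" "passage_time v X y w = ereal t" "switch_count X t w = n"
      using w by (auto simp: passage_event_def)
    obtain K where K: "t < real K" using reals_Archimedean2 by blast
    have sk: "skeleton (real (Suc K)) (X 0 w) (?H K w) (\<lambda>t. X t w)"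
      by (rule skeleton_path) (use wM in auto)
    have "\<exists>t\<in>A. t < real (Suc K) \<and> passage_time v X y w = ereal t \<and> switch_count X t w = n"
      using t K by (intro bexI[of _ t]) auto
    then have "w \<in> ?C K (X 0 w)"
      unfolding in_passage_event_iff[OF wM y g sk] using wM by blast
    then show "w \<in> (\<Union>K. \<Union>i\<in>{0, 1}. {w \<in> space M. X 0 w = i} \<inter> ?C K i)"
      using state_01[OF order_refl wM] wM by blast
  next
    fix w assume "w \<in> (\<Union>K. \<Union>i\<in>{0, 1}. {w \<in> space M. X 0 w = i} \<inter> ?C K i)"
    then obtain K where wM: "w \<in> space M" and c: "w \<in> ?C K (X 0 w)" by auto
    have sk: "skeleton (real (Suc K)) (X 0 w) (?H K w) (\<lambda>t. X t w)"
      by (rule skeleton_path) (use wM in auto)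
    from c have "\<exists>t\<in>A. t < real (Suc K) \<and> passage_time v X y w = ereal t \<and> switch_count X t w = n"
      unfolding in_passage_event_iff[OF wM y g sk] by blast
    then show "w \<in> passage_event v y n A" using wM by (auto simp: passage_event_def)
  qed
  also have "\<dots> \<in> sets M"
    using C pred_state[OF order_refl] by (intro sets.countable_UN' sets.finite_UN sets.Int) (auto simp: pred_def)
  finally show ?thesis .
qed

context
  fixes i :: nat
  assumes i: "i \<in> {0, 1}" and start: "0 < prob {w \<in> space M. X 0 w = i}"
begin

lemma start_event: "{w \<in> space M. X 0 w = i} \<in> events"
  by (rule predE[OF pred_state]) simp

lemma start_emeasure: "emeasure M {w \<in> space M. X 0 w = i} \<noteq> 0" "emeasure M {w \<in> space M. X 0 w = i} \<noteq> \<infinity>"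
  using start by (auto simp: emeasure_eq_measure)

lemma sets_cond_start [simp]: "sets (cond_start M X i) = sets M"
  by (simp add: cond_start_def)

lemma space_cond_start [simp]: "space (cond_start M X i) = space M"
  by (simp add: cond_start_def)

lemma prob_space_cond_start: "prob_space (cond_start M X i)"
  unfolding cond_start_def by (rule prob_space_uniform_measure[OF start_emeasure])

text \<open>Multiplication by the rates normalizes the exponentials; conditioning divides out the
  start factor in \<open>prob_holding_tail\<close>.\<close>

lemma cond_start_holding_law:
  "distr (cond_start M X i) (\<Pi>\<^sub>M j\<in>UNIV. borel) (\<lambda>w j. lam (alt i j) * holding 1 (\<lambda>t. X t w) j) =
    (\<Pi>\<^sub>M j\<in>UNIV. exp1)"
proof (rule prob_space.distr_iid_exponential[OF prob_space_cond_start])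
  let ?H = "\<lambda>w. holding 1 (\<lambda>t. X t w)"
  have H: "(\<lambda>w. ?H w j) \<in> borel_measurable M" for j by (rule holding_measurable) simp
  show "(\<lambda>w. lam (alt i j) * ?H w j) \<in> borel_measurable (cond_start M X i)" for j
    using H[of j] by (simp add: measurable_cong_sets[OF sets_cond_start refl])
  have lp: "0 < lam (alt i j)" for j by (rule lam_pos[OF alt_in[OF i]])
  show "0 < lam (alt i j) * ?H w j" if "w \<in> space (cond_start M X i)" for j w
    using lp holding_pos[of 1 w j] that by simp
  fix n and c :: "nat \<Rightarrow> real" assume c: "\<And>j. 0 \<le> c j"
  let ?c = "\<lambda>j. c j / lam (alt i j)"
  let ?\<pi> = "prob {w \<in> space M. X 0 w = i}"
  let ?B = "{w \<in> space M. \<forall>j<n. ?c j < ?H w j}"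
  have B: "?B \<in> events"
  proof -
    have "Measurable.pred M (\<lambda>w. \<forall>j\<in>{..<n}. ?c j < ?H w j)"
      by (rule pred_intros_finite) (use H in \<open>simp, measurable\<close>)
    then show ?thesis by (simp add: pred_def)
  qed
  have "{w \<in> space (cond_start M X i). \<forall>j<n. c j < lam (alt i j) * ?H w j} = ?B"
    using lp by (simp add: pos_divide_less_eq mult.commute)
  moreover have "measure (cond_start M X i) ?B =
      prob {w \<in> space M. X 0 w = i \<and> (\<forall>j<n. ?c j < ?H w j)} / ?\<pi>"
  proof -
    have "{w \<in> space M. X 0 w = i} \<inter> ?B = {w \<in> space M. X 0 w = i \<and> (\<forall>j<n. ?c j < ?H w j)}" by auto
    then show ?thesis
      unfolding cond_start_def using measure_uniform_measure[OF start_emeasure B] by simp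
  qed
  moreover have "prob {w \<in> space M. X 0 w = i \<and> (\<forall>j<n. ?c j < ?H w j)} =
      ?\<pi> * (\<Prod>j<n. exp (- (lam (alt i j) * ?c j)))"
    by (rule prob_holding_tail[OF i]) (use c lp in \<open>simp add: less_imp_le\<close>)
  moreover have "lam (alt i j) * ?c j = c j" for j using lp[of j] by simp
  ultimately show "measure (cond_start M X i) {w \<in> space (cond_start M X i). \<forall>j<n. c j < lam (alt i j) * ?H w j} =
      (\<Prod>j<n. exp (- c j))"
    using start by simp
qed

text \<open>The link to the product space: given the start in \<open>i\<close>, the event almost
  surely depends on the holding times alone, and \<open>scaled\<close> undoes the normalization by
  the rates.\<close>

lemma emeasure_passage_event:
  assumes y: "0 < y" and g: "v 0 \<noteq> 0" "v 1 \<noteq> 0" and A: "A \<in> sets borel"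
  shows "emeasure (cond_start M X i) (passage_event v y n A) = passage_mass lam v i n y A"
proof -
  let ?N = "cond_start M X i"
  let ?H = "\<lambda>w. holding 1 (\<lambda>t. X t w)"
  let ?X = "\<lambda>w j. lam (alt i j) * ?H w j"
  let ?E = "{w \<in> space M. crosses v i y n (?H w) \<and> cross_time v i y n (?H w) \<in> A}"
  let ?B = "{e. crosses v i y n (scaled lam i e) \<and> cross_time v i y n (scaled lam i e) \<in> A}"
  have H: "(\<lambda>w. ?H w j) \<in> borel_measurable M" for j by (rule holding_measurable) simp
  have E: "?E \<in> sets M" by (rule measurable_crossing_set[OF H A])
  have lp: "lam (alt i j) \<noteq> 0" for j using lam_pos[OF alt_in[OF i], of j] by simp
  have sc: "scaled lam i (?X w) = ?H w" for w using lp by (simp add: scaled_def fun_eq_iff)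
  have sets_eq: "sets (\<Pi>\<^sub>M j\<in>(UNIV :: nat set). exp1) = sets (\<Pi>\<^sub>M j\<in>UNIV. borel)"
    by (rule sets_PiM_cong) simp_all
  have B: "?B \<in> sets (\<Pi>\<^sub>M j\<in>UNIV. borel)"
    using measurable_crossing_set[OF measurable_scaled A, of v i y n] unfolding sets_eq by (simp add: space_PiM)
  have X: "?X \<in> ?N \<rightarrow>\<^sub>M (\<Pi>\<^sub>M j\<in>UNIV. borel)"
    unfolding measurable_cong_sets[OF sets_cond_start refl]
    by (rule measurable_PiM_single') (use H in auto)
  have "emeasure ?N (passage_event v y n A) = emeasure ?N ?E"
  proof (rule emeasure_eq_AE)
    have "AE w in M. X 0 w = i \<longrightarrow> w \<in> passage_event v y n A \<longleftrightarrow> w \<in> ?E"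
      using AE_leaves AE_space
    proof eventually_elim
      case (elim w)
      have "w \<in> passage_event v y n A \<longleftrightarrow> w \<in> ?E" if "X 0 w = i"
      proof -
        have sk: "skeleton K (X 0 w) (?H w) (\<lambda>t. X t w)" for K
          by (rule skeleton_of_leaves[OF elim(2,1)])
        note iff = in_passage_event_iff[OF elim(2) y g sk, unfolded that]
        \<comment> \<open>These holding times describe the path up to every horizon, so the bound
          \<open>K\<close> can be removed.\<close>
        have "w \<in> passage_event v y n A \<longleftrightarrow>
            (\<exists>K. \<exists>t\<in>A. t < K \<and> passage_time v X y w = ereal t \<and> switch_count X t w = n)"
          using elim(2) by (auto simp: passage_event_def intro: gt_ex)
        also have "\<dots> \<longleftrightarrow> w \<in> ?E" unfolding iff using elim(2) by (auto intro: gt_ex)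
        finally show ?thesis .
      qed
      then show ?case by blast
    qed
    then show "AE w in ?N. w \<in> passage_event v y n A \<longleftrightarrow> w \<in> ?E"
      unfolding cond_start_def using start_event by (intro AE_uniform_measureI) (auto elim: eventually_mono)
  qed (use E passage_event_sets[OF y g A] in auto)
  also have "?E = ?X -` ?B \<inter> space ?N" unfolding vimage_def mem_Collect_eq sc by auto
  also have "emeasure ?N (?X -` ?B \<inter> space ?N) = emeasure (distr ?N (\<Pi>\<^sub>M j\<in>UNIV. borel) ?X) ?B"
    by (rule emeasure_distr[symmetric, OF X B])
  finally show ?thesis unfolding cond_start_holding_law passage_mass_def .
qed

lemma passage_densityI:
  assumes f: "mass_density lam v i n f" and nn: "\<And>t. 0 \<le> f y t"
    and y: "0 < y" and g: "v 0 \<noteq> 0" "v 1 \<noteq> 0"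
  shows "passage_density (cond_start M X i) v X y n (f y)"
  unfolding passage_density_def
proof (intro conjI allI ballI nn)
  have f_m: "(\<lambda>(y, t). f y t) \<in> borel_measurable borel" using f by (simp add: mass_density_def)
  have "(\<lambda>t. (y, t)) \<in> borel \<rightarrow>\<^sub>M (borel :: real measure) \<Otimes>\<^sub>M (borel :: real measure)" by measurable
  from measurable_compose[OF this[unfolded borel_prod] f_m] show "f y \<in> borel_measurable borel" by simp
  fix A :: "real set" assume A: "A \<in> sets borel"
  show "{w \<in> space (cond_start M X i). \<exists>t\<in>A. passage_time v X y w = ereal t \<and> switch_count X t w = n}
      \<in> sets (cond_start M X i)"
    using passage_event_sets[OF y g A, of n] by (simp add: passage_event_def)
  show "emeasure (cond_start M X i)
      {w \<in> space (cond_start M X i). \<exists>t\<in>A. passage_time v X y w = ereal t \<and> switch_count X t w = n} =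
      (\<integral>\<^sup>+t\<in>A. ennreal (f y t) \<partial>lborel)"
    using emeasure_passage_event[OF y g A, of n] f y A by (simp add: passage_event_def mass_density_def)
qed

end

end

lemma sets_borel_ereal_image: "A \<in> sets borel \<Longrightarrow> ereal ` A \<in> sets borel"
proof -
  assume A [measurable]: "A \<in> sets borel"
  have "ereal ` A = {x \<in> space borel. \<bar>x\<bar> \<noteq> \<infinity> \<and> real_of_ereal x \<in> A}"
    by (auto simp: image_iff ereal_real)
  also have "\<dots> \<in> sets borel" by measurable
  finally show ?thesis .
qed

lemma Union_parity: "(\<Union>n. F n) = F 0 \<union> ((\<Union>n. F (2 * n + 1)) \<union> (\<Union>n. F (2 * n + 2)))"
  for F :: "nat \<Rightarrow> 'b set"
proof (intro equalityI subsetI)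
  fix x assume "x \<in> (\<Union>n. F n)"
  then obtain n where n: "x \<in> F n" by blast
  have "n = 0 \<or> (\<exists>m. n = 2 * m + 1) \<or> (\<exists>m. n = 2 * m + 2)" by presburger
  then consider "n = 0" | m where "n = 2 * m + 1" | m where "n = 2 * m + 2" by blast
  then show "x \<in> F 0 \<union> ((\<Union>n. F (2 * n + 1)) \<union> (\<Union>n. F (2 * n + 2)))"
    using n by cases blast+
qed blast

section \<open>Translation into \<open>tel_xi\<close>, \<open>tel_z\<close> and
  \<open>tel_theta\<close>\<close>

lemma tel_xi_occ:
  "tel_xi v 0 t y = occ v 0 t y" "tel_xi v 1 t y = occ v 1 t y"
proof -
  show "tel_xi v 0 t y = occ v 0 t y" by (simp add: tel_xi_def occ_def)
  have "(v 0 * t - y) / (v 0 - v 1) = (- (v 0 * t - y)) / (- (v 0 - v 1))"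
    by (rule minus_divide_divide[symmetric])
  then show "tel_xi v 1 t y = occ v 1 t y" by (simp add: tel_xi_def occ_def)
qed

lemma tel_z_occ: "i \<in> {0, 1} \<Longrightarrow> lam i * lam (1 - i) * occ v i t y * occ v (1 - i) t y = tel_z lam v t y"
  unfolding tel_z_def tel_xi_occ by auto

lemma occ_weight_tel: "i \<in> {0, 1} \<Longrightarrow> occ_weight lam v i t y = \<bar>tel_theta lam v t y\<bar>"
  unfolding tel_theta_def tel_xi_occ occ_weight_def
  by (auto simp: abs_minus_commute algebra_simps)

text \<open>The occupation time of state 0 vanishes at \<open>y / v 1\<close>, that of state 1 at
  \<open>y / v 0\<close>.\<close>

lemma segment_iff_occ:
  assumes "0 < v 0" "0 < v 1" "v 0 \<noteq> v 1" "0 < y"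
  shows "t \<in> closed_segment (y / v 0) (y / v 1) \<longleftrightarrow> 0 \<le> occ v 0 t y \<and> 0 \<le> occ v 1 t y"
proof (cases "v 0 < v 1")
  case True
  then have "y / v 1 \<le> y / v 0" "y / v 1 < y / v 0" using assms by (simp_all add: divide_strict_left_mono divide_left_mono)
  then show ?thesis using True assms
    by (auto simp: closed_segment_eq_real_ivl occ_def zero_le_divide_iff field_simps)
next
  case False
  then have "y / v 0 \<le> y / v 1" using assms by (simp add: divide_left_mono)
  then show ?thesis using False assms
    by (auto simp: closed_segment_eq_real_ivl occ_def zero_le_divide_iff field_simps)
qed

lemma segment_iff_occ':
  assumes "0 < v 0" "0 < v 1" "v 0 \<noteq> v 1" "0 < y" "i \<in> {0, 1}"
  shows "of_bool (0 \<le> occ v i t y \<and> 0 \<le> occ v (1 - i) t y) = (indicator (closed_segment (y / v 0) (y / v 1)) t :: real)"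
  using assms(5) unfolding indicator_def segment_iff_occ[OF assms(1-4)] by auto

text \<open>Dominated by the exponential series, since the additional factorial in the denominator
  is at least 1.\<close>

lemma summable_tel_I:
  fixes z :: real
  shows "summable (\<lambda>n. z ^ n / (fact n)\<^sup>2)" "summable (\<lambda>n. z ^ n / (fact n * fact (n + 1)))"
proof -
  have s: "summable (\<lambda>n. inverse (fact n) * \<bar>z\<bar> ^ n)" by (rule summable_exp)
  have b: "\<bar>z ^ n\<bar> / (fact n * c) \<le> inverse (fact n) * \<bar>z\<bar> ^ n" if "1 \<le> c" for n and c :: real
  proof -
    have "\<bar>z ^ n\<bar> / (fact n * c) \<le> \<bar>z ^ n\<bar> / (fact n * 1)"
      using that by (intro divide_left_mono mult_left_mono) auto
    then show ?thesis by (simp add: power_abs divide_inverse mult.commute)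
  qed
  show "summable (\<lambda>n. z ^ n / (fact n)\<^sup>2)"
    by (rule summable_comparison_test'[OF s]) (use b[of "fact _"] in \<open>simp add: power2_eq_square abs_mult fact_ge_1\<close>)
  show "summable (\<lambda>n. z ^ n / (fact n * fact (n + 1)))"
    by (rule summable_comparison_test'[OF s])
      (use b[of "fact (_ + 1)"] in \<open>simp add: abs_mult fact_ge_1 del: fact_Suc\<close>)
qed

context two_state
begin

context
  fixes v :: "nat \<Rightarrow> real" and y :: real
  assumes y: "0 < y" and g: "0 < v 0" "0 < v 1" and ne: "v 0 \<noteq> v 1"
begin

lemma velocity_pos: "i \<in> {0, 1} \<Longrightarrow> 0 < v i"
  using g by auto

lemma velocity_nonzero: "v 0 \<noteq> 0" "v 1 \<noteq> 0"
  using g by auto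

text \<open>With \<open>m\<close> the smaller velocity, every path has reached \<open>y\<close> by
  time \<open>y / m\<close>; the velocity bounds put the passage time into the segment.\<close>

lemma same_sign_passage:
  assumes w: "w \<in> space M"
  obtains t where "t \<in> closed_segment (y / v 0) (y / v 1)" "passage_time v X y w = ereal t"
proof -
  define m m' where "m = min (v 0) (v 1)" "m' = max (v 0) (v 1)"
  note m_def = this
  have m: "0 < m" "0 < m'" using g by (auto simp: m_def)
  define u where "u = y / m"
  have u: "0 \<le> u" "y = m * u" using y m by (simp_all add: u_def)
  obtain h where sk: "skeleton (u + 1) (X 0 w) h (\<lambda>t. X t w)" using skeleton_path_ex[OF w] by blast
  have "y \<le> telegraph v X u w" using telegraph_bounds(1)[OF w u(1), of v] u(2) by (simp add: m_def)
  then obtain s where s: "0 < s" "telegraph v X s w = y"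
    using telegraph_hits[where X=X and w=w, OF sk state_01[OF order_refl w] u(1) _ y] by auto
  then have "passage_time v X y w = ereal (LEAST t. 0 < t \<and> telegraph v X t w = y)"
    unfolding passage_time_def by (intro if_P) blast
  then obtain t where t: "passage_time v X y w = ereal t" by blast
  have c: "continuous_on {0..t} (\<lambda>t. telegraph v X t w)" if "0 \<le> t" for t
    using w that by (rule telegraph_continuous_path)
  have "0 < t" "telegraph v X t w = y"
    using t y passage_time_eq_ereal_iff[where X=X and w=w and v=v, OF c, of y t] by auto
  then have "m * t \<le> y" "y \<le> m' * t" using telegraph_bounds[OF w, of t v] by (auto simp: m_def)
  then have "t \<le> y / m" "y / m' \<le> t" using m by (simp_all add: field_simps)
  then have "t \<in> closed_segment (y / v 0) (y / v 1)"
    using y g by (cases "v 0 \<le> v 1") (auto simp: closed_segment_eq_real_ivl m_def min_def max_def divide_left_mono)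
  then show thesis using t by (rule that)
qed

lemma passage_time_vimage:
  "{w \<in> space M. passage_time v X y w \<in> ereal ` A} = (\<Union>n. passage_event v y n A)"
  by (auto simp: passage_event_def)

text \<open>The passage time is finite on every path, and preimages of real Borel sets are unions of
  passage events over the number of switchings.\<close>

lemma passage_time_measurable: "passage_time v X y \<in> borel_measurable M"
proof -
  have T: "passage_time v X y w = ereal (real_of_ereal (passage_time v X y w))" if "w \<in> space M" for w
    using same_sign_passage[OF that] by (metis real_of_ereal.simps(1))
  have "(\<lambda>w. real_of_ereal (passage_time v X y w)) \<in> borel_measurable M"
  proof (rule measurableI)
    fix A :: "real set" assume A: "A \<in> sets borel"
    have "(\<lambda>w. real_of_ereal (passage_time v X y w)) -` A \<inter> space M =
        {w \<in> space M. passage_time v X y w \<in> ereal ` A}"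
      using T by (auto simp: image_iff)
    also have "\<dots> \<in> sets M"
      unfolding passage_time_vimage using passage_event_sets[where v=v, OF y velocity_nonzero A] by auto
    finally show "(\<lambda>w. real_of_ereal (passage_time v X y w)) -` A \<inter> space M \<in> sets M" .
  qed simp
  then have "(\<lambda>w. ereal (real_of_ereal (passage_time v X y w))) \<in> borel_measurable M" by measurable
  with T show ?thesis by (simp cong: measurable_cong)
qed

lemma same_sign_range:
  "\<exists>C::real. AE w in M. passage_time v X y w \<le> ereal C"
  "prob {w \<in> space M. passage_time v X y w \<in> ereal ` closed_segment (y / v 0) (y / v 1)} = 1"
proof -
  have "passage_time v X y w \<le> ereal (max (y / v 0) (y / v 1))" if w: "w \<in> space M" for w
  proof -
    obtain t where t: "t \<in> closed_segment (y / v 0) (y / v 1)" "passage_time v X y w = ereal t"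
      using same_sign_passage[OF w] by blast
    have "t \<le> max (y / v 0) (y / v 1)"
      using t(1) unfolding closed_segment_eq_real_ivl by (cases "y / v 0 \<le> y / v 1") simp_all
    then show ?thesis unfolding t(2) by (simp only: ereal_less_eq)
  qed
  then show "\<exists>C::real. AE w in M. passage_time v X y w \<le> ereal C" by (intro exI) (rule AE_I2)
  have "{w \<in> space M. passage_time v X y w \<in> ereal ` closed_segment (y / v 0) (y / v 1)} = space M"
    using same_sign_passage by blast
  then show "prob {w \<in> space M. passage_time v X y w \<in> ereal ` closed_segment (y / v 0) (y / v 1)} = 1"
    by (simp add: prob_space)
qed

context
  fixes i :: nat
  assumes i: "i \<in> {0, 1}" and start: "0 < prob {w \<in> space M. X 0 w = i}"
begin

text \<open>The absolute value of \<open>tel_theta\<close> makes these expressions invariant under reflection, which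
  reverses the order of the velocities.\<close>

abbreviation "odd_density n t \<equiv> lam i * \<bar>v (1 - i)\<bar> * (tel_z lam v t y ^ n / (fact n)\<^sup>2) *
  \<bar>tel_theta lam v t y\<bar> * indicator (closed_segment (y / v 0) (y / v 1)) t"

abbreviation "even_density n t \<equiv> lam 0 * lam 1 * \<bar>v i\<bar> * tel_xi v i t y *
  (tel_z lam v t y ^ n / (fact n * fact (n + 1))) *
  \<bar>tel_theta lam v t y\<bar> * indicator (closed_segment (y / v 0) (y / v 1)) t"

lemma tel_xi_i: "tel_xi v i t y = occ v i t y"
  using i tel_xi_occ by auto

lemma lam_i: "lam i * lam (1 - i) = lam 0 * lam 1"
  using i by auto

lemma odd_density_eq: "same_sign_odd lam v i n y = odd_density n"
  unfolding same_sign_odd_def tel_z_occ[OF i] occ_weight_tel[OF i] segment_iff_occ'[where v=v, OF g ne y i]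
  using velocity_pos[OF compl_in, of i] by (auto simp: fun_eq_iff)

lemma even_density_eq: "same_sign_even lam v i n y = even_density n"
  unfolding same_sign_even_def tel_z_occ[OF i] unfolding occ_weight_tel[OF i] segment_iff_occ'[where v=v, OF g ne y i] tel_xi_i lam_i
  using velocity_pos[OF i] by (auto simp: fun_eq_iff)

lemma tel_z_nonneg:
  assumes "t \<in> closed_segment (y / v 0) (y / v 1)"
  shows "0 \<le> tel_z lam v t y" "0 \<le> tel_xi v i t y"
proof -
  have o: "0 \<le> occ v 0 t y" "0 \<le> occ v 1 t y" using assms segment_iff_occ[of v, OF g ne y] by auto
  then show "0 \<le> tel_z lam v t y" "0 \<le> tel_xi v i t y"
    using lam_pos[of 0] lam_pos[of 1] i unfolding tel_z_def tel_xi_i tel_xi_occ by auto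
qed

lemma density_nonneg: "0 \<le> odd_density n t" "0 \<le> even_density n t"
proof -
  have l: "0 < lam i" "0 < lam 0" "0 < lam 1" using lam_pos i by auto
  show "0 \<le> odd_density n t" "0 \<le> even_density n t"
    using tel_z_nonneg[of t] l by (auto simp: indicator_def)
qed

lemma same_sign_passage_density:
  "passage_density (cond_start M X i) v X y (2 * n + 1) (odd_density n)"
  "passage_density (cond_start M X i) v X y (2 * n + 2) (even_density n)"
proof -
  have "passage_density (cond_start M X i) v X y (2 * n + 1) (same_sign_odd lam v i n y)"
    by (rule passage_densityI[OF i start same_sign_densities(1)[of lam v, OF lam_pos ne velocity_pos i] _ y velocity_nonzero])
      (assumption | unfold odd_density_eq, rule density_nonneg)+
  then show "passage_density (cond_start M X i) v X y (2 * n + 1) (odd_density n)" unfolding odd_density_eq .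
  have "passage_density (cond_start M X i) v X y (2 * n + 2) (same_sign_even lam v i n y)"
    by (rule passage_densityI[OF i start same_sign_densities(2)[of lam v, OF lam_pos ne velocity_pos i] _ y velocity_nonzero])
      (assumption | unfold even_density_eq, rule density_nonneg)+
  then show "passage_density (cond_start M X i) v X y (2 * n + 2) (even_density n)" unfolding even_density_eq .
qed

lemma passage_density_emeasure:
  assumes "passage_density (cond_start M X i) v X y n f" "A \<in> sets borel"
  shows "emeasure (cond_start M X i) (passage_event v y n A) = (\<integral>\<^sup>+t\<in>A. ennreal (f t) \<partial>lborel)"
  using assms by (simp add: passage_density_def passage_event_def space_cond_start[OF i start])

lemma suminf_passage_density:
  assumes d: "\<And>n. passage_density (cond_start M X i) v X y (k n) (f n)" and k: "inj k"
    and s: "\<And>t. summable (\<lambda>n. f n t)" and A: "A \<in> sets borel"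
  shows "emeasure (cond_start M X i) (\<Union>n. passage_event v y (k n) A) = (\<integral>\<^sup>+t\<in>A. ennreal (\<Sum>n. f n t) \<partial>lborel)"
proof -
  have disj: "disjoint_family (\<lambda>n. passage_event v y (k n) A)"
    using k by (auto simp: disjoint_family_on_def passage_event_def inj_def)
  have f: "f n \<in> borel_measurable borel" "\<And>t. 0 \<le> f n t" for n
    using d[of n] by (auto simp: passage_density_def)
  have "emeasure (cond_start M X i) (\<Union>n. passage_event v y (k n) A) =
      (\<Sum>n. emeasure (cond_start M X i) (passage_event v y (k n) A))"
    by (rule suminf_emeasure[symmetric, OF _ disj])
      (use passage_event_sets[where v=v, OF y velocity_nonzero A] sets_cond_start[OF i start] in auto)
  also have "\<dots> = (\<Sum>n. \<integral>\<^sup>+t. ennreal (f n t) * indicator A t \<partial>lborel)"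
    unfolding passage_density_emeasure[OF d A] ..
  also have "\<dots> = (\<integral>\<^sup>+t. (\<Sum>n. ennreal (f n t) * indicator A t) \<partial>lborel)"
    by (rule nn_integral_suminf[symmetric]) (use f A in measurable)
  also have "\<dots> = (\<integral>\<^sup>+t\<in>A. ennreal (\<Sum>n. f n t) \<partial>lborel)"
    by (intro nn_integral_cong) (simp add: ennreal_suminf_multc suminf_ennreal2[OF f(2) s])
  finally show ?thesis .
qed

text \<open>No switching gives the atom, the odd numbers sum to the \<open>tel_I0\<close> term and
  the positive even ones to the \<open>tel_I1\<close> term.\<close>

lemma same_sign_passage_law:
  assumes A: "A \<in> sets borel"
  shows "emeasure (passage_law (cond_start M X i) v X y) (ereal ` A) =
    ennreal (exp (- lam i * y / v i)) * indicator A (y / v i) +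
    (\<integral>\<^sup>+t\<in>A. ennreal (lam i * (\<bar>v (1 - i)\<bar> * tel_I0 lam v t y +
       lam (1 - i) * \<bar>v i\<bar> * tel_xi v i t y * tel_I1 lam v t y) * \<bar>tel_theta lam v t y\<bar> *
       indicator (closed_segment (y / v 0) (y / v 1)) t) \<partial>lborel)"
proof -
  let ?N = "cond_start M X i"
  let ?E = "\<lambda>n. passage_event v y n A"
  let ?I = "indicator (closed_segment (y / v 0) (y / v 1)) :: real \<Rightarrow> real"
  let ?O = "\<lambda>t. lam i * \<bar>v (1 - i)\<bar> * tel_I0 lam v t y * \<bar>tel_theta lam v t y\<bar> * ?I t"
  let ?V = "\<lambda>t. lam 0 * lam 1 * \<bar>v i\<bar> * tel_xi v i t y * tel_I1 lam v t y * \<bar>tel_theta lam v t y\<bar> * ?I t"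
  let ?F = "\<lambda>t. lam i * (\<bar>v (1 - i)\<bar> * tel_I0 lam v t y +
       lam (1 - i) * \<bar>v i\<bar> * tel_xi v i t y * tel_I1 lam v t y) * \<bar>tel_theta lam v t y\<bar> * ?I t"
  have E: "?E n \<in> sets ?N" for n
    using passage_event_sets[where v=v, OF y velocity_nonzero A] sets_cond_start[OF i start] by simp
  have UE: "(\<Union>n. ?E (k n)) \<in> sets ?N" for k :: "nat \<Rightarrow> nat" using E by auto
  have T: "passage_time v X y \<in> ?N \<rightarrow>\<^sub>M borel"
    using passage_time_measurable by (simp add: measurable_cong_sets[OF sets_cond_start[OF i start] refl])
  have odd_sum: "(\<lambda>n. odd_density n t) sums (?O t)" for t
    unfolding tel_I0_def by (intro sums_mult2 sums_mult summable_sums summable_tel_I)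
  have even_sum: "(\<lambda>n. even_density n t) sums (?V t)" for t
    unfolding tel_I1_def by (intro sums_mult2 sums_mult summable_sums summable_tel_I)
  have split: "(\<Union>n. ?E n) = ?E 0 \<union> ((\<Union>n. ?E (2 * n + 1)) \<union> (\<Union>n. ?E (2 * n + 2)))"
    by (rule Union_parity)
  have dis: "?E n \<inter> ?E m = {}" if "n \<noteq> m" for n m
    using that by (auto simp: passage_event_def)
  have dis1: "?E 0 \<inter> ((\<Union>n. ?E (2 * n + 1)) \<union> (\<Union>n. ?E (2 * n + 2))) = {}"
    using dis[of 0] by auto
  have dis2: "(\<Union>n. ?E (2 * n + 1)) \<inter> (\<Union>n. ?E (2 * n + 2)) = {}"
  proof -
    have "2 * n + 1 \<noteq> 2 * m + 2" for n m :: nat by presburger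
    then show ?thesis using dis by blast
  qed
  have "emeasure (passage_law ?N v X y) (ereal ` A) = emeasure ?N (passage_time v X y -` (ereal ` A) \<inter> space ?N)"
    unfolding passage_law_def by (rule emeasure_distr[OF T sets_borel_ereal_image[OF A]])
  also have "passage_time v X y -` (ereal ` A) \<inter> space ?N = (\<Union>n. ?E n)"
    unfolding passage_time_vimage[symmetric] space_cond_start[OF i start] by auto
  also have "emeasure ?N (\<Union>n. ?E n) = emeasure ?N (?E 0) +
      (emeasure ?N (\<Union>n. ?E (2 * n + 1)) + emeasure ?N (\<Union>n. ?E (2 * n + 2)))"
    unfolding split plus_emeasure[OF UE[of "\<lambda>n. 2 * n + 1"] UE[of "\<lambda>n. 2 * n + 2"] dis2]
      plus_emeasure[OF E[of 0] sets.Un[OF UE[of "\<lambda>n. 2 * n + 1"] UE[of "\<lambda>n. 2 * n + 2"]] dis1] ..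
  also have "emeasure ?N (?E 0) = ennreal (exp (- lam i * y / v i)) * indicator A (y / v i)"
    using emeasure_passage_event[where v=v, OF i start y velocity_nonzero A, of 0]
      passage_mass_0[where lam=lam and v=v, OF i lam_pos[OF i] y _ A] velocity_pos[OF i]
    by (simp add: mult.commute)
  also have "emeasure ?N (\<Union>n. ?E (2 * n + 1)) =
      (\<integral>\<^sup>+t\<in>A. ennreal (?O t) \<partial>lborel)"
    unfolding sums_unique[OF odd_sum]
    by (rule suminf_passage_density[OF same_sign_passage_density(1) _ sums_summable[OF odd_sum] A]) (auto simp: inj_def)
  also have "emeasure ?N (\<Union>n. ?E (2 * n + 2)) =
      (\<integral>\<^sup>+t\<in>A. ennreal (?V t) \<partial>lborel)"
    unfolding sums_unique[OF even_sum]
    by (rule suminf_passage_density[OF same_sign_passage_density(2) _ sums_summable[OF even_sum] A]) (auto simp: inj_def)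
  also have "(\<integral>\<^sup>+t\<in>A. ennreal (?O t) \<partial>lborel) +
      (\<integral>\<^sup>+t\<in>A. ennreal (?V t) \<partial>lborel) =
      (\<integral>\<^sup>+t. ennreal (?O t) * indicator A t +
       ennreal (?V t) * indicator A t \<partial>lborel)"
  proof (rule nn_integral_add[symmetric])
    have m: "(\<lambda>t. odd_density n t) \<in> borel_measurable borel" "(\<lambda>t. even_density n t) \<in> borel_measurable borel" for n
      using same_sign_passage_density[of n] by (auto simp: passage_density_def)
    have "(\<lambda>t. \<Sum>n. odd_density n t) \<in> borel_measurable borel" by (intro borel_measurable_suminf m)
    then show "(\<lambda>t. ennreal (?O t) * indicator A t) \<in> borel_measurable lborel"
      unfolding sums_unique[OF odd_sum, symmetric] using A by measurable
    have "(\<lambda>t. \<Sum>n. even_density n t) \<in> borel_measurable borel" by (intro borel_measurable_suminf m)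
    then show "(\<lambda>t. ennreal (?V t) * indicator A t) \<in> borel_measurable lborel"
      unfolding sums_unique[OF even_sum, symmetric] using A by measurable
  qed
  also have "\<dots> = (\<integral>\<^sup>+t\<in>A. ennreal (?F t) \<partial>lborel)"
  proof (rule nn_integral_cong)
    fix t
    \<comment> \<open>Nonnegativity of both terms permits adding them inside
      \<open>ennreal\<close>.\<close>
    have "0 \<le> (\<Sum>n. odd_density n t)" "0 \<le> (\<Sum>n. even_density n t)"
      using density_nonneg sums_summable[OF odd_sum] sums_summable[OF even_sum] by (auto intro!: suminf_nonneg)
    then have nn: "0 \<le> ?O t"
      "0 \<le> ?V t"
      unfolding sums_unique[OF odd_sum, symmetric] sums_unique[OF even_sum, symmetric] .
    show "ennreal (?O t) * indicator A t +
       ennreal (?V t) * indicator A t =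
       ennreal (?F t) * indicator A t"
    proof -
      have "?F t =
          ?O t +
          ?V t"
        unfolding lam_i[symmetric] by (simp add: algebra_simps)
      then show ?thesis by (simp only: ennreal_plus[OF nn] distrib_right)
    qed
  qed
  finally show ?thesis .
qed

end

end

lemma opposite_sign_passage_density:
  assumes y: "0 < y" and g: "0 < v 0" "v 1 < 0"
  shows "0 < prob {w \<in> space M. X 0 w = 0} \<Longrightarrow>
      passage_density (cond_start M X 0) v X y (2 * n + 1) (\<lambda>t. 0)"
    and "0 < prob {w \<in> space M. X 0 w = 1} \<Longrightarrow>
      passage_density (cond_start M X 1) v X y (2 * n + 2) (\<lambda>t. 0)"
    and "0 < prob {w \<in> space M. X 0 w = 1} \<Longrightarrow>
      passage_density (cond_start M X 1) v X y (2 * n + 1) (\<lambda>t. lam 1 / tel_xi v 0 t y *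
        (tel_z lam v t y ^ n / (fact n)\<^sup>2) * tel_theta lam v t y *
        (y - v 1 / (n + 1) * tel_xi v 1 t y) * indicator {y / v 0<..} t)"
    (is "_ \<Longrightarrow> passage_density _ _ _ _ _ ?desc")
    and "0 < prob {w \<in> space M. X 0 w = 0} \<Longrightarrow>
      passage_density (cond_start M X 0) v X y (2 * n + 2) (\<lambda>t. lam 0 * lam 1 * y *
        (tel_z lam v t y ^ n / (fact n * fact (n + 1))) * tel_theta lam v t y * indicator {y / v 0<..} t)"
    (is "_ \<Longrightarrow> passage_density _ _ _ _ _ ?climb")
proof -
  have i: "0 \<in> {0, 1 :: nat}" "1 \<in> {0, 1 :: nat}" and g0: "v 0 \<noteq> 0" "v 1 \<noteq> 0" and ne: "v 0 \<noteq> v 1"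
    using g by auto
  have g1: "v (1 - 0) < 0" using g by simp
  have l: "0 < lam 0" "0 < lam 1" using lam_pos by auto
  note dens = opposite_sign_densities[of lam v 0 n, OF lam_pos ne i(1) g(1) g1, unfolded diff_zero]
  have th: "\<bar>tel_theta lam v t y\<bar> = tel_theta lam v t y" for t
    using g unfolding tel_theta_def by simp
  have ind: "of_bool (0 < occ v 1 t y) = (indicator {y / v 0<..} t :: real)" for t
  proof -
    have "0 < occ v 1 t y \<longleftrightarrow> y / v 0 < t"
      unfolding tel_xi_occ[symmetric] tel_xi_def using g by (simp add: zero_less_divide_iff pos_divide_less_eq mult.commute)
    then show ?thesis by (simp add: indicator_def)
  qed
  have lev: "v 0 * occ v 0 t y + v 1 * occ v 1 t y = y" for t
    using occ_level[of 0 lam v t y] l ne by simp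
  \<comment> \<open>Being at \<open>y > 0\<close> after some descent forces some ascent. So
    \<open>tel_z\<close> is nonnegative and the divisor \<open>tel_xi v 0 t y\<close> positive
    wherever the indicator is 1.\<close>
  have occ0: "0 < occ v 0 t y" if "0 < occ v 1 t y" for t
  proof -
    have "v 1 * occ v 1 t y < 0" using g that by (simp add: mult_neg_pos)
    then have "0 < v 0 * occ v 0 t y" using lev[of t] y by linarith
    then show ?thesis using g by (simp add: zero_less_mult_iff)
  qed
  have z: "0 \<le> tel_z lam v t y" if "0 < occ v 1 t y" for t
    unfolding tel_z_def tel_xi_occ using l that occ0[OF that] by simp
  have desc: "descend_odd lam v 1 n y = ?desc"
    unfolding descend_odd_def tel_z_occ[OF i(2)] unfolding occ_weight_tel[OF i(2)] th ind tel_xi_occ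
    by (simp add: fun_eq_iff mult_ac)
  have climb: "climb_even lam v 0 n y = ?climb"
    unfolding climb_even_def tel_z_occ[OF i(1)] unfolding occ_weight_tel[OF i(1)] th diff_zero ind
    by (simp add: fun_eq_iff mult_ac)
  have desc_nn: "0 \<le> descend_odd lam v 1 n y t" for t
  proof (cases "0 < occ v 1 t y")
    case True
    have "v 1 / real (n + 1) * occ v 1 t y \<le> 0"
      using g True by (intro mult_nonpos_nonneg) (auto simp: divide_le_0_iff)
    then have "0 \<le> y - v 1 / real (n + 1) * occ v 1 t y" using y by linarith
    moreover have "0 \<le> occ_weight lam v 1 t y" unfolding occ_weight_tel[OF i(2)] by simp
    ultimately show ?thesis
      unfolding descend_odd_def tel_z_occ[OF i(2)] using True occ0[OF True] z[OF True] l by simp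
  qed (simp add: descend_odd_def)
  have climb_nn: "0 \<le> climb_even lam v 0 n y t" for t
  proof (cases "0 < occ v 1 t y")
    case True
    have "0 \<le> occ_weight lam v 0 t y" unfolding occ_weight_tel[OF i(1)] by simp
    then show ?thesis
      unfolding climb_even_def tel_z_occ[OF i(1)] using True z[OF True] l y by simp
  qed (simp add: climb_even_def)
  note I = passage_densityI[OF _ _ _ _ y g0]
  show "passage_density (cond_start M X 0) v X y (2 * n + 1) (\<lambda>t. 0)"
    if "0 < prob {w \<in> space M. X 0 w = 0}"
    by (rule I[OF i(1) that dens(3)]) simp_all
  show "passage_density (cond_start M X 1) v X y (2 * n + 2) (\<lambda>t. 0)"
    if "0 < prob {w \<in> space M. X 0 w = 1}"
    by (rule I[OF i(2) that dens(4)]) simp_all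
  show "passage_density (cond_start M X 1) v X y (2 * n + 1) ?desc"
    if "0 < prob {w \<in> space M. X 0 w = 1}"
    unfolding desc[symmetric] by (rule I[OF i(2) that dens(1) desc_nn]; assumption)
  show "passage_density (cond_start M X 0) v X y (2 * n + 2) ?climb"
    if "0 < prob {w \<in> space M. X 0 w = 0}"
    unfolding climb[symmetric] by (rule I[OF i(1) that dens(2) climb_nn]; assumption)
qed

end

text \<open>Negating level and velocities preserves the passage time and both occupation times; only
  the denominator of \<open>tel_theta\<close> changes sign, hence the modulus.\<close>

lemma reflection:
  "passage_density P (\<lambda>i. - v i) X (- y) n f = passage_density P v X y n f"
  "passage_law P (\<lambda>i. - v i) X (- y) = passage_law P v X y"
  "tel_xi (\<lambda>i. - v i) i t (- y) = tel_xi v i t y"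
  "tel_z lam (\<lambda>i. - v i) t (- y) = tel_z lam v t y"
  "tel_I0 lam (\<lambda>i. - v i) t (- y) = tel_I0 lam v t y"
  "tel_I1 lam (\<lambda>i. - v i) t (- y) = tel_I1 lam v t y"
  "\<bar>tel_theta lam (\<lambda>i. - v i) t (- y)\<bar> = \<bar>tel_theta lam v t y\<bar>"
proof -
  have m: "(- a - - b * t) / (- c - - d) = (a - b * t) / (c - d)"
    "(- c * t - - a) / (- c - - d) = (c * t - a) / (c - d)" for a b c d t :: real
  proof -
    have "(- a - - b * t) / (- c - - d) = - (a - b * t) / - (c - d)" by (intro arg_cong2[where f="(/)"]) simp_all
    then show "(- a - - b * t) / (- c - - d) = (a - b * t) / (c - d)" by (simp only: minus_divide_divide)
    have "(- c * t - - a) / (- c - - d) = - (c * t - a) / - (c - d)" by (intro arg_cong2[where f="(/)"]) simp_all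
    then show "(- c * t - - a) / (- c - - d) = (c * t - a) / (c - d)" by (simp only: minus_divide_divide)
  qed
  show xi: "tel_xi (\<lambda>i. - v i) i t (- y) = tel_xi v i t y" for i
    unfolding tel_xi_def m ..
  show z: "tel_z lam (\<lambda>i. - v i) t (- y) = tel_z lam v t y"
    unfolding tel_z_def xi ..
  show "tel_I0 lam (\<lambda>i. - v i) t (- y) = tel_I0 lam v t y" "tel_I1 lam (\<lambda>i. - v i) t (- y) = tel_I1 lam v t y"
    unfolding tel_I0_def tel_I1_def z by (rule refl)+
  show "\<bar>tel_theta lam (\<lambda>i. - v i) t (- y)\<bar> = \<bar>tel_theta lam v t y\<bar>"
    unfolding tel_theta_def xi by (simp add: abs_minus_commute)
  show "passage_density P (\<lambda>i. - v i) X (- y) n f = passage_density P v X y n f"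
    "passage_law P (\<lambda>i. - v i) X (- y) = passage_law P v X y"
    unfolding passage_density_def passage_law_def passage_time_uminus by (rule refl)+
qed

lemma two_state_markovE:
  assumes "two_state_markov M lam X" "0 < lam 0" "0 < lam 1"
  obtains p where "two_state M lam X p"
proof -
  from assms(1) obtain p where ps: "prob_space M"
    and meas: "\<forall>t\<ge>0. X t \<in> M \<rightarrow>\<^sub>M count_space {0, 1}"
    and cad: "\<forall>w\<in>space M. cadlag_path (\<lambda>t. X t w)"
    and mk: "\<forall>(n::nat) (\<tau> :: nat \<Rightarrow> real) (s :: nat \<Rightarrow> nat).
           0 \<le> \<tau> 0 \<and> strict_mono_on {..Suc n} \<tau> \<and> (\<forall>k\<le>Suc n. s k \<in> {0, 1}) \<and>
           \<P>(w in M. \<forall>k\<le>n. X (\<tau> k) w = s k) > 0 \<longrightarrow>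
           \<P>(w in M. X (\<tau> (Suc n)) w = s (Suc n) \<bar> \<forall>k\<le>n. X (\<tau> k) w = s k)
             = p (\<tau> (Suc n) - \<tau> n) (s n) (s (Suc n))"
    and rt: "\<forall>i\<in>{0, 1}. ((\<lambda>h. p h i (1 - i) / h) \<longlongrightarrow> lam i) (at_right 0)"
    unfolding two_state_markov_def by blast
  have "two_state M lam X p"
    unfolding two_state_def two_state_axioms_def
    using ps meas cad mk rt assms(2,3) by blast
  then show thesis by (rule that)
qed

context two_state
begin

text \<open>Free of any order of the velocities and with the modulus of \<open>tel_theta\<close>, so
  that reflection, which reverses the order, maps the predicate to itself. Bundling all claims makes
  the negative case a single rewriting.\<close>

definition same_sign_laws :: "(nat \<Rightarrow> real) \<Rightarrow> real \<Rightarrow> bool" where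
  "same_sign_laws v y \<longleftrightarrow> passage_time v X y \<in> borel_measurable M \<and>
    (\<exists>C::real. AE w in M. passage_time v X y w \<le> ereal C) \<and>
    prob {w \<in> space M. passage_time v X y w \<in> ereal ` closed_segment (y / v 0) (y / v 1)} = 1 \<and>
    (\<forall>i\<in>{0, 1}. 0 < prob {w \<in> space M. X 0 w = i} \<longrightarrow>
      (\<forall>n. passage_density (cond_start M X i) v X y (2 * n + 1) (\<lambda>t. lam i * \<bar>v (1 - i)\<bar> *
          (tel_z lam v t y ^ n / (fact n)\<^sup>2) * \<bar>tel_theta lam v t y\<bar> *
          indicator (closed_segment (y / v 0) (y / v 1)) t) \<and>
        passage_density (cond_start M X i) v X y (2 * n + 2) (\<lambda>t. lam 0 * lam 1 * \<bar>v i\<bar> *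
          tel_xi v i t y * (tel_z lam v t y ^ n / (fact n * fact (n + 1))) * \<bar>tel_theta lam v t y\<bar> *
          indicator (closed_segment (y / v 0) (y / v 1)) t)) \<and>
      (\<forall>A\<in>sets borel. emeasure (passage_law (cond_start M X i) v X y) (ereal ` A) =
        ennreal (exp (- lam i * y / v i)) * indicator A (y / v i) +
        (\<integral>\<^sup>+t\<in>A. ennreal (lam i * (\<bar>v (1 - i)\<bar> * tel_I0 lam v t y +
          lam (1 - i) * \<bar>v i\<bar> * tel_xi v i t y * tel_I1 lam v t y) * \<bar>tel_theta lam v t y\<bar> *
          indicator (closed_segment (y / v 0) (y / v 1)) t) \<partial>lborel)))"

lemma same_sign_laws_pos:
  assumes "0 < y" "0 < v 0" "0 < v 1" "v 0 \<noteq> v 1"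
  shows "same_sign_laws v y"
  unfolding same_sign_laws_def
  by (intro conjI ballI impI allI passage_time_measurable same_sign_range same_sign_passage_density
      same_sign_passage_law assms)

lemma same_sign_laws_reflect: "same_sign_laws (\<lambda>i. - v i) (- y) = same_sign_laws v y"
  unfolding same_sign_laws_def reflection passage_time_uminus minus_divide_divide abs_minus_cancel mult_minus_right ..

lemma same_sign_laws:
  assumes "(0 < y \<and> 0 < v 0 \<and> 0 < v 1) \<or> (y < 0 \<and> v 0 < 0 \<and> v 1 < 0)" "v 0 \<noteq> v 1"
  shows "same_sign_laws v y"
  using assms same_sign_laws_pos[of y v] same_sign_laws_pos[of "- y" "\<lambda>i. - v i"]
  unfolding same_sign_laws_reflect by auto

end

theorem theorem2p1:
  fixes M :: "'a measure" and \<epsilon> :: "real \<Rightarrow> 'a \<Rightarrow> nat"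
    and lam \<gamma> :: "nat \<Rightarrow> real" and y :: real
  assumes lam: "lam 0 > 0" "lam 1 > 0"
    and gam: "\<gamma> 0 > \<gamma> 1"
    and markov: "two_state_markov M lam \<epsilon>"
  defines "T \<equiv> passage_time \<gamma> \<epsilon> y"
    and "P \<equiv> cond_start M \<epsilon>"
    and "\<Delta> \<equiv> closed_segment (y / \<gamma> 0) (y / \<gamma> 1)"
    and "\<xi> \<equiv> (\<lambda>i t. tel_xi \<gamma> i t y)"
    and "z \<equiv> (\<lambda>t. tel_z lam \<gamma> t y)"
    and "\<theta> \<equiv> (\<lambda>t. tel_theta lam \<gamma> t y)"
    and "I0 \<equiv> (\<lambda>t. tel_I0 lam \<gamma> t y)"
    and "I1 \<equiv> (\<lambda>t. tel_I1 lam \<gamma> t y)"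
    and "startable \<equiv> (\<lambda>i. \<P>(\<omega> in M. \<epsilon> 0 \<omega> = i) > 0)"
  shows
    "((0 < y \<and> 0 < \<gamma> 0 \<and> 0 < \<gamma> 1) \<or> (y < 0 \<and> \<gamma> 0 < 0 \<and> \<gamma> 1 < 0) \<longrightarrow>
        T \<in> borel_measurable M \<and>
        (\<exists>C::real. AE \<omega> in M. T \<omega> \<le> ereal C) \<and>
        \<P>(\<omega> in M. T \<omega> \<in> ereal ` \<Delta>) = 1 \<and>
        (\<forall>i\<in>{0, 1}. startable i \<longrightarrow> (\<forall>n.
           passage_density (P i) \<gamma> \<epsilon> y (2 * n + 1)
             (\<lambda>t. lam i * \<bar>\<gamma> (1 - i)\<bar> * (z t ^ n / (fact n)\<^sup>2) * \<theta> t * indicator \<Delta> t) \<and>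
           passage_density (P i) \<gamma> \<epsilon> y (2 * n + 2)
             (\<lambda>t. lam 0 * lam 1 * \<bar>\<gamma> i\<bar> * \<xi> i t * (z t ^ n / (fact n * fact (n + 1))) * \<theta> t
                  * indicator \<Delta> t))) \<and>
        (startable 0 \<longrightarrow> (\<forall>A\<in>sets borel.
           emeasure (passage_law (P 0) \<gamma> \<epsilon> y) (ereal ` A) =
             ennreal (exp (- lam 0 * y / \<gamma> 0)) * indicator A (y / \<gamma> 0) +
             (\<integral>\<^sup>+t\<in>A. ennreal (lam 0 * (\<bar>\<gamma> 1\<bar> * I0 t + lam 1 * \<bar>\<gamma> 0\<bar> * \<xi> 0 t * I1 t) * \<theta> t
                              * indicator \<Delta> t) \<partial>lborel))) \<and>
        (startable 1 \<longrightarrow> (\<forall>A\<in>sets borel.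
           emeasure (passage_law (P 1) \<gamma> \<epsilon> y) (ereal ` A) =
             ennreal (exp (- lam 1 * y / \<gamma> 1)) * indicator A (y / \<gamma> 1) +
             (\<integral>\<^sup>+t\<in>A. ennreal (lam 1 * (\<bar>\<gamma> 0\<bar> * I0 t + lam 0 * \<bar>\<gamma> 1\<bar> * \<xi> 1 t * I1 t) * \<theta> t
                              * indicator \<Delta> t) \<partial>lborel))))
     \<and> ((y < 0 \<and> 0 < \<gamma> 1 \<and> \<gamma> 1 \<le> \<gamma> 0) \<or> (y > 0 \<and> 0 > \<gamma> 0 \<and> \<gamma> 0 \<ge> \<gamma> 1) \<longrightarrow>
        (AE \<omega> in M. T \<omega> = \<infinity>))
     \<and> (\<gamma> 0 > 0 \<and> 0 > \<gamma> 1 \<and> y > 0 \<longrightarrow> (\<forall>n.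
        (startable 0 \<longrightarrow> passage_density (P 0) \<gamma> \<epsilon> y (2 * n + 1) (\<lambda>t. 0)) \<and>
        (startable 1 \<longrightarrow> passage_density (P 1) \<gamma> \<epsilon> y (2 * n + 2) (\<lambda>t. 0)) \<and>
        (startable 1 \<longrightarrow> passage_density (P 1) \<gamma> \<epsilon> y (2 * n + 1)
           (\<lambda>t. lam 1 / \<xi> 0 t * (z t ^ n / (fact n)\<^sup>2) * \<theta> t * (y - \<gamma> 1 / (n + 1) * \<xi> 1 t)
                * indicator {y / \<gamma> 0<..} t)) \<and>
        (startable 0 \<longrightarrow> passage_density (P 0) \<gamma> \<epsilon> y (2 * n + 2)
           (\<lambda>t. lam 0 * lam 1 * y * (z t ^ n / (fact n * fact (n + 1))) * \<theta> t
                * indicator {y / \<gamma> 0<..} t))))"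
proof -
  obtain p where "two_state M lam \<epsilon> p" using two_state_markovE[OF markov lam] .
  then interpret two_state M lam \<epsilon> p .
  note defs = assms(5-13)
  \<comment> \<open>Here the order of the velocities enters: it makes \<open>tel_theta\<close>
    positive and removes the modulus.\<close>
  have th: "\<bar>tel_theta lam \<gamma> t y\<bar> = tel_theta lam \<gamma> t y" for t
    using gam unfolding tel_theta_def by simp
  have ne: "\<gamma> 0 \<noteq> \<gamma> 1" using gam by simp
  show ?thesis
    unfolding defs
  proof (rule conjI, rule impI, goal_cases)
    case 1
    from same_sign_laws[OF this ne, unfolded same_sign_laws_def th] show ?case by auto
  next
    case 2
    show ?case
      using passage_time_never[of y \<gamma>] opposite_sign_passage_density[of y \<gamma>] by (auto intro!: AE_I2)
  qed
qed

end
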